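(* Let $\tau\in\mathrm{MRDS}(\mathrm{Rat}_+)$ be a mean stable system with associated directed graph $(V,E)$. Then there exists $\alpha<0$ such that for each $z\in\widehat{\mathbb C}$ there exists a Borel set $\mathfrak F\subset(\mathrm{Rat}_+\times E)^{\mathbb N}$ with $\tilde\tau(\mathfrak F)=1$ such that for every $(f_n,e_n)_{n=1}^\infty\in\mathfrak F$ we have $$\limsup_{n\to\infty}\frac1n\log\|D(f_n\circ\dots\circ f_1)(z)\|\le\alpha.$$ Here $Dg(z)$ denotes the complex differential of a holomorphic map $g$ at $z$ and $\|\cdot\|$ denotes the norm with respect to the spherical metric.
   Context: Let $d$ be the spherical distance on the Riemann sphere $\widehat{\mathbb C}$. $\mathrm{Rat}_+$ is the space of all rational maps $\widehat{\mathbb C}\to\widehat{\mathbb C}$ of degree two or more, with metric $\kappa(f,g)=\sup_{z\in\widehat{\mathbb C}}d(f(z),g(z))$. Markov random dynamical system (MRDS): for some $q\in\mathbb N$, a family $\tau=(\tau_{ij})_{i,j=1,\dots,q}$ of regular Borel measures on $\mathrm{Rat}_+$ with $\sum_{j=1}^q\tau_{ij}(\mathrm{Rat}_+)=1$ for all $i$. Its associated directed graph $(V,E)$ has $V=\{1,\dots,q\}$ and $E=\{(i,j)\in V\times V;\tau_{ij}(\mathrm{Rat}_+)>0\}$; for $e=(i,j)\in E$ put $i(e)=i$, $t(e)=j$, $\tau_e=\tau_{ij}$, $\Gamma_e=\operatorname{supp}\tau_e$ (topological support). $S_\tau=(V,E,(\Gamma_e)_{e\in E})$. $\tau$ is irreducible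 if $(V,E)$ is strongly connected. For $X\subset\mathrm{Rat}_+$, $\mathrm{MRDS}(X)$ is the set of all irreducible MRDSs $\tau$ such that $\operatorname{supp}\tau_e$ is compact and contained in $X$ for every $e\in E$. A word $e=(e_1,\dots,e_N)\in E^N$ is admissible if $t(e_n)=i(e_{n+1})$ for $n=1,\dots,N-1$; put $i(e)=i(e_1)$, $t(e)=t(e_N)$. $H_i^j(S_\tau)$ is the set of all compositions $f_N\circ\dots\circ f_1$ with $N\in\mathbb N$, $f_n\in\Gamma_{e_n}$, $(e_1,\dots,e_N)$ admissible, $i(e_1)=i$, $t(e_N)=j$. $F_i(S_\tau)$ is the set of $z\in\widehat{\mathbb C}$ having a neighborhood on which $\bigcup_{j\in V}H_i^j(S_\tau)$ is equicontinuous. Mean stable: there exist $N\in\mathbb N$ and families of non-empty open sets $(U_i)_{i\in V}$, $(W_i)_{i\in V}$ such that (I) $U_i\subset\overline{U_i}\subset W_i\subset\overline{W_i}\subset F_i(S_\tau)$ for each $i$; (II) for each admissible word $e=(e_1,\dots,e_N)$ of length $N$ and all $f_n\in\Gamma_{e_n}$, $\overline{f_N\circ\dots\circ f_1(W_{i(e)})}\subset U_{t(e)}$; (III) for each $z\in\widehat{\mathbb C}$ and $i\in V$ there exist $j\in V$ and $h\in H_i^j(S_\tau)$ with $h(z)\in W_j$. Measures: for irreducible $\tau$ put $P=(\tau_{ij}(\mathrm{Rat}_+))_{i,j\in V}$; $p=(p_1,\dots,p_q)$ is the unique vector with $pP=p$, $\sum_ip_i=1$, $p_i>0$. For $i\in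 V$, $\tilde\tau_i$ is the Borel probability measure on $(\mathrm{Rat}_+\times E)^{\mathbb N}$ such that for all $N$, Borel sets $A_1,\dots,A_N\subset\mathrm{Rat}_+$ and $(e_1,\dots,e_N)\in E^N$, the cylinder $(A_1\times\{e_1\})\times\dots\times(A_N\times\{e_N\})\times\prod_{N+1}^\infty(\mathrm{Rat}_+\times E)$ has measure $\tau_{e_1}(A_1)\cdots\tau_{e_N}(A_N)$ if $(e_1,\dots,e_N)$ is admissible with $i(e_1)=i$, and $0$ otherwise. $\tilde\tau=\sum_{i\in V}p_i\tilde\tau_i$. *)

theory Defs
  imports
    "HOL-Analysis.Analysis"
    "HOL-Computational_Algebra.Computational_Algebra"
begin

section \<open>The Riemann sphere with its spherical distance\<close>

datatype rsphere = Fin complex | Infty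

text \<open>The inverse stereographic projection onto the unit sphere of
  \<^typ>\<open>complex \<times> real\<close>, a copy of \<open>\<real>\<^sup>3\<close>.\<close>

fun stereo :: "rsphere \<Rightarrow> complex \<times> real" where
  "stereo (Fin z) =
     (complex_of_real (2 / (1 + (cmod z)\<^sup>2)) * z, ((cmod z)\<^sup>2 - 1) / (1 + (cmod z)\<^sup>2))"
| "stereo Infty = (0, 1)"

lemma one_plus_cmod_sq_pos: "1 + (cmod z)\<^sup>2 > 0"
  by (simp add: add_pos_nonneg)

lemma stereo_self: "stereo x \<bullet> stereo x = 1"
proof (cases x)
  case (Fin z)
  define r where "r = (cmod z)\<^sup>2"
  have r: "1 + r > 0" unfolding r_def by (rule one_plus_cmod_sq_pos)
  have "norm (stereo x) ^ 2 = (2 / (1 + r))\<^sup>2 * r + ((r - 1) / (1 + r))\<^sup>2"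
    by (simp add: Fin norm_Pair norm_mult norm_divide power_mult_distrib r_def flip: of_real_add of_real_divide of_real_power)
       (simp add: power_divide)
  also have "\<dots> = (4 * r + (r - 1)\<^sup>2) / (1 + r)\<^sup>2"
    by (simp add: power_divide add_divide_distrib power2_eq_square)
  also have "4 * r + (r - 1)\<^sup>2 = (1 + r)\<^sup>2"
    by (simp add: power2_eq_square algebra_simps)
  also have "(1 + r)\<^sup>2 / (1 + r)\<^sup>2 = 1"
    using r by simp
  finally show ?thesis
    by (simp add: power2_norm_eq_inner)
qed (simp add: inner_Pair)

lemma norm_stereo: "norm (stereo x) = 1"
  using stereo_self[of x] by (simp add: norm_eq_sqrt_inner)

lemma stereo_inj: "stereo x = stereo y \<Longrightarrow> x = y"
proof -
  have ht: "((cmod z)\<^sup>2 - 1) / (1 + (cmod z)\<^sup>2) = 1 - 2 / (1 + (cmod z)\<^sup>2)" for z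
    using one_plus_cmod_sq_pos[of z] by (simp add: field_simps)
  have ne: "((cmod z)\<^sup>2 - 1) / (1 + (cmod z)\<^sup>2) \<noteq> 1" for z
    unfolding ht using one_plus_cmod_sq_pos[of z] by simp
  assume eq: "stereo x = stereo y"
  show "x = y"
  proof (cases x; cases y)
    fix z w assume xy: "x = Fin z" "y = Fin w"
    define c where "c = 2 / (1 + (cmod z)\<^sup>2)"
    define d where "d = 2 / (1 + (cmod w)\<^sup>2)"
    have cd: "c = d" using eq unfolding xy stereo.simps ht c_def d_def by simp
    have c0: "c \<noteq> 0" using one_plus_cmod_sq_pos[of z] unfolding c_def by simp
    have "complex_of_real c * z = complex_of_real d * w"
      using eq unfolding xy stereo.simps c_def d_def by (rule Pair_inject)
    with cd c0 show ?thesis by (simp add: xy)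
  qed (use eq ne ne[symmetric] in auto)
qed

lemma angle_triangle:
  fixes u v w :: "'a :: real_inner"
  assumes "norm u = 1" "norm v = 1" "norm w = 1"
  shows "arccos (u \<bullet> w) \<le> arccos (u \<bullet> v) + arccos (v \<bullet> w)"
proof -
  have b: "-1 \<le> x \<bullet> y \<and> x \<bullet> y \<le> 1" if "norm x = 1" "norm y = 1" for x y :: 'a
    using Cauchy_Schwarz_ineq2[of x y] that by auto
  let ?a = "arccos (u \<bullet> v)" and ?b = "arccos (v \<bullet> w)"
  have uv: "-1 \<le> u \<bullet> v" "u \<bullet> v \<le> 1" and vw: "-1 \<le> v \<bullet> w" "v \<bullet> w \<le> 1"
    and uw: "-1 \<le> u \<bullet> w" "u \<bullet> w \<le> 1"
    using b assms by auto
  show ?thesis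
  proof (cases "?a + ?b \<le> pi")
    case True
    define x where "x = u - (u \<bullet> v) *\<^sub>R v"
    define y where "y = w - (v \<bullet> w) *\<^sub>R v"
    have s: "u \<bullet> u = 1" "v \<bullet> v = 1" "w \<bullet> w = 1"
      using assms by (simp_all add: norm_eq_1)
    have nx: "norm x = sqrt (1 - (u \<bullet> v)\<^sup>2)" and ny: "norm y = sqrt (1 - (v \<bullet> w)\<^sup>2)"
      unfolding norm_eq_sqrt_inner x_def y_def
      by (simp_all add: inner_diff_left inner_diff_right s inner_commute power2_eq_square
            algebra_simps)
    have xy: "x \<bullet> y = u \<bullet> w - (u \<bullet> v) * (v \<bullet> w)"
      by (simp add: x_def y_def inner_diff_left inner_diff_right s inner_commute algebra_simps)
    have "cos (?a + ?b) = (u \<bullet> v) * (v \<bullet> w) - norm x * norm y"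
      using uv vw by (simp add: cos_add nx ny sin_arccos)
    also have "\<dots> \<le> (u \<bullet> v) * (v \<bullet> w) + x \<bullet> y"
      using Cauchy_Schwarz_ineq2[of x y] by auto
    also have "\<dots> = u \<bullet> w" by (simp add: xy)
    finally have "arccos (u \<bullet> w) \<le> arccos (cos (?a + ?b))"
      using uw by (intro arccos_le_arccos) auto
    also have "\<dots> = ?a + ?b"
      using True uv vw by (intro arccos_cos add_nonneg_nonneg arccos_lbound)
    finally show ?thesis .
  next
    case False
    then show ?thesis using arccos_ubound[of "u \<bullet> w"] uw by linarith
  qed
qed

instantiation rsphere :: metric_space
begin

text \<open>The geodesic distance of the metric \<open>2 |dz| / (1 + |z|\<^sup>2)\<close>,
  i.e. the angle between the two points of the unit sphere.\<close>

definition dist_rsphere :: "rsphere \<Rightarrow> rsphere \<Rightarrow> real" where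
  "dist_rsphere x y = arccos (stereo x \<bullet> stereo y)"

definition uniformity_rsphere :: "(rsphere \<times> rsphere) filter" where
  "uniformity_rsphere = (INF e\<in>{0 <..}. principal {(x, y). dist x y < e})"

definition open_rsphere :: "rsphere set \<Rightarrow> bool" where
  "open_rsphere S = (\<forall>x\<in>S. \<forall>\<^sub>F (x', y) in uniformity. x' = x \<longrightarrow> y \<in> S)"

instance
proof
  show "dist x y = 0 \<longleftrightarrow> x = y" for x y :: rsphere
  proof
    assume "dist x y = 0"
    have b: "-1 \<le> stereo x \<bullet> stereo y" "stereo x \<bullet> stereo y \<le> 1"
      using Cauchy_Schwarz_ineq2[of "stereo x" "stereo y"] by (auto simp: norm_stereo)
    have "cos (arccos (stereo x \<bullet> stereo y)) = 1"
      using \<open>dist x y = 0\<close> by (simp add: dist_rsphere_def)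
    then have "stereo x \<bullet> stereo y = 1"
      using b by simp
    then have "(stereo x - stereo y) \<bullet> (stereo x - stereo y) = 0"
      by (simp add: inner_diff_left inner_diff_right stereo_self inner_commute)
    then show "x = y"
      using stereo_inj by simp
  qed (simp add: dist_rsphere_def stereo_self)
  show "dist x y \<le> dist x z + dist y z" for x y z :: rsphere
    using angle_triangle[of "stereo x" "stereo z" "stereo y"]
    by (simp add: dist_rsphere_def norm_stereo inner_commute)
qed (simp_all only: uniformity_rsphere_def open_rsphere_def)

end

lemma dist_rsphere_le_pi: "dist (x :: rsphere) y \<le> pi"
  using Cauchy_Schwarz_ineq2[of "stereo x" "stereo y"]
  by (auto simp: dist_rsphere_def norm_stereo intro!: arccos_ubound)


section \<open>Rational maps\<close>

text \<open>The self-map of the sphere given by \<open>P / Q\<close> for coprime \<open>P\<close>, \<open>Q\<close>; its degree is the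
  maximum of the two degrees.\<close>

definition rat_degree :: "complex poly \<Rightarrow> complex poly \<Rightarrow> nat" where
  "rat_degree P Q = max (degree P) (degree Q)"

fun rat_eval :: "complex poly \<Rightarrow> complex poly \<Rightarrow> rsphere \<Rightarrow> rsphere" where
  "rat_eval P Q (Fin z) = (if poly Q z = 0 then Infty else Fin (poly P z / poly Q z))"
| "rat_eval P Q Infty =
     (let n = rat_degree P Q
      in if coeff Q n = 0 then Infty else Fin (coeff P n / coeff Q n))"

typedef ratmap =
  "{rat_eval P Q | P Q. coprime P Q \<and> rat_degree P Q \<ge> 2}"
  morphisms app Abs_ratmap
proof -
  have "coprime (monom 1 2) (1 :: complex poly) \<and> rat_degree (monom 1 2) 1 \<ge> 2"
    by (simp add: rat_degree_def degree_monom_eq)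
  then show ?thesis by blast
qed

instantiation ratmap :: metric_space
begin

definition dist_ratmap :: "ratmap \<Rightarrow> ratmap \<Rightarrow> real" where
  "dist_ratmap f g = (SUP z. dist (app f z) (app g z))"

definition uniformity_ratmap :: "(ratmap \<times> ratmap) filter" where
  "uniformity_ratmap = (INF e\<in>{0 <..}. principal {(x, y). dist x y < e})"

definition open_ratmap :: "ratmap set \<Rightarrow> bool" where
  "open_ratmap S = (\<forall>x\<in>S. \<forall>\<^sub>F (x', y) in uniformity. x' = x \<longrightarrow> y \<in> S)"

instance
proof
  have le: "dist (app f z) (app g z) \<le> dist f g" for f g z
    unfolding dist_ratmap_def
    by (rule cSUP_upper) (auto intro!: bdd_aboveI2 dist_rsphere_le_pi)
  show "dist f g = 0 \<longleftrightarrow> f = g" for f g :: ratmap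
  proof
    assume "dist f g = 0"
    then have "app f z = app g z" for z
      using le[of f z g] by simp
    then show "f = g" by (simp add: app_inject fun_eq_iff flip: app_inject)
  qed (simp add: dist_ratmap_def)
  show "dist f g \<le> dist f h + dist g h" for f g h :: ratmap
  proof -
    have "dist (app f z) (app g z) \<le> dist f h + dist g h" for z
      using dist_triangle2[of "app f z" "app g z" "app h z"] le[of f z h] le[of g z h]
      by linarith
    then show ?thesis
      unfolding dist_ratmap_def[of f g] by (intro cSUP_least) auto
  qed
qed (simp_all only: uniformity_ratmap_def open_ratmap_def)

end

definition comp_maps :: "ratmap list \<Rightarrow> rsphere \<Rightarrow> rsphere" where
  "comp_maps fs = fold (\<lambda>f g. app f \<circ> g) fs id"

lemma comp_maps_two: "comp_maps [f1, f2] = app f2 \<circ> app f1"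
  by (simp add: comp_maps_def)


section \<open>The spherical norm of the derivative\<close>

text \<open>\<open>affine_coord x\<close> is the chart centred at infinity if \<open>x = Infty\<close> and the standard
  affine chart otherwise; \<open>affine_param x\<close> is its inverse.  The value at the one point of
  the sphere outside the chart domain is immaterial.  The spherical metric has the density
  \<open>2 / (1 + |t|\<^sup>2)\<close> in both charts because \<open>z \<mapsto> 1/z\<close> is a rotation.\<close>

definition affine_coord :: "rsphere \<Rightarrow> rsphere \<Rightarrow> complex" where
  "affine_coord x y =
     (case y of
        Fin z \<Rightarrow> (if x = Infty then inverse z else z)
      | Infty \<Rightarrow> 0)"

definition affine_param :: "rsphere \<Rightarrow> complex \<Rightarrow> rsphere" where
  "affine_param x t =
     (if x = Infty then (if t = 0 then Infty else Fin (inverse t)) else Fin t)"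

definition sph_density :: "complex \<Rightarrow> real" where
  "sph_density t = 2 / (1 + (cmod t)\<^sup>2)"

definition chart_deriv :: "(rsphere \<Rightarrow> rsphere) \<Rightarrow> rsphere \<Rightarrow> complex" where
  "chart_deriv g x = deriv (affine_coord (g x) \<circ> g \<circ> affine_param x) (affine_coord x x)"

text \<open>Operator norm of the differential from the tangent line at \<open>x\<close> to that at \<open>g x\<close>.\<close>

definition sph_deriv_norm :: "(rsphere \<Rightarrow> rsphere) \<Rightarrow> rsphere \<Rightarrow> real" where
  "sph_deriv_norm g x =
     sph_density (affine_coord (g x) (g x)) * cmod (chart_deriv g x)
       / sph_density (affine_coord x x)"

text \<open>The logarithm on \<open>[0, \<infinity>)\<close> with \<open>log 0 = -\<infinity>\<close>, whereas \<open>ln 0 = 0\<close> in HOL.\<close>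

definition ext_ln :: "real \<Rightarrow> ereal" where
  "ext_ln x = (if x = 0 then -\<infinity> else ereal (ln x))"


section \<open>Markov random dynamical systems\<close>

definition regular_measure :: "'a :: topological_space measure \<Rightarrow> bool" where
  "regular_measure M \<longleftrightarrow>
     (\<forall>B\<in>sets M.
        emeasure M B = (INF U\<in>{U. B \<subseteq> U \<and> open U}. emeasure M U) \<and>
        emeasure M B = (SUP K\<in>{K. K \<subseteq> B \<and> compact K}. emeasure M K))"

definition topological_support :: "'a :: topological_space measure \<Rightarrow> 'a set" where
  "topological_support M = {x. \<forall>U. open U \<and> x \<in> U \<longrightarrow> emeasure M U > 0}"

type_synonym edge = "nat \<times> nat"
type_synonym system = "nat \<Rightarrow> nat \<Rightarrow> ratmap measure"

abbreviation verts :: "nat \<Rightarrow> nat set" where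
  "verts q \<equiv> {1..q}"

definition is_MRDS :: "nat \<Rightarrow> system \<Rightarrow> bool" where
  "is_MRDS q \<tau> \<longleftrightarrow>
     q \<ge> 1 \<and>
     (\<forall>i\<in>verts q. \<forall>j\<in>verts q. sets (\<tau> i j) = sets borel \<and> regular_measure (\<tau> i j)) \<and>
     (\<forall>i\<in>verts q. (\<Sum>j\<in>verts q. emeasure (\<tau> i j) UNIV) = 1)"

definition edges :: "nat \<Rightarrow> system \<Rightarrow> edge set" where
  "edges q \<tau> = {(i, j). i \<in> verts q \<and> j \<in> verts q \<and> emeasure (\<tau> i j) UNIV > 0}"

definition edge_measure :: "system \<Rightarrow> edge \<Rightarrow> ratmap measure" where
  "edge_measure \<tau> e = \<tau> (fst e) (snd e)"

definition edge_support :: "system \<Rightarrow> edge \<Rightarrow> ratmap set" where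
  "edge_support \<tau> e = topological_support (edge_measure \<tau> e)"

definition irreducible_system :: "nat \<Rightarrow> system \<Rightarrow> bool" where
  "irreducible_system q \<tau> \<longleftrightarrow> (\<forall>i\<in>verts q. \<forall>j\<in>verts q. (i, j) \<in> (edges q \<tau>)\<^sup>*)"

definition MRDS :: "nat \<Rightarrow> ratmap set \<Rightarrow> system set" where
  "MRDS q X =
     {\<tau>. is_MRDS q \<tau> \<and> irreducible_system q \<tau> \<and>
         (\<forall>e\<in>edges q \<tau>. compact (edge_support \<tau> e) \<and> edge_support \<tau> e \<subseteq> X)}"

definition admissible :: "edge set \<Rightarrow> edge list \<Rightarrow> bool" where
  "admissible E es \<longleftrightarrow>
     es \<noteq> [] \<and> set es \<subseteq> E \<and> (\<forall>n. Suc n < length es \<longrightarrow> snd (es ! n) = fst (es ! Suc n))"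

definition word_init :: "edge list \<Rightarrow> nat" where
  "word_init es = fst (hd es)"

definition word_term :: "edge list \<Rightarrow> nat" where
  "word_term es = snd (last es)"

definition maps_along :: "system \<Rightarrow> edge list \<Rightarrow> ratmap list \<Rightarrow> bool" where
  "maps_along \<tau> es fs \<longleftrightarrow> list_all2 (\<lambda>f e. f \<in> edge_support \<tau> e) fs es"

definition semigroup_from_to :: "nat \<Rightarrow> system \<Rightarrow> nat \<Rightarrow> nat \<Rightarrow> (rsphere \<Rightarrow> rsphere) set" where
  "semigroup_from_to q \<tau> i j =
     {comp_maps fs | fs es. admissible (edges q \<tau>) es \<and> maps_along \<tau> es fs \<and>
                            word_init es = i \<and> word_term es = j}"

definition equicontinuous_on ::
  "'a :: metric_space set \<Rightarrow> ('a \<Rightarrow> 'b :: metric_space) set \<Rightarrow> bool" where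
  "equicontinuous_on U H \<longleftrightarrow>
     (\<forall>x\<in>U. \<forall>\<epsilon>>0. \<exists>\<delta>>0. \<forall>h\<in>H. \<forall>y\<in>U. dist y x < \<delta> \<longrightarrow> dist (h y) (h x) < \<epsilon>)"

definition Fatou :: "nat \<Rightarrow> system \<Rightarrow> nat \<Rightarrow> rsphere set" where
  "Fatou q \<tau> i =
     {z. \<exists>U. open U \<and> z \<in> U \<and>
             equicontinuous_on U (\<Union>j\<in>verts q. semigroup_from_to q \<tau> i j)}"

definition mean_stable :: "nat \<Rightarrow> system \<Rightarrow> bool" where
  "mean_stable q \<tau> \<longleftrightarrow>
     (\<exists>N\<ge>1. \<exists>U W :: nat \<Rightarrow> rsphere set.
        (\<forall>i\<in>verts q. open (U i) \<and> U i \<noteq> {} \<and> open (W i) \<and> W i \<noteq> {}) \<and>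
        (\<forall>i\<in>verts q. U i \<subseteq> closure (U i) \<and> closure (U i) \<subseteq> W i \<and>
                      W i \<subseteq> closure (W i) \<and> closure (W i) \<subseteq> Fatou q \<tau> i) \<and>
        (\<forall>es fs. length es = N \<and> admissible (edges q \<tau>) es \<and> maps_along \<tau> es fs \<longrightarrow>
                 closure (comp_maps fs ` W (word_init es)) \<subseteq> U (word_term es)) \<and>
        (\<forall>z. \<forall>i\<in>verts q. \<exists>j\<in>verts q. \<exists>h\<in>semigroup_from_to q \<tau> i j. h z \<in> W j))"


section \<open>Measures on the space of sequences\<close>

text \<open>The measures \<open>\<tau> i j\<close> are finite, so \<open>measure\<close> gives the entries of the
  transition matrix.\<close>

definition stationary_vector :: "nat \<Rightarrow> system \<Rightarrow> (nat \<Rightarrow> real) \<Rightarrow> bool" where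
  "stationary_vector q \<tau> p \<longleftrightarrow>
     (\<forall>j\<in>verts q. (\<Sum>i\<in>verts q. p i * measure (\<tau> i j) UNIV) = p j) \<and>
     (\<Sum>i\<in>verts q. p i) = 1 \<and> (\<forall>i\<in>verts q. p i > 0)"

text \<open>\<open>(Rat\<^sub>+ \<times> E)\<^sup>\<nat>\<close> with the product topology, \<open>E\<close> being discrete.  Sequences are
  indexed from 0, so \<open>\<omega> 0\<close> is the pair \<open>(f\<^sub>1, e\<^sub>1)\<close>.\<close>

definition path_topology :: "edge set \<Rightarrow> (nat \<Rightarrow> ratmap \<times> edge) topology" where
  "path_topology E = product_topology (\<lambda>_. prod_topology euclidean (discrete_topology E)) UNIV"

definition path_borel :: "edge set \<Rightarrow> (nat \<Rightarrow> ratmap \<times> edge) measure" where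
  "path_borel E = sigma (topspace (path_topology E)) {U. openin (path_topology E) U}"

lemma sets_path_borel:
  "sets (path_borel E) = sigma_sets (topspace (path_topology E)) {U. openin (path_topology E) U}"
  unfolding path_borel_def by (intro sets_measure_of) (auto dest: openin_subset)

lemma space_path_borel: "space (path_borel E) = UNIV \<rightarrow>\<^sub>E UNIV \<times> E"
proof -
  have "space (path_borel E) = topspace (path_topology E)"
    unfolding path_borel_def by (intro space_measure_of) (auto dest: openin_subset)
  then show ?thesis by (simp add: path_topology_def)
qed

definition cylinder ::
  "edge set \<Rightarrow> nat \<Rightarrow> (nat \<Rightarrow> ratmap set) \<Rightarrow> (nat \<Rightarrow> edge) \<Rightarrow> (nat \<Rightarrow> ratmap \<times> edge) set" where
  "cylinder E N A e =
     {\<omega> \<in> space (path_borel E). \<forall>n<N. \<omega> n \<in> A n \<times> {e n}}"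

definition is_path_measure ::
  "nat \<Rightarrow> system \<Rightarrow> nat \<Rightarrow> (nat \<Rightarrow> ratmap \<times> edge) measure \<Rightarrow> bool" where
  "is_path_measure q \<tau> i M \<longleftrightarrow>
     sets M = sets (path_borel (edges q \<tau>)) \<and> emeasure M (space M) = 1 \<and>
     (\<forall>N\<ge>1. \<forall>A e. (\<forall>n<N. A n \<in> sets borel \<and> e n \<in> edges q \<tau>) \<longrightarrow>
        emeasure M (cylinder (edges q \<tau>) N A e) =
          (if admissible (edges q \<tau>) (map e [0..<N]) \<and> fst (e 0) = i
           then \<Prod>n<N. emeasure (edge_measure \<tau> (e n)) (A n) else 0))"

text \<open>The measure \<open>\<Sum>i. p i \<cdot> \<mu> i\<close>.\<close>

definition mixture ::
  "nat \<Rightarrow> system \<Rightarrow> (nat \<Rightarrow> real) \<Rightarrow> (nat \<Rightarrow> (nat \<Rightarrow> ratmap \<times> edge) measure)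
    \<Rightarrow> (nat \<Rightarrow> ratmap \<times> edge) measure" where
  "mixture q \<tau> p \<mu> =
     measure_of (space (path_borel (edges q \<tau>))) (sets (path_borel (edges q \<tau>)))
       (\<lambda>B. \<Sum>i\<in>verts q. ennreal (p i) * emeasure (\<mu> i) B)"

lemma sets_mixture: "sets (mixture q \<tau> p \<mu>) = sets (path_borel (edges q \<tau>))"
  unfolding mixture_def by (simp add: sets.space_closed sets.sigma_sets_eq)

lemma emeasure_mixture:
  assumes sets: "\<And>i. i \<in> verts q \<Longrightarrow> sets (\<mu> i) = sets (path_borel (edges q \<tau>))"
    and B: "B \<in> sets (path_borel (edges q \<tau>))"
  shows "emeasure (mixture q \<tau> p \<mu>) B = (\<Sum>i\<in>verts q. ennreal (p i) * emeasure (\<mu> i) B)"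
proof (rule emeasure_measure_of[OF mixture_def])
  show "countably_additive (sets (mixture q \<tau> p \<mu>))
          (\<lambda>B. \<Sum>i\<in>verts q. ennreal (p i) * emeasure (\<mu> i) B)"
  proof (rule countably_additiveI)
    fix A :: "nat \<Rightarrow> _ set"
    assume A: "range A \<subseteq> sets (mixture q \<tau> p \<mu>)" "disjoint_family A"
    have "(\<Sum>n. \<Sum>i\<in>verts q. ennreal (p i) * emeasure (\<mu> i) (A n)) =
          (\<Sum>i\<in>verts q. \<Sum>n. ennreal (p i) * emeasure (\<mu> i) (A n))"
      by (rule suminf_sum) simp
    also have "\<dots> = (\<Sum>i\<in>verts q. ennreal (p i) * emeasure (\<mu> i) (\<Union>n. A n))"
      using A by (intro sum.cong refl) (simp add: suminf_emeasure sets sets_mixture)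
    finally show "(\<Sum>n. \<Sum>i\<in>verts q. ennreal (p i) * emeasure (\<mu> i) (A n)) =
          (\<Sum>i\<in>verts q. ennreal (p i) * emeasure (\<mu> i) (\<Union>n. A n))" .
  qed
qed (use B in \<open>auto simp: positive_def sets_mixture sets.space_closed dest: sets.sets_into_space\<close>)

end

(* Each closure of W i misses a point, because the iterates of a surjective non-injective map of a
   compact space are never equicontinuous; hence W i is a bounded plane domain in a chart. Every
   word of length N maps W i well inside W j, so the Earle--Hamilton argument contracts derivatives
   by a definite factor: orbits that have entered some W i contract exponentially at a uniform
   rate. By (III), compactness of the sphere and openness, finitely many open sets of words of
   positive weight lead every point into some W i, so almost every orbit enters. *)

theory Submission
  imports Defs "HOL-Complex_Analysis.Cauchy_Integral_Formula" "HOL-Computational_Algebra.Field_as_Ring"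
begin

section \<open>Topology of the sphere\<close>

text \<open>The rate must not depend on z. The factor \<beta> is built from the sets
  \<open>U\<close> and \<open>W\<close> alone; whatever depends on the orbit (entry time, derivative
  up to entry, room around the entry point) goes into a constant factor, which disappears after
  taking logarithms and dividing by n. Contraction is known only for whole blocks of N letters, so
  the exponent is ln \<beta> / N. The incomplete last block is harmless because
  \<open>closure (W i)\<close> is a compact subset of the Fatou set, where equicontinuity and
  Cauchy's estimate bound the derivatives of the whole semigroup at once.

  The path measures are prescribed on cylinders only, whereas entering \<open>W\<close> is a
  condition on the position of the orbit. The Markov property is therefore proved for the
  sigma-algebra generated by the rectangles of length n, and the position after n letters is shown
  to be measurable for it.\<close>

definition hom_pt :: "complex \<Rightarrow> complex \<Rightarrow> rsphere" where
  "hom_pt a b = (if b = 0 then Infty else Fin (a / b))"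

text \<open>In homogeneous coordinates [a : b] stereographic projection is a single formula, so
  continuity at infinity needs no case of its own. The hypothesis excludes a = b = 0, where
  \<open>hom_pt\<close> has the default value \<open>Infty\<close>.\<close>

lemma stereo_hom_pt:
  assumes "a \<noteq> 0 \<or> b \<noteq> 0"
  shows "stereo (hom_pt a b) =
    (2 * a * cnj b / of_real ((cmod a)\<^sup>2 + (cmod b)\<^sup>2),
     ((cmod a)\<^sup>2 - (cmod b)\<^sup>2) / ((cmod a)\<^sup>2 + (cmod b)\<^sup>2))"
proof (cases "b = 0")
  case True
  then show ?thesis using assms by (simp add: hom_pt_def)
next
  case False
  define A B where "A = (cmod a)\<^sup>2" and "B = (cmod b)\<^sup>2"
  have AB: "A \<ge> 0" "B > 0" using False by (auto simp: A_def B_def)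
  have e1: "2 / (1 + A / B) = 2 * B / (A + B)" and e2: "(A / B - 1) / (1 + A / B) = (A - B) / (A + B)"
    using AB by (simp_all add: divide_simps)
  have "complex_of_real B = b * cnj b" unfolding B_def by (rule complex_norm_square)
  then have "complex_of_real (2 * B / (A + B)) * (a / b) = 2 * a * cnj b / complex_of_real (A + B)"
    using False by (simp add: field_simps)
  then show ?thesis
    using False by (simp add: hom_pt_def norm_divide power_divide e1 e2 flip: A_def B_def)
qed

lemma cos_dist_rsphere: "cos (dist x y) = stereo x \<bullet> stereo y"
  using Cauchy_Schwarz_ineq2[of "stereo x" "stereo y"]
  by (auto simp: dist_rsphere_def norm_stereo intro!: cos_arccos)

text \<open>A chord of angle d has length 2 sin (d/2). Besides giving continuity of
  \<open>stereo\<close>, this turns a small distance into a small difference of heights on the unit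
  sphere.\<close>

lemma chord_le_dist: "norm (stereo x - stereo y) \<le> dist x y"
proof (rule power2_le_imp_le)
  have "(norm (stereo x - stereo y))\<^sup>2 = 2 - 2 * cos (2 * (dist x y / 2))"
    by (simp add: power2_norm_eq_inner inner_diff_left inner_diff_right stereo_self
        cos_dist_rsphere inner_commute)
  also have "\<dots> = 4 * (sin (dist x y / 2))\<^sup>2"
    by (subst cos_double_sin) simp
  also have "\<dots> = 4 * \<bar>sin (dist x y / 2)\<bar>\<^sup>2" by simp
  also have "\<dots> \<le> 4 * \<bar>dist x y / 2\<bar>\<^sup>2"
    by (intro mult_left_mono power_mono abs_sin_x_le_abs_x) auto
  also have "\<dots> = (dist x y)\<^sup>2" by (simp add: power2_eq_square)
  finally show "(norm (stereo x - stereo y))\<^sup>2 \<le> (dist x y)\<^sup>2" .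
qed simp

lemma tendsto_stereo: "(f \<longlongrightarrow> l) F \<Longrightarrow> ((\<lambda>x. stereo (f x)) \<longlongrightarrow> stereo l) F"
  by (rule metric_tendsto_imp_tendsto) (auto simp: dist_norm chord_le_dist)

lemma tendsto_rsphereI:
  assumes "((\<lambda>x. stereo (f x)) \<longlongrightarrow> stereo l) F"
  shows "(f \<longlongrightarrow> l) F"
proof -
  have b: "stereo (f x) \<bullet> stereo l \<in> {-1..1}" for x
    using Cauchy_Schwarz_ineq2[of "stereo (f x)" "stereo l"] by (auto simp: norm_stereo)
  have "((\<lambda>x. stereo (f x) \<bullet> stereo l) \<longlongrightarrow> stereo l \<bullet> stereo l) F"
    by (intro tendsto_intros assms)
  then have "((\<lambda>x. arccos (stereo (f x) \<bullet> stereo l)) \<longlongrightarrow> arccos (stereo l \<bullet> stereo l)) F"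
    by (rule continuous_on_tendsto_compose[OF continuous_on_arccos'])
       (use b in \<open>auto simp: stereo_self\<close>)
  then show ?thesis
    by (subst tendsto_dist_iff) (simp add: dist_rsphere_def stereo_self)
qed

lemma tendsto_hom_pt:
  assumes "(f \<longlongrightarrow> a) F" "(g \<longlongrightarrow> b) F" "a \<noteq> 0 \<or> b \<noteq> 0"
  shows "((\<lambda>x. hom_pt (f x) (g x)) \<longlongrightarrow> hom_pt a b) F"
proof (rule tendsto_rsphereI)
  have ne: "complex_of_real ((cmod a)\<^sup>2 + (cmod b)\<^sup>2) \<noteq> 0" "(cmod a)\<^sup>2 + (cmod b)\<^sup>2 \<noteq> 0"
    using assms(3) by (auto simp: add_nonneg_eq_0_iff simp flip: of_real_add)
  have "\<forall>\<^sub>F x in F. f x \<noteq> 0 \<or> g x \<noteq> 0"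
    using assms(3)
  proof
    assume "a \<noteq> 0"
    from tendsto_imp_eventually_ne[OF assms(1) this] show ?thesis by eventually_elim simp
  next
    assume "b \<noteq> 0"
    from tendsto_imp_eventually_ne[OF assms(2) this] show ?thesis by eventually_elim simp
  qed
  then have ev: "\<forall>\<^sub>F x in F. (2 * f x * cnj (g x) / of_real ((cmod (f x))\<^sup>2 + (cmod (g x))\<^sup>2),
     ((cmod (f x))\<^sup>2 - (cmod (g x))\<^sup>2) / ((cmod (f x))\<^sup>2 + (cmod (g x))\<^sup>2)) = stereo (hom_pt (f x) (g x))"
    by eventually_elim (simp add: stereo_hom_pt)
  show "((\<lambda>x. stereo (hom_pt (f x) (g x))) \<longlongrightarrow> stereo (hom_pt a b)) F"
    unfolding stereo_hom_pt[OF assms(3)]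
    by (rule Lim_transform_eventually[OF _ ev]) (use ne in \<open>intro tendsto_intros assms(1,2)\<close>)
qed

lemma tendsto_Fin: "(f \<longlongrightarrow> a) F \<Longrightarrow> ((\<lambda>x. Fin (f x)) \<longlongrightarrow> Fin a) F"
  using tendsto_hom_pt[of f a F "\<lambda>_. 1" 1] by (simp add: hom_pt_def)

section \<open>The affine charts and their continuity\<close>

lemma affine_param_hom_pt: "affine_param x t = (if x = Infty then hom_pt 1 t else hom_pt t 1)"
  by (auto simp: affine_param_def hom_pt_def divide_inverse)

lemma tendsto_affine_param:
  "(f \<longlongrightarrow> a) F \<Longrightarrow> ((\<lambda>y. affine_param x (f y)) \<longlongrightarrow> affine_param x a) F"
  unfolding affine_param_hom_pt by (auto intro!: tendsto_hom_pt)

text \<open>The omitted point is the one that \<open>affine_coord x\<close> cannot tell from the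
  origin of the chart: both receive the coordinate 0.\<close>

definition chart_dom :: "rsphere \<Rightarrow> rsphere set" where
  "chart_dom x = (if x = Infty then - {Fin 0} else - {Infty})"

lemma open_chart_dom: "open (chart_dom x)"
  unfolding chart_dom_def by (auto intro: open_Compl)

lemma chart_dom_self: "x \<in> chart_dom x"
  by (simp add: chart_dom_def)

lemma affine_param_coord: "y \<in> chart_dom x \<Longrightarrow> affine_param x (affine_coord x y) = y"
  by (cases y) (auto simp: affine_param_def affine_coord_def chart_dom_def split: if_splits)

text \<open>Projection from one of the two poles recovers the coordinate; the conjugation comes from
  1/z = cnj z / |z|^2. Continuity of a chart is thereby reduced to that of \<open>stereo\<close>,
  wherever the denominator does not vanish.\<close>

lemma affine_coord_stereo:
  "affine_coord x y =
    (if x = Infty then cnj (fst (stereo y)) / of_real (1 + snd (stereo y))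
     else fst (stereo y) / of_real (1 - snd (stereo y)))"
proof (cases y)
  case (Fin z)
  define r where "r = (cmod z)\<^sup>2"
  have r: "1 + r > 0" "1 + r \<noteq> 0" unfolding r_def using one_plus_cmod_sq_pos[of z] by auto
  have e: "1 + (r - 1) / (1 + r) = 2 * r / (1 + r)" "1 - (r - 1) / (1 + r) = 2 / (1 + r)"
    using r by (simp_all add: field_simps)
  have c: "complex_of_real (1 + r) \<noteq> 0" using r(2) by (metis of_real_eq_0_iff)
  have rz: "complex_of_real r = z * cnj z" unfolding r_def by (rule complex_norm_square)
  have "cnj (of_real (2 / (1 + r)) * z) / of_real (2 * r / (1 + r)) = inverse z"
  proof (cases "z = 0")
    case False
    have "cnj (of_real (2 / (1 + r)) * z) / of_real (2 * r / (1 + r)) =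
        (2 * cnj z / of_real (1 + r)) / (2 * of_real r / of_real (1 + r))"
      by simp
    also have "\<dots> = cnj z / of_real r"
      using c by simp
    finally show ?thesis using False by (simp add: rz field_simps)
  qed simp
  moreover have "complex_of_real (2 / (1 + r)) \<noteq> 0"
    using r by (metis of_real_eq_0_iff divide_eq_0_iff zero_neq_numeral)
  then have "of_real (2 / (1 + r)) * z / of_real (2 / (1 + r)) = z"
    by (rule nonzero_mult_div_cancel_left)
  ultimately show ?thesis
    unfolding Fin affine_coord_def stereo.simps r_def[symmetric] fst_conv snd_conv e by simp
qed (simp add: affine_coord_def)

lemma snd_stereo_eq_1: "snd (stereo y) = 1 \<Longrightarrow> y = Infty"
proof -
  assume "snd (stereo y) = 1"
  moreover have "(fst (stereo y)) \<bullet> (fst (stereo y)) + snd (stereo y) * snd (stereo y) = 1"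
    using stereo_self[of y] by (simp add: inner_prod_def)
  ultimately have "stereo y = stereo Infty" by (simp add: prod_eq_iff)
  then show ?thesis by (rule stereo_inj)
qed

lemma snd_stereo_eq_minus_1: "snd (stereo y) = -1 \<Longrightarrow> y = Fin 0"
proof -
  assume "snd (stereo y) = -1"
  moreover have "(fst (stereo y)) \<bullet> (fst (stereo y)) + snd (stereo y) * snd (stereo y) = 1"
    using stereo_self[of y] by (simp add: inner_prod_def)
  ultimately have "stereo y = stereo (Fin 0)" by (simp add: prod_eq_iff)
  then show ?thesis by (rule stereo_inj)
qed

lemma tendsto_affine_coord:
  assumes "(f \<longlongrightarrow> y) F" "y \<in> chart_dom x"
  shows "((\<lambda>u. affine_coord x (f u)) \<longlongrightarrow> affine_coord x y) F"
proof -
  have s: "((\<lambda>x. stereo (f x)) \<longlongrightarrow> stereo y) F" by (rule tendsto_stereo[OF assms(1)])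
  have ne: "x = Infty \<Longrightarrow> 1 + snd (stereo y) \<noteq> 0" "x \<noteq> Infty \<Longrightarrow> 1 - snd (stereo y) \<noteq> 0"
    using assms(2) snd_stereo_eq_1[of y] snd_stereo_eq_minus_1[of y] by (auto simp: chart_dom_def)
  show ?thesis
  proof (cases "x = Infty")
    case True
    then have "complex_of_real (1 + snd (stereo y)) \<noteq> 0"
      using ne by (metis of_real_eq_0_iff)
    then show ?thesis
      unfolding affine_coord_stereo using True by (auto intro!: tendsto_intros s simp del: of_real_add)
  next
    case False
    then have "complex_of_real (1 - snd (stereo y)) \<noteq> 0"
      using ne by (metis of_real_eq_0_iff)
    then show ?thesis
      unfolding affine_coord_stereo using False by (auto intro!: tendsto_intros s simp del: of_real_diff)
  qed
qed

lemma stereo_surj: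
  assumes "norm v = 1"
  shows "\<exists>x. stereo x = v"
proof (cases "snd v = 1")
  case True
  have "fst v \<bullet> fst v + snd v * snd v = 1"
    using assms by (simp add: norm_eq_1 inner_prod_def)
  then have "stereo Infty = v" using True by (simp add: prod_eq_iff)
  then show ?thesis by blast
next
  case False
  define c t where "c = fst v" and "t = snd v"
  have ct: "(cmod c)\<^sup>2 = 1 - t\<^sup>2"
    using assms by (simp add: norm_eq_1 inner_prod_def c_def t_def power2_norm_eq_inner)
      (simp add: power2_eq_square)
  have t: "1 - t \<noteq> 0" using False by (simp add: t_def)
  have "stereo (Fin (c / of_real (1 - t))) = v"
  proof -
    have n: "(cmod (c / of_real (1 - t)))\<^sup>2 = (1 + t) / (1 - t)"
    proof -
      have "(cmod (c / of_real (1 - t)))\<^sup>2 = (1 - t\<^sup>2) / (1 - t)\<^sup>2"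
        by (simp add: norm_divide power_divide ct del: of_real_diff)
      also have "\<dots> = ((1 + t) * (1 - t)) / ((1 - t) * (1 - t))"
        by (simp add: power2_eq_square algebra_simps)
      also have "\<dots> = (1 + t) / (1 - t)"
        using t by simp
      finally show ?thesis .
    qed
    have e: "1 + (1 + t) / (1 - t) = 2 / (1 - t)" "(1 + t) / (1 - t) - 1 = 2 * t / (1 - t)"
      using t by (simp_all add: field_simps)
    have "complex_of_real (1 - t) \<noteq> 0" using t by (metis of_real_eq_0_iff)
    then have "complex_of_real (1 - t) * (c / complex_of_real (1 - t)) = c" by simp
    then show ?thesis
      unfolding stereo.simps n e using t
      by (simp add: prod_eq_iff flip: c_def t_def)
  qed
  then show ?thesis by blast
qed

lemma compact_rsphere: "compact (UNIV :: rsphere set)"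
proof (unfold compact_eq_seq_compact_metric,unfold seq_compact_def, intro allI impI)
  fix f :: "nat \<Rightarrow> rsphere"
  have "\<forall>n. stereo (f n) \<in> sphere 0 1" by (simp add: norm_stereo)
  moreover have "seq_compact (sphere 0 1 :: (complex \<times> real) set)"
    by (rule compact_imp_seq_compact[OF compact_sphere])
  ultimately obtain v r where v: "v \<in> sphere 0 1" "strict_mono r" "((stereo \<circ> f) \<circ> r) \<longlonglongrightarrow> v"
    unfolding seq_compact_def by (metis comp_apply)
  then obtain x where "stereo x = v" using stereo_surj[of v] by auto
  with v(3) have "(f \<circ> r) \<longlonglongrightarrow> x"
    by (intro tendsto_rsphereI) (simp add: o_def)
  with v(2) show "\<exists>l\<in>UNIV. \<exists>r. strict_mono r \<and> (f \<circ> r) \<longlonglongrightarrow> l" by blast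
qed

section \<open>The spherical derivative\<close>

text \<open>Continuity is demanded separately because coordinates alone cannot see it: a map jumping
  between \<open>Fin 0\<close> and \<open>Infty\<close> has the constant coordinate 0.\<close>

definition sph_diff :: "(rsphere \<Rightarrow> rsphere) \<Rightarrow> rsphere \<Rightarrow> bool" where
  "sph_diff g x \<longleftrightarrow> isCont g x \<and>
     (affine_coord (g x) \<circ> g \<circ> affine_param x) field_differentiable at (affine_coord x x)"

lemma affine_param_coord_self [simp]: "affine_param x (affine_coord x x) = x"
  by (simp add: affine_param_coord chart_dom_self)

text \<open>By continuity f maps a neighbourhood of x into the domain of the chart at f x, where
  \<open>affine_param\<close> inverts \<open>affine_coord\<close>; so the coordinate expressions
  compose and the densities at f x cancel.\<close>

lemma sph_diff_chain:
  assumes f: "sph_diff f x" and g: "sph_diff g (f x)"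
  shows "sph_diff (g \<circ> f) x"
    and "sph_deriv_norm (g \<circ> f) x = sph_deriv_norm g (f x) * sph_deriv_norm f x"
proof -
  define t0 where "t0 = affine_coord x x"
  define F where "F = affine_coord (f x) \<circ> f \<circ> affine_param x"
  define G where "G = affine_coord (g (f x)) \<circ> g \<circ> affine_param (f x)"
  have Ft0: "F t0 = affine_coord (f x) (f x)" by (simp add: F_def t0_def)
  have dF: "(F has_field_derivative deriv F t0) (at t0)"
    using f unfolding sph_diff_def F_def t0_def by (simp add: DERIV_deriv_iff_field_differentiable)
  have dG: "(G has_field_derivative deriv G (F t0)) (at (F t0))"
    using g unfolding sph_diff_def Ft0 G_def by (simp add: DERIV_deriv_iff_field_differentiable)
  have cont: "((\<lambda>t. f (affine_param x t)) \<longlongrightarrow> f x) (nhds t0)"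
  proof -
    have "((\<lambda>t. affine_param x t) \<longlongrightarrow> affine_param x t0) (nhds t0)"
      by (intro tendsto_affine_param) (simp add: filterlim_def)
    moreover have "(f \<longlongrightarrow> f x) (nhds x)"
      using f by (simp add: sph_diff_def isCont_def tendsto_at_iff_tendsto_nhds)
    ultimately show ?thesis
      by (auto intro: filterlim_compose simp: t0_def)
  qed
  have "\<forall>\<^sub>F t in nhds t0. f (affine_param x t) \<in> chart_dom (f x)"
    by (rule topological_tendstoD[OF cont open_chart_dom chart_dom_self])
  then have ev: "\<forall>\<^sub>F t in nhds t0. (affine_coord ((g \<circ> f) x) \<circ> (g \<circ> f) \<circ> affine_param x) t = (G \<circ> F) t"
    by eventually_elim (simp add: G_def F_def affine_param_coord)
  have D: "((affine_coord ((g \<circ> f) x) \<circ> (g \<circ> f) \<circ> affine_param x) has_field_derivative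
      deriv G (F t0) * deriv F t0) (at t0)"
    by (subst DERIV_cong_ev[OF refl ev refl]) (rule DERIV_chain[OF dG dF])
  have "isCont (g \<circ> f) x"
    using f g by (simp add: sph_diff_def continuous_at_compose)
  with D show "sph_diff (g \<circ> f) x"
    unfolding sph_diff_def field_differentiable_def t0_def by blast
  have "chart_deriv (g \<circ> f) x = deriv G (F t0) * deriv F t0"
    unfolding chart_deriv_def by (rule DERIV_imp_deriv) (use D in \<open>simp add: t0_def\<close>)
  moreover have "chart_deriv f x = deriv F t0" "chart_deriv g (f x) = deriv G (F t0)"
    by (simp_all add: chart_deriv_def F_def[symmetric] G_def[symmetric] Ft0 t0_def)
      (simp add: F_def)
  moreover have "sph_density (affine_coord y y) > 0" for y
    by (simp add: sph_density_def add_pos_nonneg)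
  then have "sph_density (affine_coord y y) \<noteq> 0" for y by (metis less_irrefl)
  ultimately show "sph_deriv_norm (g \<circ> f) x = sph_deriv_norm g (f x) * sph_deriv_norm f x"
    by (simp add: sph_deriv_norm_def norm_mult)
qed

lemma sph_deriv_norm_nonneg: "sph_deriv_norm g x \<ge> 0"
  by (simp add: sph_deriv_norm_def sph_density_def)

text \<open>A local lift of \<open>g\<close> to homogeneous coordinates; the Wronskian gives the derivative
  irrespective of the chart at the image point.\<close>

lemma sph_diff_lift:
  assumes ev: "\<forall>\<^sub>F t in nhds t0. g (affine_param x t) = hom_pt (p t) (q t)"
    and t0: "t0 = affine_coord x x"
    and p: "(p has_field_derivative p') (at t0)" and q: "(q has_field_derivative q') (at t0)"
    and ne: "p t0 \<noteq> 0 \<or> q t0 \<noteq> 0"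
  shows "sph_diff g x"
    and "sph_deriv_norm g x =
      cmod (p' * q t0 - p t0 * q') * (1 + (cmod t0)\<^sup>2) / ((cmod (p t0))\<^sup>2 + (cmod (q t0))\<^sup>2)"
proof -
  have gx: "g x = hom_pt (p t0) (q t0)"
    using eventually_nhds_x_imp_x[OF ev] by (simp add: t0)
  have pc: "(p \<longlongrightarrow> p t0) (nhds t0)" "(q \<longlongrightarrow> q t0) (nhds t0)"
    using DERIV_isCont[OF p] DERIV_isCont[OF q] by (simp_all add: isCont_def tendsto_at_iff_tendsto_nhds)
  have co: "(affine_coord x \<longlongrightarrow> t0) (nhds x)"
    unfolding t0 by (rule tendsto_affine_coord) (simp_all add: chart_dom_self filterlim_def)
  have "\<forall>\<^sub>F y in nhds x. y \<in> chart_dom x"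
    using open_chart_dom chart_dom_self by (rule eventually_nhds_in_open)
  moreover have "\<forall>\<^sub>F y in nhds x. g (affine_param x (affine_coord x y)) = hom_pt (p (affine_coord x y)) (q (affine_coord x y))"
    by (rule eventually_compose_filterlim[OF ev co])
  ultimately have e2: "\<forall>\<^sub>F y in nhds x. hom_pt (p (affine_coord x y)) (q (affine_coord x y)) = g y"
    by eventually_elim (simp add: affine_param_coord)
  have "((\<lambda>y. hom_pt (p (affine_coord x y)) (q (affine_coord x y))) \<longlongrightarrow> hom_pt (p t0) (q t0)) (nhds x)"
    by (intro tendsto_hom_pt filterlim_compose[OF pc(1) co] filterlim_compose[OF pc(2) co] ne)
  then have "(g \<longlongrightarrow> g x) (nhds x)"
    unfolding gx using e2 by (rule Lim_transform_eventually)
  then have cont: "isCont g x"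
    by (simp add: isCont_def tendsto_at_iff_tendsto_nhds)
  let ?r = "affine_coord (g x) \<circ> g \<circ> affine_param x"
  \<comment> \<open>The chart at the image is the one at infinity exactly when q vanishes, so the
    quotient rule applies to q/p or to p/q. Both give the Wronskian up to sign, and the image
    density turns the denominator into |p|^2 + |q|^2.\<close>
  define d where "d = (if q t0 = 0 then (q' * p t0 - q t0 * p') / (p t0 * p t0)
     else (p' * q t0 - p t0 * q') / (q t0 * q t0))"
  have D: "(?r has_field_derivative d) (at t0)"
  proof (cases "q t0 = 0")
    case True
    have "\<forall>\<^sub>F t in nhds t0. ?r t = q t / p t"
      using ev by eventually_elim (use True in \<open>auto simp: gx hom_pt_def affine_coord_def\<close>)
    then show ?thesis
      using True ne DERIV_divide[OF q p] by (subst DERIV_cong_ev[OF refl _ refl]) (auto simp: d_def)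
  next
    case False
    have "\<forall>\<^sub>F t in nhds t0. ?r t = p t / q t"
      using ev by eventually_elim (use False in \<open>auto simp: gx hom_pt_def affine_coord_def\<close>)
    then show ?thesis
      using False DERIV_divide[OF p q] by (subst DERIV_cong_ev[OF refl _ refl]) (auto simp: d_def)
  qed
  show "sph_diff g x"
    unfolding sph_diff_def field_differentiable_def using cont D by (auto simp: t0)
  have cd: "chart_deriv g x = d"
    unfolding chart_deriv_def by (rule DERIV_imp_deriv) (use D in \<open>simp add: t0\<close>)
  have gg: "affine_coord (g x) (g x) = (if q t0 = 0 then 0 else p t0 / q t0)"
    by (simp add: gx hom_pt_def affine_coord_def)
  show "sph_deriv_norm g x =
      cmod (p' * q t0 - p t0 * q') * (1 + (cmod t0)\<^sup>2) / ((cmod (p t0))\<^sup>2 + (cmod (q t0))\<^sup>2)"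
  proof (cases "q t0 = 0")
    case True
    then show ?thesis using ne
      unfolding sph_deriv_norm_def cd gg t0[symmetric] d_def
      by (simp add: sph_density_def norm_mult norm_divide power2_eq_square)
  next
    case False
    define A B where "A = cmod (p t0)" and "B = cmod (q t0)"
    have B: "B > 0" using False by (simp add: B_def)
    have k1: "(1 + (A / B)\<^sup>2) * (B * B) = A\<^sup>2 + B\<^sup>2"
      using B by (simp add: field_simps power2_eq_square)
    have k2: "2 / X * (w / Y) / (2 / Z) = w * Z / (X * Y)" for w X Y Z :: real
      by simp
    have fin: "2 / (1 + (A / B)\<^sup>2) * (w / (B * B)) / (2 / (1 + T)) = w * (1 + T) / (A\<^sup>2 + B\<^sup>2)" for w T
      by (simp only: k1 k2)
    have "sph_deriv_norm g x =
        2 / (1 + (A / B)\<^sup>2) * (cmod (p' * q t0 - p t0 * q') / (B * B)) / (2 / (1 + (cmod t0)\<^sup>2))"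
      unfolding sph_deriv_norm_def cd gg t0[symmetric] d_def using False
      by (simp add: sph_density_def norm_mult norm_divide flip: A_def B_def)
    then show ?thesis
      unfolding fin by (simp only: A_def B_def)
  qed
qed

section \<open>Moebius and rational maps\<close>

definition mob :: "complex \<Rightarrow> complex \<Rightarrow> complex \<Rightarrow> complex \<Rightarrow> rsphere \<Rightarrow> rsphere" where
  "mob a b c d x = (case x of Fin z \<Rightarrow> hom_pt (a * z + b) (c * z + d) | Infty \<Rightarrow> hom_pt a c)"

lemma hom_pt_scale: "k \<noteq> 0 \<Longrightarrow> hom_pt (k * a) (k * b) = hom_pt a b"
  by (simp add: hom_pt_def)

lemma mob_param:
  "mob a b c d (affine_param x t) =
    (if x = Infty then hom_pt (a + b * t) (c + d * t) else hom_pt (a * t + b) (c * t + d))"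
proof (cases "x = Infty \<and> t \<noteq> 0")
  case True
  then have "a + b * t = t * (a * inverse t + b)" "c + d * t = t * (c * inverse t + d)"
    by (simp_all add: distrib_left)
  then show ?thesis
    using True hom_pt_scale[of t "a * inverse t + b" "c * inverse t + d"]
    by (simp only: mob_def affine_param_def) simp
qed (auto simp: mob_def affine_param_def)

lemma mob_lift_ne:
  fixes a b c d t :: complex
  assumes "a * d - b * c \<noteq> 0"
  shows "a * t + b \<noteq> 0 \<or> c * t + d \<noteq> 0" "a + b * t \<noteq> 0 \<or> c + d * t \<noteq> 0"
proof -
  have "a * (c * t + d) - c * (a * t + b) = a * d - b * c"
       "d * (a + b * t) - b * (c + d * t) = a * d - b * c" by (simp_all add: algebra_simps)
  with assms show "a * t + b \<noteq> 0 \<or> c * t + d \<noteq> 0" "a + b * t \<noteq> 0 \<or> c + d * t \<noteq> 0"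
    by (auto simp del: mult_eq_0_iff)
qed

lemma sph_diff_mob:
  assumes "a * d - b * c \<noteq> 0"
  shows "sph_diff (mob a b c d) x"
proof (cases "x = Infty")
  case True
  show ?thesis
  proof (rule sph_diff_lift)
    show "\<forall>\<^sub>F t in nhds (affine_coord x x). mob a b c d (affine_param x t) = hom_pt (a + b * t) (c + d * t)"
      using True by (simp add: mob_param)
  qed (use mob_lift_ne(2)[OF assms] in \<open>auto intro!: derivative_eq_intros\<close>)
next
  case False
  show ?thesis
  proof (rule sph_diff_lift)
    show "\<forall>\<^sub>F t in nhds (affine_coord x x). mob a b c d (affine_param x t) = hom_pt (a * t + b) (c * t + d)"
      using False by (simp add: mob_param)
  qed (use mob_lift_ne(1)[OF assms] in \<open>auto intro!: derivative_eq_intros\<close>)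
qed

lemma sph_deriv_norm_inversion: "sph_deriv_norm (mob 0 1 1 0) x = 1"
proof (cases x)
  case Infty
  have "sph_deriv_norm (mob 0 1 1 0) x = cmod (1 * 1 - 0 * 0) * (1 + (cmod 0)\<^sup>2) / ((cmod 0)\<^sup>2 + (cmod 1)\<^sup>2)"
  proof (rule sph_diff_lift(2)[OF _ _ DERIV_ident DERIV_const])
    show "\<forall>\<^sub>F t in nhds 0. mob 0 1 1 0 (affine_param x t) = hom_pt t 1"
      using Infty by (simp add: mob_param)
  qed (simp_all add: Infty affine_coord_def)
  then show ?thesis by simp
next
  case (Fin z)
  have "sph_deriv_norm (mob 0 1 1 0) x = cmod (0 * z - 1 * 1) * (1 + (cmod z)\<^sup>2) / ((cmod 1)\<^sup>2 + (cmod z)\<^sup>2)"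
  proof (rule sph_diff_lift(2)[OF _ _ DERIV_const DERIV_ident])
    show "\<forall>\<^sub>F t in nhds z. mob 0 1 1 0 (affine_param x t) = hom_pt 1 t"
      using Fin by (simp add: mob_param)
  qed (simp_all add: Fin affine_coord_def)
  then show ?thesis using one_plus_cmod_sq_pos[of z] by simp
qed

lemma inversion_inversion [simp]: "mob 0 1 1 0 (mob 0 1 1 0 x) = x"
  by (cases x) (auto simp: mob_def hom_pt_def)

text \<open>The map z to 1/z is the rotation of the sphere by the angle pi about the real axis. It
  is the isometry that exchanges the hemispheres.\<close>

lemma stereo_inversion:
  "stereo (mob 0 1 1 0 x) = (cnj (fst (stereo x)), - snd (stereo x))"
proof (cases x)
  case (Fin z)
  have "x = hom_pt z 1" "mob 0 1 1 0 x = hom_pt 1 z" by (simp_all add: Fin mob_def hom_pt_def)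
  then show ?thesis
    by (simp only:) (subst (1 2 3) stereo_hom_pt; simp add: add.commute minus_divide_left)
next
  case Infty
  have "mob 0 1 1 0 x = Fin 0" by (simp add: Infty mob_def hom_pt_def)
  then show ?thesis by (simp add: Infty)
qed

lemma dist_inversion: "dist (mob 0 1 1 0 x) (mob 0 1 1 0 y) = dist x y"
  by (simp add: dist_rsphere_def stereo_inversion inner_prod_def inner_complex_def)

section \<open>Polynomial lifts of rational maps\<close>

lemma poly_common_root:
  fixes P Q :: "complex poly"
  assumes "coprime P Q"
  shows "poly P z \<noteq> 0 \<or> poly Q z \<noteq> 0"
proof (rule ccontr)
  assume "\<not> ?thesis"
  then have "[:-z, 1:] dvd P" "[:-z, 1:] dvd Q" by (simp_all add: poly_eq_0_iff_dvd)
  with assms have "is_unit [:-z, 1:]" by (rule coprime_common_divisor)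
  then show False by (simp add: is_unit_iff_degree)
qed

text \<open>This is the polynomial t^n P(1/t). The monomial makes up the difference between degree P
  and the common exponent n, so that P and Q acquire the same factor t^n, which cancels in
  homogeneous coordinates.\<close>

lemma poly_scaled_reflect:
  fixes P :: "complex poly"
  assumes "degree P \<le> n"
  shows "t \<noteq> 0 \<Longrightarrow> poly (monom 1 (n - degree P) * reflect_poly P) t = t ^ n * poly P (inverse t)"
    and "poly (monom 1 (n - degree P) * reflect_poly P) 0 = coeff P n"
proof -
  assume "t \<noteq> 0"
  then show "poly (monom 1 (n - degree P) * reflect_poly P) t = t ^ n * poly P (inverse t)"
    using assms by (simp add: poly_reflect_poly_nz poly_monom flip: power_add)
next
  show "poly (monom 1 (n - degree P) * reflect_poly P) 0 = coeff P n"
  proof (cases "degree P = n")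
    case True
    then show ?thesis by (simp add: poly_monom)
  next
    case False
    with assms have "degree P < n" by simp
    then show ?thesis by (simp add: poly_monom coeff_eq_0)
  qed
qed

text \<open>One of the two coefficients is the leading one of the polynomial of larger degree, so
  both vanish only for P = Q = 0. They are the values at t = 0 of the lift at infinity, which thus
  has no common zero there.\<close>

lemma rat_coeff_ne:
  assumes "coprime P Q"
  shows "coeff P (rat_degree P Q) \<noteq> 0 \<or> coeff Q (rat_degree P Q) \<noteq> 0"
proof (rule ccontr)
  assume *: "\<not> ?thesis"
  have "P = 0 \<and> Q = 0"
  proof (cases "degree P \<le> degree Q")
    case True
    with * have Q: "Q = 0" by (auto simp: rat_degree_def max_def)
    with True * have "degree P = 0" "coeff P 0 = 0" by (auto simp: rat_degree_def)
    with Q show ?thesis by (metis leading_coeff_0_iff)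
  next
    case False
    with * have P: "P = 0" by (auto simp: rat_degree_def max_def)
    with False show ?thesis by simp
  qed
  with assms show False by simp
qed

lemma rat_eval_lift:
  assumes "coprime P Q"
  obtains p q :: "complex poly"
  where "\<And>t. rat_eval P Q (affine_param x t) = hom_pt (poly p t) (poly q t)"
    and "\<And>t. poly p t \<noteq> 0 \<or> poly q t \<noteq> 0"
proof (cases "x = Infty")
  case False
  show thesis
    by (rule that[of P Q]) (use False poly_common_root[OF assms] in \<open>auto simp: affine_param_def hom_pt_def\<close>)
next
  case True
  define n where "n = rat_degree P Q"
  have n: "degree P \<le> n" "degree Q \<le> n" by (simp_all add: n_def rat_degree_def)
  note rp = poly_scaled_reflect[OF n(1)] and rq = poly_scaled_reflect[OF n(2)]
  show thesis
  proof (rule that)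
    fix t
    let ?p = "monom 1 (n - degree P) * reflect_poly P" and ?q = "monom 1 (n - degree Q) * reflect_poly Q"
    have ne: "coeff P n \<noteq> 0 \<or> coeff Q n \<noteq> 0" unfolding n_def by (rule rat_coeff_ne[OF assms])
    show "rat_eval P Q (affine_param x t) = hom_pt (poly ?p t) (poly ?q t)"
    proof (cases "t = 0")
      case t: True
      show ?thesis
        unfolding t rp(2) rq(2) using True by (simp add: affine_param_def hom_pt_def n_def Let_def)
    next
      case False
      then show ?thesis
        unfolding rp(1)[OF False] rq(1)[OF False] using True by (simp add: affine_param_def hom_pt_def)
    qed
    show "poly ?p t \<noteq> 0 \<or> poly ?q t \<noteq> 0"
    proof (cases "t = 0")
      case t: True
      show ?thesis unfolding t rp(2) rq(2) by (rule ne)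
    next
      case False
      then show ?thesis
        unfolding rp(1)[OF False] rq(1)[OF False] using poly_common_root[OF assms] by simp
    qed
  qed
qed

lemma ratmap_cases:
  obtains P Q where "app f = rat_eval P Q" "coprime P Q" "rat_degree P Q \<ge> 2"
  using app[of f] by blast

lemma sph_diff_app: "sph_diff (app f) x"
proof -
  obtain P Q where PQ: "app f = rat_eval P Q" "coprime P Q" by (rule ratmap_cases)
  obtain p q where pq: "\<And>t. rat_eval P Q (affine_param x t) = hom_pt (poly p t) (poly q t)"
    "\<And>t. poly p t \<noteq> 0 \<or> poly q t \<noteq> 0"
    using rat_eval_lift[OF PQ(2)] by metis
  show ?thesis
    unfolding PQ(1) by (rule sph_diff_lift[OF _ refl poly_DERIV poly_DERIV]) (use pq in auto)
qed

section \<open>Fibres of rational maps\<close>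

lemma complex_poly_root: "degree p \<noteq> 0 \<Longrightarrow> \<exists>z :: complex. poly p z = 0"
  by (rule Fundamental_Theorem_Algebra.fundamental_theorem_of_algebra) (simp add: constant_degree)

text \<open>A finite value w is taken at a root of P - w Q. If there is no root, this polynomial is
  constant, its coefficient of index n vanishes, and that says that w is the value at
  \<open>Infty\<close>. The value \<open>Infty\<close> is treated in the same way with Q.\<close>

lemma rat_surj:
  assumes "coprime P Q" "rat_degree P Q \<ge> 1"
  shows "surj (rat_eval P Q)"
proof -
  define n where "n = rat_degree P Q"
  have ne: "coeff P n \<noteq> 0 \<or> coeff Q n \<noteq> 0" unfolding n_def by (rule rat_coeff_ne[OF assms(1)])
  have n1: "n \<ge> 1" using assms(2) by (simp add: n_def)
  have "\<exists>x. rat_eval P Q x = y" for y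
  proof (cases y)
    case Infty
    show ?thesis
    proof (cases "\<exists>z. poly Q z = 0")
      case True
      then obtain z where "poly Q z = 0" by blast
      then show ?thesis using Infty by (intro exI[of _ "Fin z"]) simp
    next
      case False
      then have "degree Q = 0"
        using complex_poly_root by blast
      then have "coeff Q n = 0" using n1 by (simp add: coeff_eq_0)
      then show ?thesis using Infty by (intro exI[of _ Infty]) (simp flip: n_def)
    qed
  next
    case (Fin w)
    define R where "R = P - smult w Q"
    show ?thesis
    proof (cases "\<exists>z. poly R z = 0")
      case True
      then obtain z where z: "poly P z = w * poly Q z" by (auto simp: R_def)
      then have "poly Q z \<noteq> 0" using poly_common_root[OF assms(1), of z] by auto
      then show ?thesis using Fin z by (intro exI[of _ "Fin z"]) simp
    next
      case False
      then have "degree R = 0"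
        using complex_poly_root by blast
      then have "coeff R n = 0" using n1 by (simp add: coeff_eq_0)
      then have c: "coeff P n = w * coeff Q n" by (simp add: R_def)
      then have "coeff Q n \<noteq> 0" using ne by auto
      then show ?thesis using Fin c by (intro exI[of _ Infty]) (simp add: Let_def flip: n_def)
    qed
  qed
  then show ?thesis by (metis surjI)
qed

text \<open>A generic fibre is simple, and it has as many points as the degree.\<close>

lemma rat_not_inj:
  assumes cop: "coprime P Q" and deg: "rat_degree P Q \<ge> 2"
  shows "\<not> inj (rat_eval P Q)"
proof
  assume inj: "inj (rat_eval P Q)"
  define n where "n = rat_degree P Q"
  have ne: "coeff P n \<noteq> 0 \<or> coeff Q n \<noteq> 0" unfolding n_def by (rule rat_coeff_ne[OF cop])
  have nm: "n = max (degree P) (degree Q)" by (simp add: n_def rat_degree_def)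
  have dn: "degree P \<le> n" "degree Q \<le> n" "n \<ge> 2" using deg by (simp_all add: n_def rat_degree_def)
  have no_const: "\<not> (degree P = 0 \<and> degree Q = 0)" using dn nm by auto
  \<comment> \<open>The point z0 below avoids three finite sets: the zeros of the Wronskian
    \<open>D\<close>, so that z0 is a simple root of its fibre equation; the zeros of
    \<open>E\<close>, so that its value differs from the one at \<open>Infty\<close> and
    \<open>R\<close> keeps the full degree n; and the zeros of \<open>Q\<close>. A second root of
    \<open>R\<close> then has to be a different point.\<close>
  define D where "D = pderiv P * Q - P * pderiv Q"
  define E where "E = smult (coeff P n) Q - smult (coeff Q n) P"
  have D0: "D \<noteq> 0"
  proof
    assume "D = 0"
    then have eq: "pderiv P * Q = P * pderiv Q" by (simp add: D_def)
    have "P dvd pderiv P * Q" "Q dvd P * pderiv Q" using eq by (metis dvd_triv_left dvd_triv_right)+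
    then have "P dvd pderiv P" "Q dvd pderiv Q"
      using cop by (metis coprime_dvd_mult_left_iff coprime_dvd_mult_right_iff coprime_commute)+
    then have "degree P = 0" "degree Q = 0" using not_dvd_pderiv by blast+
    with no_const show False by blast
  qed
  have E0: "E \<noteq> 0"
  proof
    assume "E = 0"
    then have eq: "smult (coeff P n) Q = smult (coeff Q n) P" by (simp add: E_def)
    have "P \<noteq> 0 \<or> Q \<noteq> 0" using no_const by auto
    consider "coeff P n \<noteq> 0" | "coeff Q n \<noteq> 0" using ne by blast
    then show False
    proof cases
      case 1
      then have "P dvd Q" using eq by (metis dvd_smult_iff dvd_smult dvd_refl)
      then have "is_unit P" using cop by (metis coprime_common_divisor dvd_refl)
      then have dP: "degree P = 0" by (metis is_unit_iff_degree not_is_unit_0)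
      then have "coeff P n = 0" using dn by (simp add: coeff_eq_0)
      with 1 show False by simp
    next
      case 2
      then have "Q dvd P" using eq by (metis dvd_smult_iff dvd_smult dvd_refl)
      then have "is_unit Q" using cop by (metis coprime_common_divisor dvd_refl)
      then have dP: "degree Q = 0" by (metis is_unit_iff_degree not_is_unit_0)
      then have "coeff Q n = 0" using dn by (simp add: coeff_eq_0)
      with 2 show False by simp
    qed
  qed
  have Q0: "Q \<noteq> 0"
  proof
    assume "Q = 0"
    with D0 show False by (simp add: D_def)
  qed
  have "D * E * Q \<noteq> 0" using D0 E0 Q0 by simp
  then have "finite {z. poly (D * E * Q) z = 0}" by (rule poly_roots_finite)
  then have "{z. poly (D * E * Q) z = 0} \<noteq> UNIV" using infinite_UNIV_char_0 by metis
  then obtain z0 where "poly (D * E * Q) z0 \<noteq> 0" by blast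
  then have z0: "poly D z0 \<noteq> 0" "poly E z0 \<noteq> 0" "poly Q z0 \<noteq> 0" by simp_all
  define w where "w = poly P z0 / poly Q z0"
  define R where "R = P - smult w Q"
  have Rz0: "poly R z0 = 0" using z0 by (simp add: R_def w_def)
  have "coeff R n * poly Q z0 = poly E z0" using z0 by (simp add: R_def w_def E_def field_simps)
  then have cR: "coeff R n \<noteq> 0" using z0 by auto
  then have dR: "degree R \<ge> 2" using dn(3) le_degree by fastforce
  obtain S where S: "R = [:-z0, 1:] * S" using Rz0 by (auto simp: poly_eq_0_iff_dvd)
  have S0: "S \<noteq> 0" using S cR by auto
  have "degree R = 1 + degree S" unfolding S using S0 by (subst degree_mult_eq) auto
  then have "degree S \<noteq> 0" using dR by simp
  then obtain z1 where z1: "poly S z1 = 0"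
    using complex_poly_root by blast
  have "z1 \<noteq> z0"
  proof
    assume "z1 = z0"
    with z1 have "poly (pderiv R) z0 = 0" unfolding S by (subst pderiv_mult) (simp add: pderiv_pCons)
    then have "poly (pderiv P) z0 = w * poly (pderiv Q) z0" by (simp add: R_def pderiv_diff pderiv_smult)
    then have "poly D z0 = 0" using z0 by (simp add: D_def w_def field_simps)
    with z0 show False by simp
  qed
  have "poly R z1 = 0" unfolding S by (simp add: z1)
  then have P1: "poly P z1 = w * poly Q z1" by (simp add: R_def)
  then have "poly Q z1 \<noteq> 0" using poly_common_root[OF cop, of z1] by auto
  then have "rat_eval P Q (Fin z1) = rat_eval P Q (Fin z0)" using P1 z0 by (simp add: w_def)
  from injD[OF inj this] have "z1 = z0" by simp
  with \<open>z1 \<noteq> z0\<close> show False by simp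
qed

lemma surj_app: "surj (app f)" and not_inj_app: "\<not> inj (app f)"
  using ratmap_cases[of f] rat_surj rat_not_inj by (metis one_le_numeral order_trans)+

section \<open>Equicontinuity forces injectivity\<close>

text \<open>By pigeonhole two iterates are uniformly close, so by surjectivity some iterate is
  uniformly close to the identity and cannot identify two distant points.\<close>

lemma equicontinuous_surj_imp_inj:
  fixes h :: "'a::metric_space \<Rightarrow> 'a"
  assumes comp: "compact (UNIV :: 'a set)" and surj: "surj h"
    and equi: "\<And>x e. e > 0 \<Longrightarrow> \<exists>\<delta>>0. \<forall>n\<ge>1. \<forall>y. dist y x < \<delta> \<longrightarrow> dist ((h ^^ n) y) ((h ^^ n) x) < e"
  shows "inj h"
proof (rule injI, rule ccontr)
  fix a b assume ab: "h a = h b" "a \<noteq> b"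
  \<comment> \<open>Some iterate is going to be within 4 e of the identity. It sends a and b to the
    same point, so dist a b < 8 e, the contradiction.\<close>
  define e where "e = dist a b / 8"
  have e: "e > 0" using ab by (simp add: e_def)
  obtain \<delta> where \<delta>: "\<And>x. \<delta> x > 0"
    "\<And>x n y. n \<ge> 1 \<Longrightarrow> dist y x < \<delta> x \<Longrightarrow> dist ((h ^^ n) y) ((h ^^ n) x) < e"
    using equi[OF e] by metis
  have cover: "\<exists>X. finite X \<and> UNIV \<subseteq> (\<Union>x\<in>X. ball x (r x))" if "\<And>x. r x > 0" for r :: "'a \<Rightarrow> real"
  proof -
    have "UNIV \<subseteq> (\<Union>x\<in>UNIV. ball x (r x))" using that centre_in_ball by blast
    from compactE_image[OF comp _ this] obtain X where "finite X" "UNIV \<subseteq> (\<Union>x\<in>X. ball x (r x))"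
      using open_ball by metis
    then show ?thesis by blast
  qed
  obtain X where X: "finite X" "UNIV \<subseteq> (\<Union>x\<in>X. ball x (\<delta> x))"
    using cover[of \<delta>, OF \<delta>(1)] by metis
  obtain Y :: "'a set" where Y: "finite Y" "UNIV \<subseteq> (\<Union>x\<in>Y. ball x e)"
    using cover[of "\<lambda>_. e", OF e] by blast
  have "\<exists>y\<in>Y. dist y x < e" for x
    using subsetD[OF Y(2) UNIV_I, of x] unfolding UN_iff mem_ball .
  then have "\<forall>x. \<exists>y. y \<in> Y \<and> dist y x < e" by blast
  from choice[OF this] obtain y where y: "\<And>x. y x \<in> Y" "\<And>x. dist (y x) x < e" by blast
  \<comment> \<open>A finite code of the n-th iterate: for every centre in \<open>X\<close>, a net
    point within e of its image. Equal codes put the iterates within 2 e of each other at the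
    centres and hence within 4 e everywhere.\<close>
  define c where "c n = restrict (\<lambda>x. y ((h ^^ n) x)) X" for n
  have "c ` {1..} \<subseteq> X \<rightarrow>\<^sub>E Y" using y(1) by (auto simp: c_def)
  then have "finite (c ` {1..})" by (rule finite_subset) (simp add: finite_PiE X Y)
  then have "\<not> inj_on c {1..}" using finite_imageD infinite_Ici by blast
  then obtain m n where mn: "m < n" "m \<ge> 1" "c m = c n"
    unfolding inj_on_def by (metis atLeast_iff linorder_neqE_nat)
  have close: "dist ((h ^^ m) z) ((h ^^ n) z) < 4 * e" for z
  proof -
    obtain x where x: "x \<in> X" "dist z x < \<delta> x" using subsetD[OF X(2) UNIV_I, of z] unfolding UN_iff mem_ball by (metis dist_commute)
    have "y ((h ^^ m) x) = y ((h ^^ n) x)" using mn(3) x(1) unfolding c_def by (metis restrict_apply')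
    then have "dist ((h ^^ m) x) ((h ^^ n) x) < 2 * e"
      using y(2)[of "(h ^^ m) x"] y(2)[of "(h ^^ n) x"] dist_triangle2[of "(h ^^ m) x" "(h ^^ n) x" "y ((h ^^ m) x)"]
      by (simp add: dist_commute)
    moreover have "dist ((h ^^ m) z) ((h ^^ m) x) < e" "dist ((h ^^ n) z) ((h ^^ n) x) < e"
      using \<delta>(2) x(2) mn by auto
    ultimately show ?thesis
      using dist_triangle[of "(h ^^ m) z" "(h ^^ n) z" "(h ^^ m) x"]
        dist_triangle2[of "(h ^^ m) x" "(h ^^ n) z" "(h ^^ n) x"] by (simp add: dist_commute)
  qed
  define k where "k = n - m"
  have k: "n = k + m" "k \<ge> 1" using mn by (simp_all add: k_def)
  have id_close: "dist v ((h ^^ k) v) < 4 * e" for v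
  proof -
    have "surj (h ^^ m)" using surj by (simp add: surj_fn)
    then obtain u where "v = (h ^^ m) u" by (metis surjD)
    then show ?thesis using close[of u] by (simp add: k(1) funpow_add)
  qed
  have "(h ^^ k) a = (h ^^ k) b"
  proof -
    obtain l where "k = Suc l" using k(2) by (metis Suc_le_D One_nat_def)
    then show ?thesis using ab(1) by (simp add: funpow_swap1)
  qed
  then have "dist a b < 8 * e"
    using id_close[of a] id_close[of b] dist_triangle2[of a b "(h ^^ k) a"] by simp
  then show False by (simp add: e_def)
qed

section \<open>Compositions\<close>

lemma fold_app:
  fixes g :: "rsphere \<Rightarrow> rsphere"
  shows "fold (\<lambda>f g. app f \<circ> g) fs g = comp_maps fs \<circ> g"
proof (induction fs arbitrary: g)
  case Nil
  then show ?case by (simp add: comp_maps_def)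
next
  case (Cons f fs)
  have "comp_maps (f # fs) = comp_maps fs \<circ> (app f \<circ> id)"
    unfolding comp_maps_def[of "f # fs"] by (simp only: fold_simps) (rule Cons.IH)
  then show ?case by (simp only: fold_simps Cons.IH) (simp only: comp_id o_assoc)
qed

lemma comp_maps_simps [simp]:
  "comp_maps [] = id" "comp_maps (f # fs) = comp_maps fs \<circ> app f"
proof -
  show "comp_maps [] = id" by (simp add: comp_maps_def)
  show "comp_maps (f # fs) = comp_maps fs \<circ> app f"
    unfolding comp_maps_def[of "f # fs"] by (simp only: fold_simps) (simp only: fold_app comp_id)
qed

lemma comp_maps_append: "comp_maps (fs @ gs) = comp_maps gs \<circ> comp_maps fs"
  by (induction fs) (simp_all add: o_assoc)

lemma sph_deriv_norm_id: "sph_deriv_norm id x = 1" and sph_diff_id: "sph_diff id x"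
proof -
  \<comment> \<open>As the square of the inversion, \<open>id\<close> inherits both facts from the
    chain rule.\<close>
  have id: "id = mob 0 1 1 0 \<circ> mob 0 1 1 0" by auto
  have d: "sph_diff (mob 0 1 1 0) y" for y by (rule sph_diff_mob) simp
  show "sph_deriv_norm id x = 1" "sph_diff id x"
    unfolding id using sph_diff_chain[OF d d, of x] by (simp_all add: sph_deriv_norm_inversion)
qed

lemma sph_diff_comp_maps: "sph_diff (comp_maps fs) x"
  by (induction fs arbitrary: x) (auto intro: sph_diff_id sph_diff_chain sph_diff_app)

lemma sph_diff_imp_continuous_on: "(\<And>x. sph_diff g x) \<Longrightarrow> continuous_on UNIV g"
  by (simp add: continuous_on_eq_continuous_at sph_diff_def)

lemma sph_diff_tendsto: "sph_diff g x \<Longrightarrow> (g \<longlongrightarrow> g x) (nhds x)"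
  by (simp add: sph_diff_def isCont_def tendsto_at_iff_tendsto_nhds)

lemma continuous_on_Fin: "continuous_on UNIV Fin"
  unfolding continuous_on_def by (auto intro!: tendsto_Fin)

text \<open>Charts vary with the point, whereas holomorphy concerns one function on an open set. As
  long as the values are finite, all charts involved are the standard one and \<open>k\<close> is
  that function. The estimate discards the factor 1/(1 + |k u|^2), which is at most 1.\<close>

lemma sph_planar:
  assumes d: "sph_diff g (Fin u)" and ne: "g (Fin u) \<noteq> Infty"
  defines "k \<equiv> \<lambda>v. affine_coord (Fin 0) (g (Fin v))"
  shows "(k has_field_derivative deriv k u) (at u)"
    and "sph_deriv_norm g (Fin u) \<le> cmod (deriv k u) * (1 + (cmod u)\<^sup>2)"
proof -
  have e: "affine_coord (g (Fin u)) \<circ> g \<circ> affine_param (Fin u) = k"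
    using ne by (auto simp: k_def affine_coord_def affine_param_def fun_eq_iff split: rsphere.splits)
  have c: "affine_coord (Fin u) (Fin u) = u" by (simp add: affine_coord_def)
  show "(k has_field_derivative deriv k u) (at u)"
    using d unfolding sph_diff_def e c by (simp add: DERIV_deriv_iff_field_differentiable)
  define T where "T = (cmod (affine_coord (g (Fin u)) (g (Fin u))))\<^sup>2"
  have "sph_deriv_norm g (Fin u) = 2 / (1 + T) * cmod (deriv k u) / (2 / (1 + (cmod u)\<^sup>2))"
    unfolding sph_deriv_norm_def chart_deriv_def e c sph_density_def T_def ..
  also have "\<dots> = cmod (deriv k u) * (1 + (cmod u)\<^sup>2) / (1 + T)"
  proof -
    have "2 / X * d / (2 / Y) = d * Y / X" for X d Y :: real by simp
    then show ?thesis .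
  qed
  also have "\<dots> \<le> cmod (deriv k u) * (1 + (cmod u)\<^sup>2) / 1"
    by (intro divide_left_mono) (simp_all add: T_def add_pos_nonneg)
  finally show "sph_deriv_norm g (Fin u) \<le> cmod (deriv k u) * (1 + (cmod u)\<^sup>2)" by simp
qed

text \<open>Cauchy's inequality is applied on the ball of half the radius, whose closure still lies
  in the domain; this costs the factor 2.\<close>

lemma Cauchy_deriv_bound:
  assumes "g holomorphic_on ball u r" "\<And>z. z \<in> ball u r \<Longrightarrow> cmod (g z) \<le> B" "r > 0"
  shows "cmod (deriv g u) \<le> 2 * B / r"
proof -
  have "cmod ((deriv ^^ 1) g u) \<le> fact 1 * B / (r / 2) ^ 1"
  proof (rule Cauchy_inequality)
    show "g holomorphic_on ball u (r / 2)"
      using assms(1) by (rule holomorphic_on_subset) (use assms(3) in auto)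
    show "continuous_on (cball u (r / 2)) g"
      by (rule holomorphic_on_imp_continuous_on, rule holomorphic_on_subset[OF assms(1)])
         (use assms(3) in auto)
    show "cmod (g x) \<le> B" if "cmod (u - x) = r / 2" for x
      by (rule assms(2)) (use that assms(3) in \<open>simp add: dist_norm\<close>)
  qed (use assms(3) in simp)
  then show ?thesis by (simp add: mult.commute)
qed

section \<open>Equicontinuous families have bounded derivatives\<close>

text \<open>An isometry that moves a given point to height at most 0, hence away from infinity,
  without changing any spherical derivative.\<close>

lemma inversion_lower_hemisphere:
  obtains \<sigma> where "\<And>x. sph_diff \<sigma> x" "\<And>x. sph_deriv_norm \<sigma> x = 1" "\<And>x. \<sigma> (\<sigma> x) = x"
    "\<And>x y. dist (\<sigma> x) (\<sigma> y) = dist x y" "snd (stereo (\<sigma> x)) \<le> 0"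
proof (cases "snd (stereo x) \<le> 0")
  case True
  show ?thesis by (rule that[of id]) (use True in \<open>simp_all add: sph_diff_id sph_deriv_norm_id\<close>)
next
  case False
  show ?thesis
    by (rule that[of "mob 0 1 1 0"])
       (use False in \<open>simp_all add: sph_diff_mob sph_deriv_norm_inversion dist_inversion stereo_inversion\<close>)
qed

text \<open>Height at most 1/2 means |z|^2 <= 3.\<close>

lemma low_stereo_imp_Fin:
  assumes "snd (stereo x) \<le> 1 / 2"
  obtains z where "x = Fin z" "cmod z \<le> 2"
proof (cases x)
  case (Fin z)
  have "(cmod z)\<^sup>2 - 1 \<le> (1 + (cmod z)\<^sup>2) / 2"
    using assms one_plus_cmod_sq_pos[of z] by (simp add: Fin field_simps)
  then have "(cmod z)\<^sup>2 \<le> 2\<^sup>2" by simp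
  then have "cmod z \<le> 2" by (rule power2_le_imp_le) simp
  with Fin show ?thesis by (rule that)
qed (use assms in simp)

text \<open>Equicontinuity confines h, near x0, to a small neighbourhood of h x0. After one isometry
  of the source, and one of the target chosen for each h, the family consists of holomorphic
  functions from a fixed disk into the disk of radius 2, where Cauchy's estimate is uniform in
  h.\<close>

lemma sph_deriv_norm_locally_bounded:
  assumes H: "\<And>h x. h \<in> H \<Longrightarrow> sph_diff h x"
    and S: "open S" "x0 \<in> S" "equicontinuous_on S H"
  obtains S' C where "open S'" "x0 \<in> S'" "\<And>h y. h \<in> H \<Longrightarrow> y \<in> S' \<Longrightarrow> sph_deriv_norm h y \<le> C"
proof -
  obtain \<rho> where \<rho>: "\<And>x. sph_diff \<rho> x" "\<And>x. sph_deriv_norm \<rho> x = 1" "\<And>x. \<rho> (\<rho> x) = x"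
    "\<And>x y. dist (\<rho> x) (\<rho> y) = dist x y" "snd (stereo (\<rho> x0)) \<le> 0"
    using inversion_lower_hemisphere[of x0] by blast
  have "snd (stereo (\<rho> x0)) \<le> 1 / 2" using \<rho>(5) by simp
  then obtain z0 where z0: "\<rho> x0 = Fin z0" by (rule low_stereo_imp_Fin)
  have x0: "x0 = \<rho> (Fin z0)" using \<rho>(3)[of x0] z0 by simp
  have c\<rho>: "continuous_on UNIV \<rho>" by (rule sph_diff_imp_continuous_on[OF \<rho>(1)])
  \<comment> \<open>The isometry \<sigma> chosen below brings h x0 to height at most 0; a distance
    less than 1/2 from it keeps the height at most 1/2, as \<open>low_stereo_imp_Fin\<close>
    requires.\<close>
  obtain \<delta>1 where \<delta>1: "\<delta>1 > 0" "\<And>h y. h \<in> H \<Longrightarrow> y \<in> S \<Longrightarrow> dist y x0 < \<delta>1 \<Longrightarrow> dist (h y) (h x0) < 1 / 2"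
  proof -
    have "\<exists>\<delta>>0. \<forall>h\<in>H. \<forall>y\<in>S. dist y x0 < \<delta> \<longrightarrow> dist (h y) (h x0) < 1 / 2"
      using S(2,3) unfolding equicontinuous_on_def by (metis half_gt_zero zero_less_one)
    then show thesis using that by blast
  qed
  have "open ((\<lambda>z. \<rho> (Fin z)) -` (S \<inter> ball x0 \<delta>1))"
    by (intro open_vimage open_Int S(1) open_ball continuous_on_compose2[OF c\<rho> continuous_on_Fin]) auto
  moreover have "z0 \<in> (\<lambda>z. \<rho> (Fin z)) -` (S \<inter> ball x0 \<delta>1)"
    using S(2) \<delta>1(1) by (simp flip: x0)
  ultimately obtain \<delta> where \<delta>: "\<delta> > 0" "ball z0 \<delta> \<subseteq> (\<lambda>z. \<rho> (Fin z)) -` (S \<inter> ball x0 \<delta>1)"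
    by (metis open_contains_ball)
  have t\<rho>: "(\<rho> \<longlongrightarrow> Fin z0) (nhds x0)"
    using sph_diff_tendsto[OF \<rho>(1), of x0] z0 by simp
  have "((\<lambda>y. affine_coord (Fin 0) (\<rho> y)) \<longlongrightarrow> affine_coord (Fin 0) (Fin z0)) (nhds x0)"
    by (rule tendsto_affine_coord[OF t\<rho>]) (simp add: chart_dom_def)
  then have "\<forall>\<^sub>F y in nhds x0. affine_coord (Fin 0) (\<rho> y) \<in> ball z0 (\<delta> / 2)"
    by (rule topological_tendstoD) (use \<delta>(1) in \<open>simp_all add: affine_coord_def\<close>)
  moreover have "\<forall>\<^sub>F y in nhds x0. \<rho> y \<in> chart_dom (Fin 0)"
    by (rule topological_tendstoD[OF t\<rho> open_chart_dom]) (simp add: chart_dom_def)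
  ultimately have "\<forall>\<^sub>F y in nhds x0. \<rho> y \<in> Fin ` ball z0 (\<delta> / 2)"
    by eventually_elim (auto simp: chart_dom_def affine_coord_def split: rsphere.splits)
  then obtain S' where S': "open S'" "x0 \<in> S'" "\<And>y. y \<in> S' \<Longrightarrow> \<rho> y \<in> Fin ` ball z0 (\<delta> / 2)"
    unfolding eventually_nhds by blast
  \<comment> \<open>Cauchy's bound for |k| <= 2 on a disk of radius \<delta>/2, times a bound for
    the factor 1 + |z|^2 in \<open>sph_planar\<close>. The disk fits because the points of
    \<open>S'\<close> have coordinates in the ball of half the radius.\<close>
  define C where "C = 2 * 2 / (\<delta> / 2) * (1 + (cmod z0 + \<delta>)\<^sup>2)"
  show thesis
  proof (rule that[OF S'(1,2)])
    fix h y assume h: "h \<in> H" and y: "y \<in> S'"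
    obtain z where z: "\<rho> y = Fin z" "z \<in> ball z0 (\<delta> / 2)" using S'(3)[OF y] by auto
    obtain \<sigma> where \<sigma>: "\<And>x. sph_diff \<sigma> x" "\<And>x. sph_deriv_norm \<sigma> x = 1" "\<And>x. \<sigma> (\<sigma> x) = x"
      "\<And>x y. dist (\<sigma> x) (\<sigma> y) = dist x y" "snd (stereo (\<sigma> (h x0))) \<le> 0"
      using inversion_lower_hemisphere[of "h x0"] by blast
    define G where "G = \<sigma> \<circ> (h \<circ> \<rho>)"
    have dG: "sph_diff G x" for x
      unfolding G_def by (intro sph_diff_chain(1) \<rho>(1) \<sigma>(1) H h)
    have hG: "h = \<sigma> \<circ> (G \<circ> \<rho>)" by (simp add: G_def fun_eq_iff \<sigma>(3) \<rho>(3))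
    have "sph_deriv_norm h y = sph_deriv_norm G (\<rho> y)"
      unfolding hG by (simp add: sph_diff_chain dG \<rho> \<sigma>)
    also have "\<dots> = sph_deriv_norm G (Fin z)" by (simp add: z(1))
    finally have eq: "sph_deriv_norm h y = sph_deriv_norm G (Fin z)" .
    define k where "k = (\<lambda>v. affine_coord (Fin 0) (G (Fin v)))"
    have low: "\<exists>w. G (Fin v) = Fin w \<and> cmod w \<le> 2" if "v \<in> ball z0 \<delta>" for v
    proof -
      have "\<rho> (Fin v) \<in> S" "dist (\<rho> (Fin v)) x0 < \<delta>1" using subsetD[OF \<delta>(2) that] by (auto simp: dist_commute)
      then have "dist (h (\<rho> (Fin v))) (h x0) < 1 / 2" by (rule \<delta>1(2)[OF h])
      then have "dist (G (Fin v)) (\<sigma> (h x0)) < 1 / 2" by (simp add: G_def \<sigma>(4))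
      then have "norm (stereo (G (Fin v)) - stereo (\<sigma> (h x0))) < 1 / 2"
        using chord_le_dist[of "G (Fin v)" "\<sigma> (h x0)"] by linarith
      then have "\<bar>snd (stereo (G (Fin v)) - stereo (\<sigma> (h x0)))\<bar> < 1 / 2"
        using norm_snd_le[of "snd (stereo (G (Fin v)) - stereo (\<sigma> (h x0)))" "fst (stereo (G (Fin v)) - stereo (\<sigma> (h x0)))"]
        unfolding prod.collapse real_norm_def by linarith
      then have "snd (stereo (G (Fin v))) \<le> 1 / 2" using \<sigma>(5) unfolding snd_diff by linarith
      then show ?thesis by (metis low_stereo_imp_Fin)
    qed
    have hol: "k holomorphic_on ball z0 \<delta>"
      unfolding holomorphic_on_def
    proof
      fix v assume "v \<in> ball z0 \<delta>"
      then have "G (Fin v) \<noteq> Infty" using low by fastforce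
      from sph_planar(1)[OF dG this] show "k field_differentiable at v within ball z0 \<delta>"
        unfolding k_def field_differentiable_def by (blast intro: DERIV_subset)
    qed
    have sub: "ball z (\<delta> / 2) \<subseteq> ball z0 \<delta>"
    proof
      fix v assume "v \<in> ball z (\<delta> / 2)"
      then show "v \<in> ball z0 \<delta>"
        using z(2) dist_triangle[of z0 v z] by simp
    qed
    have "cmod (deriv k z) \<le> 2 * 2 / (\<delta> / 2)"
    proof (rule Cauchy_deriv_bound)
      show "k holomorphic_on ball z (\<delta> / 2)" by (rule holomorphic_on_subset[OF hol sub])
      show "cmod (k v) \<le> 2" if "v \<in> ball z (\<delta> / 2)" for v
        using low[OF subsetD[OF sub that]] by (auto simp: k_def affine_coord_def)
    qed (use \<delta> in simp)
    moreover have "cmod z \<le> cmod z0 + \<delta>"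
      using z(2) \<delta>(1) norm_triangle_sub[of z z0] by (simp add: dist_norm norm_minus_commute)
    then have "(cmod z)\<^sup>2 \<le> (cmod z0 + \<delta>)\<^sup>2" by (rule power_mono) simp
    ultimately have "cmod (deriv k z) * (1 + (cmod z)\<^sup>2) \<le> C"
      unfolding C_def using \<delta>(1) by (intro mult_mono) auto
    moreover have "z \<in> ball z0 \<delta>" using z(2) \<delta>(1) by simp
    then have "G (Fin z) \<noteq> Infty" using low by fastforce
    from sph_planar(2)[OF dG this] have "sph_deriv_norm G (Fin z) \<le> cmod (deriv k z) * (1 + (cmod z)\<^sup>2)"
      by (simp add: k_def)
    ultimately show "sph_deriv_norm h y \<le> C" unfolding eq by simp
  qed
qed

lemma sph_deriv_norm_bounded_on_compact:
  assumes H: "\<And>h x. h \<in> H \<Longrightarrow> sph_diff h x" and K: "compact K"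
    and eq: "\<And>x. x \<in> K \<Longrightarrow> \<exists>S. open S \<and> x \<in> S \<and> equicontinuous_on S H"
  obtains C where "\<And>h y. h \<in> H \<Longrightarrow> y \<in> K \<Longrightarrow> sph_deriv_norm h y \<le> C"
proof -
  have "\<forall>x\<in>K. \<exists>S C. open S \<and> x \<in> S \<and> (\<forall>h\<in>H. \<forall>y\<in>S. sph_deriv_norm h y \<le> C)"
    using eq sph_deriv_norm_locally_bounded[OF H] by (metis (no_types, lifting))
  then obtain S C where SC: "\<And>x. x \<in> K \<Longrightarrow> open (S x)" "\<And>x. x \<in> K \<Longrightarrow> x \<in> S x"
    "\<And>x h y. x \<in> K \<Longrightarrow> h \<in> H \<Longrightarrow> y \<in> S x \<Longrightarrow> sph_deriv_norm h y \<le> C x"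
    by metis
  obtain X where X: "X \<subseteq> K" "finite X" "K \<subseteq> (\<Union>x\<in>X. S x)"
    using compactE_image[OF K, of K S] SC(1,2) by blast
  show thesis
  proof (rule that)
    fix h y assume h: "h \<in> H" and y: "y \<in> K"
    then obtain x where x: "x \<in> X" "y \<in> S x" using X by blast
    have "sph_deriv_norm h y \<le> C x" using SC(3) h x X by blast
    also have "\<dots> \<le> Max (C ` X)" using x X by (intro Max_ge) auto
    finally show "sph_deriv_norm h y \<le> Max (C ` X)" .
  qed
qed

lemma equicontinuous_on_singleton:
  assumes "continuous_on UNIV g"
  shows "equicontinuous_on UNIV {g}"
  unfolding equicontinuous_on_def
proof (intro ballI allI impI)
  fix x e assume "(e::real) > 0"
  then show "\<exists>\<delta>>0. \<forall>h\<in>{g}. \<forall>y\<in>UNIV. dist y x < \<delta> \<longrightarrow> dist (h y) (h x) < e"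
    using assms unfolding continuous_on_iff by (metis UNIV_I singletonD)
qed

section \<open>Contraction\<close>

primrec iter_maps :: "(nat \<Rightarrow> 'a \<Rightarrow> 'a) \<Rightarrow> nat \<Rightarrow> 'a \<Rightarrow> 'a" where
  "iter_maps \<phi> 0 = id"
| "iter_maps \<phi> (Suc n) = \<phi> n \<circ> iter_maps \<phi> n"

text \<open>The Earle--Hamilton trick: enlarging \<open>\<phi>\<close> about its value at one point by a factor
  \<open>1 + t\<close> keeps it inside the target domain, so each step gains that factor.\<close>

lemma earle_hamilton:
  fixes V :: "nat \<Rightarrow> complex set" and \<phi> :: "nat \<Rightarrow> complex \<Rightarrow> complex"
  assumes V: "\<And>n. open (V n)" and \<phi>: "\<And>n. \<phi> n holomorphic_on V n"
    and room: "\<And>n z. z \<in> V n \<Longrightarrow> cball (\<phi> n z) \<epsilon> \<subseteq> V (Suc n)"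
    and R: "\<And>n z. z \<in> V n \<Longrightarrow> cmod z \<le> R"
    and pos: "\<epsilon> > 0" "R > 0" "r > 0" and u: "ball u r \<subseteq> V 0"
  shows "iter_maps \<phi> n u \<in> V n"
    and "iter_maps \<phi> n field_differentiable at u"
    and "g holomorphic_on V n \<Longrightarrow> (\<And>z. z \<in> V n \<Longrightarrow> cmod (g z) \<le> 1) \<Longrightarrow>
      cmod (deriv (g \<circ> iter_maps \<phi> n) u) \<le> 2 / r * (1 / (1 + \<epsilon> / (2 * R))) ^ n"
proof -
  have step: "\<phi> n z \<in> V (Suc n)" if "z \<in> V n" for n z
    using room[OF that] pos(1) by auto
  have d\<phi>: "\<phi> n field_differentiable at z" if "z \<in> V n" for n z
    using \<phi> that V by (meson holomorphic_on_imp_differentiable_at)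
  show mem: "iter_maps \<phi> n u \<in> V n" for n
    by (induction n) (use u pos(3) in \<open>auto intro: step\<close>)
  show dif: "iter_maps \<phi> n field_differentiable at u" for n
  proof (induction n)
    case (Suc n)
    show ?case
      unfolding iter_maps.simps by (rule field_differentiable_compose[OF Suc.IH d\<phi>[OF mem]])
  qed (simp add: id_def field_differentiable_ident)
  \<comment> \<open>Two values of \<phi> n differ by at most 2 R, so an enlargement by the factor 1
    + t moves a value by at most t * 2 R = \<epsilon>, the available room.\<close>
  define t where "t = \<epsilon> / (2 * R)"
  have t: "t > 0" using pos by (simp add: t_def)
  show "g holomorphic_on V n \<Longrightarrow> (\<And>z. z \<in> V n \<Longrightarrow> cmod (g z) \<le> 1) \<Longrightarrow>
      cmod (deriv (g \<circ> iter_maps \<phi> n) u) \<le> 2 / r * (1 / (1 + \<epsilon> / (2 * R))) ^ n"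
    unfolding t_def[symmetric]
  \<comment> \<open>The test function \<open>g\<close> is generalised because the induction peels
    off the outermost map: the enlarged map \<open>h\<close> is absorbed into the test function g o
    h. At the base point w it has the value of \<phi> n and 1 + t times its derivative, whence the
    gain.\<close>
  proof (induction n arbitrary: g)
    case 0
    have "cmod (deriv g u) \<le> 2 * 1 / r"
    proof (rule Cauchy_deriv_bound)
      show "g holomorphic_on ball u r" using 0(1) u by (rule holomorphic_on_subset)
      show "cmod (g z) \<le> 1" if "z \<in> ball u r" for z using 0(2) that u by blast
    qed (rule pos)
    then show ?case by simp
  next
    case (Suc n)
    define w where "w = iter_maps \<phi> n u"
    define F where "F = iter_maps \<phi> n"
    define h where "h = (\<lambda>v. \<phi> n v + of_real t * (\<phi> n v - \<phi> n w))"
    have w: "w \<in> V n" unfolding w_def by (rule mem)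
    have hV: "h v \<in> V (Suc n)" if v: "v \<in> V n" for v
    proof -
      have "cmod (\<phi> n v - \<phi> n w) \<le> 2 * R"
        using norm_triangle_ineq4[of "\<phi> n v" "\<phi> n w"] R[OF step[OF v]] R[OF step[OF w]] by simp
      then have "t * cmod (\<phi> n v - \<phi> n w) \<le> t * (2 * R)" using t by (intro mult_left_mono) auto
      moreover have "dist (\<phi> n v) (h v) = t * cmod (\<phi> n v - \<phi> n w)"
        using t by (simp add: h_def dist_norm norm_mult)
      moreover have "t * (2 * R) = \<epsilon>" using pos by (simp add: t_def)
      ultimately have "dist (\<phi> n v) (h v) \<le> \<epsilon>" by simp
      then show ?thesis using room[OF v] by auto
    qed
    have hh: "h holomorphic_on V n"
      unfolding h_def by (intro holomorphic_intros \<phi>)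
    have ghol: "(g \<circ> h) holomorphic_on V n"
      by (rule holomorphic_on_compose_gen[OF hh Suc.prems(1)]) (use hV in auto)
    have IH: "cmod (deriv ((g \<circ> h) \<circ> F) u) \<le> 2 / r * (1 / (1 + t)) ^ n"
      unfolding F_def by (rule Suc.IH[OF ghol]) (use Suc.prems(2) hV in auto)
    have D\<phi>: "(\<phi> n has_field_derivative deriv (\<phi> n) w) (at w)"
      using d\<phi>[OF w] by (simp add: DERIV_deriv_iff_field_differentiable)
    have DF: "(F has_field_derivative deriv F u) (at u)"
      using dif unfolding F_def by (simp add: DERIV_deriv_iff_field_differentiable)
    have hw: "h w = \<phi> n w" by (simp add: h_def)
    have Dg: "(g has_field_derivative deriv g (\<phi> n w)) (at (\<phi> n w))"
      using Suc.prems(1) V step[OF w]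
      by (meson holomorphic_on_imp_differentiable_at DERIV_deriv_iff_field_differentiable)
    have Dh: "(h has_field_derivative deriv (\<phi> n) w + of_real t * (deriv (\<phi> n) w - 0)) (at w)"
      unfolding h_def by (intro DERIV_add DERIV_cmult DERIV_diff DERIV_const D\<phi>)
    have Fu: "F u = w" by (simp add: F_def w_def)
    have Dgh: "((g \<circ> h) has_field_derivative deriv g (\<phi> n w) * (deriv (\<phi> n) w + of_real t * (deriv (\<phi> n) w - 0))) (at w)"
      by (rule DERIV_chain) (use Dg Dh hw in simp_all)
    then have "(((g \<circ> h) \<circ> F) has_field_derivative
        deriv g (\<phi> n w) * (deriv (\<phi> n) w + of_real t * (deriv (\<phi> n) w - 0)) * deriv F u) (at u)"
      by (intro DERIV_chain[OF _ DF]) (simp only: Fu)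
    then have e1: "deriv ((g \<circ> h) \<circ> F) u = of_real (1 + t) * (deriv g (\<phi> n w) * deriv (\<phi> n) w * deriv F u)"
      by (subst DERIV_imp_deriv) (auto simp: algebra_simps)
    have "((g \<circ> \<phi> n) has_field_derivative deriv g (\<phi> n w) * deriv (\<phi> n) w) (at w)"
      by (rule DERIV_chain[OF Dg D\<phi>])
    then have "((g \<circ> \<phi> n \<circ> F) has_field_derivative deriv g (\<phi> n w) * deriv (\<phi> n) w * deriv F u) (at u)"
      by (intro DERIV_chain[OF _ DF]) (simp only: Fu)
    then have e2: "deriv (g \<circ> iter_maps \<phi> (Suc n)) u = deriv g (\<phi> n w) * deriv (\<phi> n) w * deriv F u"
      by (intro DERIV_imp_deriv) (simp add: F_def o_assoc)
    have "(1 + t) * cmod (deriv (g \<circ> iter_maps \<phi> (Suc n)) u) \<le> 2 / r * (1 / (1 + t)) ^ n"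
      using IH t unfolding e1 e2 norm_mult norm_of_real by simp
    moreover have "X \<le> B * (1 / (1 + t)) ^ Suc n" if "(1 + t) * X \<le> B * (1 / (1 + t)) ^ n" for X B
    proof -
      have "X = 1 / (1 + t) * ((1 + t) * X)" using t by simp
      also have "\<dots> \<le> 1 / (1 + t) * (B * (1 / (1 + t)) ^ n)"
        using that t by (intro mult_left_mono) auto
      finally show ?thesis by (simp add: mult_ac)
    qed
    ultimately show ?case by blast
  qed
qed

text \<open>\<open>mob 0 1 1 (- a)\<close> is the chart \<open>z \<mapsto> 1 / (z - a)\<close> with inverse \<open>mob a 1 1 0\<close>; it makes every
  set that stays away from \<open>a\<close> bounded.\<close>

lemma polar_chart_inverse:
  "mob a 1 1 0 (mob 0 1 1 (- a) x) = x" "mob 0 1 1 (- a) (mob a 1 1 0 x) = x"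
proof -
  show "mob a 1 1 0 (mob 0 1 1 (- a) x) = x"
  proof (cases x)
    case (Fin z)
    show ?thesis
    proof (cases "z = a")
      case False
      then have "z - a \<noteq> 0" by simp
      then show ?thesis by (simp add: Fin mob_def hom_pt_def) (simp add: field_simps)
    qed (simp add: Fin mob_def hom_pt_def)
  qed (simp add: mob_def hom_pt_def)
  show "mob 0 1 1 (- a) (mob a 1 1 0 x) = x"
  proof (cases x)
    case (Fin z)
    show ?thesis
    proof (cases "z = 0")
      case False
      then have "(a * z + 1) / z - a = 1 / z" by (simp add: add_divide_distrib)
      then show ?thesis using False by (simp add: Fin mob_def hom_pt_def)
    qed (simp add: Fin mob_def hom_pt_def)
  qed (simp add: mob_def hom_pt_def)
qed

lemma sph_diff_polar: "sph_diff (mob 0 1 1 (- a)) x" "sph_diff (mob a 1 1 0) x"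
  by (rule sph_diff_mob, simp)+

lemma polar_chart_finite: "x \<noteq> Fin a \<Longrightarrow> mob 0 1 1 (- a) x \<noteq> Infty"
  by (cases x) (auto simp: mob_def hom_pt_def)

text \<open>A disk of some radius d about a misses the closure of W, so 1/(z - a) has modulus at
  most 1/d on W.\<close>

lemma polar_chart_bounded:
  assumes "Fin a \<notin> closure W"
  obtains R where "\<And>u. mob a 1 1 0 (Fin u) \<in> W \<Longrightarrow> cmod u \<le> R"
proof -
  have "((\<lambda>s. Fin (a + s)) \<longlongrightarrow> Fin (a + 0)) (nhds 0)"
    by (intro tendsto_Fin tendsto_intros) (simp add: filterlim_def)
  then have "\<forall>\<^sub>F s in nhds 0. Fin (a + s) \<in> - closure W"
    by (rule topological_tendstoD) (use assms in auto)
  then obtain d where d: "d > 0" "\<And>s. cmod s < d \<Longrightarrow> Fin (a + s) \<notin> closure W"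
    unfolding eventually_nhds_metric by (auto simp: dist_norm)
  show thesis
  proof (rule that)
    fix u assume W: "mob a 1 1 0 (Fin u) \<in> W"
    show "cmod u \<le> 1 / d"
    proof (rule ccontr)
      assume *: "\<not> cmod u \<le> 1 / d"
      then have "1 / d < cmod u" by simp
      moreover have "1 / d > 0" using d(1) by simp
      ultimately have u: "cmod u > 0" by linarith
      then have "cmod (1 / u) < d" using * d(1) by (simp add: norm_divide field_simps)
      from d(2)[OF this] have "Fin (a + 1 / u) \<notin> W" using closure_subset by blast
      moreover have "mob a 1 1 0 (Fin u) = Fin (a + 1 / u)"
      proof -
        have "u \<noteq> 0" using u by auto
        then have "(a * u + 1) / u = a + 1 / u" by (simp add: add_divide_distrib)
        then show ?thesis using \<open>u \<noteq> 0\<close> by (simp add: mob_def hom_pt_def)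
      qed
      ultimately show False using W by simp
    qed
  qed
qed

text \<open>The centre of a polar chart has to be finite. If only \<open>Infty\<close> is known to
  be omitted, openness of the complement provides omitted points near it, and these are
  finite.\<close>

lemma finite_point_outside:
  assumes "closed (S :: rsphere set)" "S \<noteq> UNIV"
  obtains a where "Fin a \<notin> S"
proof -
  obtain y where y: "y \<notin> S" using assms(2) by auto
  have "((\<lambda>t. affine_param y t) \<longlongrightarrow> affine_param y (affine_coord y y)) (at (affine_coord y y))"
    by (intro tendsto_affine_param tendsto_ident_at)
  then have "\<forall>\<^sub>F t in at (affine_coord y y). affine_param y t \<in> - S"
    by (rule topological_tendstoD) (use y assms(1) in auto)
  moreover have "\<forall>\<^sub>F t in at (affine_coord y y). t \<noteq> affine_coord y y"
    by (simp add: eventually_at_filter)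
  ultimately have "\<forall>\<^sub>F t in at (affine_coord y y). \<exists>a. Fin a \<notin> S"
    by eventually_elim (auto simp: affine_param_def affine_coord_def split: if_splits)
  then have "\<exists>a. Fin a \<notin> S" by simp
  then show thesis using that by blast
qed

text \<open>A single continuous map is an equicontinuous family, so the uniform bound applies to the
  one-element family on the compact sphere.\<close>

lemma sph_deriv_norm_bounded:
  assumes "\<And>x. sph_diff g x"
  obtains C where "C > 0" "\<And>x. sph_deriv_norm g x \<le> C"
proof -
  have "equicontinuous_on UNIV {g}"
    by (rule equicontinuous_on_singleton[OF sph_diff_imp_continuous_on[OF assms]])
  then obtain C where C: "\<And>x. sph_deriv_norm g x \<le> C"
    using sph_deriv_norm_bounded_on_compact[OF _ compact_rsphere, of "{g}"] assms
    by (metis UNIV_I open_UNIV singletonD singletonI)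
  show thesis by (rule that[of "max C 1"]) (auto intro: order_trans[OF C])
qed

text \<open>Replaces constants chosen vertex by vertex by a single one. A lower bound is brought
  into this monotone form by passing to its reciprocal.\<close>

lemma uniform_on_finite:
  fixes Q :: "'i \<Rightarrow> real \<Rightarrow> bool"
  assumes "finite I" "\<And>i. i \<in> I \<Longrightarrow> \<exists>r. Q i r" "\<And>i r s. Q i r \<Longrightarrow> r \<le> s \<Longrightarrow> Q i s"
  obtains r where "r > 0" "\<And>i. i \<in> I \<Longrightarrow> Q i r"
proof -
  obtain f where f: "\<And>i. i \<in> I \<Longrightarrow> Q i (f i)" using assms(2) by metis
  show thesis
  proof (rule that[of "Max (insert 1 (f ` I))"])
    show "Max (insert 1 (f ` I)) > 0" using assms(1) by (subst Max_gr_iff) auto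
    show "Q i (Max (insert 1 (f ` I)))" if "i \<in> I" for i
      using assms(1) that by (intro assms(3)[OF f[OF that]] Max_ge) auto
  qed
qed

text \<open>Polar charts turn each \<open>W i\<close> into a bounded open set \<open>V i\<close> of
  the plane, in which \<open>U i\<close> keeps a positive distance from the boundary. Finitely many
  vertices share one bound R and one margin \<epsilon>, so \<beta> depends neither on the itinerary
  \<open>s\<close>, nor on the maps \<open>G\<close>, nor on the point; only the factor A
  does.\<close>

theorem exponential_contraction:
  fixes W U :: "'i \<Rightarrow> rsphere set"
  assumes I: "finite I" and W: "\<And>i. i \<in> I \<Longrightarrow> open (W i)"
    and clW: "\<And>i. i \<in> I \<Longrightarrow> closure (W i) \<noteq> UNIV"
    and UW: "\<And>i. i \<in> I \<Longrightarrow> closure (U i) \<subseteq> W i"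
  obtains \<beta> where "0 < \<beta>" "\<beta> < 1"
    "\<And>s G x. (\<And>n. s n \<in> I) \<Longrightarrow> (\<And>n y. sph_diff (G n) y) \<Longrightarrow>
       (\<And>n. G n ` W (s n) \<subseteq> U (s (Suc n))) \<Longrightarrow> x \<in> W (s 0) \<Longrightarrow>
       \<exists>A. \<forall>n. iter_maps G n x \<in> W (s n) \<and> sph_deriv_norm (iter_maps G n) x \<le> A * \<beta> ^ n"
proof -
  have "\<exists>a. Fin a \<notin> closure (W i)" if "i \<in> I" for i
    using finite_point_outside[of "closure (W i)"] clW[OF that] by auto
  then obtain a where a: "\<And>i. i \<in> I \<Longrightarrow> Fin (a i) \<notin> closure (W i)" by metis
  define M N where "M i = mob 0 1 1 (- a i)" and "N i = mob (a i) 1 1 0" for i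
  have NM: "N i (M i x) = x" and MN: "M i (N i x) = x" for i x
    by (simp_all add: M_def N_def polar_chart_inverse)
  have dM: "sph_diff (M i) x" and dN: "sph_diff (N i) x" for i x
    by (simp_all add: M_def N_def sph_diff_polar)
  define fin :: "rsphere \<Rightarrow> complex" where "fin = affine_coord (Fin 0)"
  have fin [simp]: "fin (Fin z) = z" for z by (simp add: fin_def affine_coord_def)
  define V where "V i = {u. N i (Fin u) \<in> W i}" for i
  have contN: "continuous_on UNIV (\<lambda>u. N i (Fin u))" for i
    by (rule continuous_on_compose2[OF sph_diff_imp_continuous_on[OF dN] continuous_on_Fin]) auto
  have V: "open (V i)" if "i \<in> I" for i
    using open_vimage[OF W[OF that] contN[of i]] by (simp add: V_def vimage_def)
  have MW: "M i x = Fin (fin (M i x))" if "i \<in> I" "x \<in> W i" for i x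
  proof -
    have "x \<noteq> Fin (a i)" using a[OF that(1)] that(2) closure_subset by blast
    then have "M i x \<noteq> Infty" unfolding M_def by (rule polar_chart_finite)
    then show ?thesis by (cases "M i x") auto
  qed
  have finV: "fin (M i x) \<in> V i" if "i \<in> I" "x \<in> W i" for i x
    using that MW[OF that] NM[of i x] by (simp add: V_def)
  obtain R where R: "R > 0" "\<And>i. i \<in> I \<Longrightarrow> \<forall>u\<in>V i. cmod u \<le> R"
  proof (rule uniform_on_finite[OF I, of "\<lambda>i r. \<forall>u\<in>V i. cmod u \<le> r"])
    show "\<exists>r. \<forall>u\<in>V i. cmod u \<le> r" if i: "i \<in> I" for i
    proof -
      obtain r where "\<And>u. mob (a i) 1 1 0 (Fin u) \<in> W i \<Longrightarrow> cmod u \<le> r"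
        using polar_chart_bounded[OF a[OF i]] by metis
      then show ?thesis unfolding V_def N_def by auto
    qed
    show "\<forall>u\<in>V i. cmod u \<le> b" if "\<forall>u\<in>V i. cmod u \<le> a" "a \<le> b" for i a b
      using that by (meson order_trans)
  qed (use that in blast)
  \<comment> \<open>In the chart the closure of \<open>U i\<close> is a compact subset of
    \<open>V i\<close> and has a margin there. The margin is written 1 / E because
    \<open>uniform_on_finite\<close> produces upper bounds.\<close>
  obtain E where E: "E > 0" "\<And>i. i \<in> I \<Longrightarrow> \<forall>u. N i (Fin u) \<in> closure (U i) \<longrightarrow> cball u (1 / E) \<subseteq> V i"
  proof (rule uniform_on_finite[OF I, of "\<lambda>i r. r > 0 \<and> (\<forall>u. N i (Fin u) \<in> closure (U i) \<longrightarrow> cball u (1 / r) \<subseteq> V i)"])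
    fix i assume i: "i \<in> I"
    define K where "K = {u. N i (Fin u) \<in> closure (U i)}"
    have KV: "K \<subseteq> V i" using UW[OF i] by (auto simp: K_def V_def)
    have "closed K"
      using closed_vimage[OF closed_closure contN[of i], of "U i"] by (simp add: K_def vimage_def)
    moreover have "bounded K" using KV R(2)[OF i] by (auto simp: bounded_iff)
    ultimately have "compact K" by (simp add: compact_eq_bounded_closed)
    then obtain \<epsilon> where \<epsilon>: "\<epsilon> > 0" "(\<Union>x\<in>K. cball x \<epsilon>) \<subseteq> V i"
      using compact_subset_open_imp_cball_epsilon_subset[OF _ V[OF i] KV] by blast
    then show "\<exists>r. r > 0 \<and> (\<forall>u. N i (Fin u) \<in> closure (U i) \<longrightarrow> cball u (1 / r) \<subseteq> V i)"
      by (intro exI[of _ "1 / \<epsilon>"]) (auto simp: K_def)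
  next
    fix i and r s :: real
    assume *: "r > 0 \<and> (\<forall>u. N i (Fin u) \<in> closure (U i) \<longrightarrow> cball u (1 / r) \<subseteq> V i)" and rs: "r \<le> s"
    then have "1 / s \<le> 1 / r" "s > 0" by (auto intro: divide_left_mono)
    then show "s > 0 \<and> (\<forall>u. N i (Fin u) \<in> closure (U i) \<longrightarrow> cball u (1 / s) \<subseteq> V i)"
      using * subset_cball[of "1 / s" "1 / r"] by blast
  qed (use that in blast)
  obtain C where C: "C > 0" "\<And>i. i \<in> I \<Longrightarrow> \<forall>x. sph_deriv_norm (N i) x \<le> C"
  proof (rule uniform_on_finite[OF I, of "\<lambda>i r. \<forall>x. sph_deriv_norm (N i) x \<le> r"])
    show "\<exists>r. \<forall>x. sph_deriv_norm (N i) x \<le> r" for i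
      using sph_deriv_norm_bounded[OF dN] by metis
    show "\<forall>x. sph_deriv_norm (N i) x \<le> b" if "\<forall>x. sph_deriv_norm (N i) x \<le> a" "a \<le> b" for i a b
      using that by (meson order_trans)
  qed (use that in blast)
  define \<epsilon> where "\<epsilon> = 1 / E"
  have \<epsilon>: "\<epsilon> > 0" using E(1) by (simp add: \<epsilon>_def)
  define \<beta> where "\<beta> = 1 / (1 + \<epsilon> / (2 * R))"
  have l: "0 < \<beta>" "\<beta> < 1" using \<epsilon> R(1) by (simp_all add: \<beta>_def field_simps add_pos_pos)
  show thesis
  proof (rule that[OF l])
    fix s :: "nat \<Rightarrow> 'i" and G x
    assume s: "\<And>n. s n \<in> I" and dG: "\<And>n y. sph_diff (G n) y"
      and GW: "\<And>n. G n ` W (s n) \<subseteq> U (s (Suc n))" and x: "x \<in> W (s 0)"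
    \<comment> \<open>The map G n read in the charts of two consecutive vertices; in a composition
      the intermediate charts cancel.\<close>
    define \<phi> where "\<phi> n v = fin (M (s (Suc n)) (G n (N (s n) (Fin v))))" for n v
    have UinW: "U i \<subseteq> W i" if "i \<in> I" for i using UW[OF that] closure_subset by blast
    have G_in_U: "G n (N (s n) (Fin v)) \<in> U (s (Suc n))" if "v \<in> V (s n)" for n v
      using that GW by (auto simp: V_def)
    have Fin\<phi>: "Fin (\<phi> n v) = M (s (Suc n)) (G n (N (s n) (Fin v)))" if "v \<in> V (s n)" for n v
      using MW[OF s subsetD[OF UinW[OF s] G_in_U[OF that]]] by (simp add: \<phi>_def)
    have hol: "\<phi> n holomorphic_on V (s n)" for n
      unfolding holomorphic_on_def
    proof
      fix v assume v: "v \<in> V (s n)"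
      define g where "g = M (s (Suc n)) \<circ> (G n \<circ> N (s n))"
      have "sph_diff g (Fin v)" unfolding g_def by (intro sph_diff_chain(1) dM dN dG)
      moreover have "g (Fin v) \<noteq> Infty" unfolding g_def o_apply Fin\<phi>[OF v, symmetric] by simp
      ultimately have "((\<lambda>v. affine_coord (Fin 0) (g (Fin v))) has_field_derivative
          deriv (\<lambda>v. affine_coord (Fin 0) (g (Fin v))) v) (at v)"
        by (rule sph_planar(1))
      moreover have "(\<lambda>v. affine_coord (Fin 0) (g (Fin v))) = \<phi> n"
        by (auto simp: \<phi>_def g_def fin_def)
      ultimately show "\<phi> n field_differentiable at v within V (s n)"
        unfolding field_differentiable_def by (metis DERIV_subset subset_UNIV)
    qed
    have room: "cball (\<phi> n v) \<epsilon> \<subseteq> V (s (Suc n))" if "v \<in> V (s n)" for n v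
    proof -
      have "N (s (Suc n)) (Fin (\<phi> n v)) \<in> closure (U (s (Suc n)))"
        unfolding Fin\<phi>[OF that] NM using G_in_U[OF that] closure_subset by blast
      then show ?thesis using E(2)[OF s] by (auto simp: \<epsilon>_def)
    qed
    define u where "u = fin (M (s 0) x)"
    have u: "u \<in> V (s 0)" unfolding u_def by (rule finV[OF s x])
    then obtain r where r: "r > 0" "ball u r \<subseteq> V (s 0)"
      using V[OF s] by (meson open_contains_ball)
    have Rb: "cmod v \<le> R" if "v \<in> V (s n)" for n v using R(2)[OF s] that by blast
    note EH = earle_hamilton[where V = "\<lambda>n. V (s n)" and \<phi> = \<phi>, OF V[OF s] hol room Rb \<epsilon> R(1) r]
    have conj: "iter_maps \<phi> n v \<in> V (s n) \<and> N (s n) (Fin (iter_maps \<phi> n v)) = iter_maps G n (N (s 0) (Fin v))"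
      if v: "v \<in> V (s 0)" for n v
    proof (induction n)
      case 0
      then show ?case using v by simp
    next
      case (Suc n)
      then have i: "iter_maps \<phi> n v \<in> V (s n)" by simp
      have "\<phi> n (iter_maps \<phi> n v) \<in> V (s (Suc n))" using room[OF i] \<epsilon> by auto
      then show ?case using Suc by (simp add: Fin\<phi>[OF i] NM)
    qed
    have xu: "x = N (s 0) (Fin u)" unfolding u_def using MW[OF s x] NM by metis
    \<comment> \<open>The chain rule through the charts: C bounds the derivative of N (s n), the
      middle factor comes from the planar estimate, and the last is the derivative of the initial
      chart at x. The factor R undoes the normalisation z / R, the test function of modulus at most
      1 given to \<open>earle_hamilton\<close>.\<close>
    define A where "A = C * (R * (2 / r) * (1 + (cmod u)\<^sup>2)) * sph_deriv_norm (M (s 0)) x"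
    have "iter_maps G n x \<in> W (s n) \<and> sph_deriv_norm (iter_maps G n) x \<le> A * \<beta> ^ n" for n
    proof
      show "iter_maps G n x \<in> W (s n)"
        using conj[OF u, of n] unfolding xu by (auto simp: V_def)
      have dI: "sph_diff (iter_maps G n) y" for n y
      proof (induction n)
        case 0
        show ?case unfolding iter_maps.simps by (rule sph_diff_id)
      next
        case (Suc n)
        show ?case unfolding iter_maps.simps by (rule sph_diff_chain(1)[OF Suc.IH dG])
      qed
      define k where "k = M (s n) \<circ> (iter_maps G n \<circ> N (s 0))"
      have dk: "sph_diff k y" for y unfolding k_def by (intro sph_diff_chain(1) dM dN dI)
      have kFin: "k (Fin v) = Fin (iter_maps \<phi> n v)" if "v \<in> V (s 0)" for v
        unfolding k_def o_apply conj[OF that, THEN conjunct2, symmetric] MN ..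
      have eq: "iter_maps G n = N (s n) \<circ> (k \<circ> M (s 0))"
        by (simp add: k_def fun_eq_iff NM)
      have Mx: "M (s 0) x = Fin u" using MW[OF s x] by (simp add: u_def)
      have dkv: "cmod (deriv (\<lambda>v. affine_coord (Fin 0) (k (Fin v))) u) \<le> R * (2 / r) * \<beta> ^ n"
      proof -
        have "\<forall>\<^sub>F v in nhds u. v \<in> V (s 0)" using V[OF s] u by (rule eventually_nhds_in_open)
        then have "\<forall>\<^sub>F v in nhds u. affine_coord (Fin 0) (k (Fin v)) = iter_maps \<phi> n v"
          by eventually_elim (simp add: kFin affine_coord_def)
        then have e: "deriv (\<lambda>v. affine_coord (Fin 0) (k (Fin v))) u = deriv (iter_maps \<phi> n) u"
          by (rule deriv_cong_ev) simp
        have "cmod (deriv ((\<lambda>z. z / of_real R) \<circ> iter_maps \<phi> n) u) \<le> 2 / r * \<beta> ^ n"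
          unfolding \<beta>_def
        proof (rule EH(3))
          show "(\<lambda>z. z / of_real R) holomorphic_on V (s n)" using R(1) by (intro holomorphic_intros) auto
          show "cmod (z / of_real R) \<le> 1" if "z \<in> V (s n)" for z
            using Rb[OF that] R(1) by (simp add: norm_divide)
        qed
        moreover have "deriv ((\<lambda>z. z / of_real R) \<circ> iter_maps \<phi> n) u = deriv (iter_maps \<phi> n) u / of_real R"
          unfolding o_def using EH(2) by (rule deriv_cdivide_right)
        ultimately show ?thesis
          unfolding e using R(1) by (simp add: norm_divide field_simps)
      qed
      have "k (Fin u) \<noteq> Infty" using kFin[OF u] by simp
      then have "sph_deriv_norm k (Fin u) \<le> cmod (deriv (\<lambda>v. affine_coord (Fin 0) (k (Fin v))) u) * (1 + (cmod u)\<^sup>2)"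
        by (rule sph_planar(2)[OF dk])
      also have "\<dots> \<le> R * (2 / r) * \<beta> ^ n * (1 + (cmod u)\<^sup>2)"
        by (intro mult_right_mono dkv) simp
      finally have kb: "sph_deriv_norm k (Fin u) \<le> R * (2 / r) * \<beta> ^ n * (1 + (cmod u)\<^sup>2)" .
      have "sph_deriv_norm (iter_maps G n) x =
          sph_deriv_norm (N (s n)) (k (Fin u)) * (sph_deriv_norm k (Fin u) * sph_deriv_norm (M (s 0)) x)"
        unfolding eq sph_diff_chain(2)[OF sph_diff_chain(1)[OF dM dk] dN] sph_diff_chain(2)[OF dM dk]
        by (simp add: Mx)
      also have "\<dots> \<le> C * (R * (2 / r) * \<beta> ^ n * (1 + (cmod u)\<^sup>2) * sph_deriv_norm (M (s 0)) x)"
        using C(2)[OF s] C(1) kb by (intro mult_mono mult_right_mono) (auto intro!: mult_nonneg_nonneg sph_deriv_norm_nonneg)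
      also have "\<dots> = A * \<beta> ^ n" by (simp add: A_def mult_ac)
      finally show "sph_deriv_norm (iter_maps G n) x \<le> A * \<beta> ^ n" .
    qed
    then show "\<exists>A. \<forall>n. iter_maps G n x \<in> W (s n) \<and> sph_deriv_norm (iter_maps G n) x \<le> A * \<beta> ^ n" by blast
  qed
qed

section \<open>Admissible words and the Fatou sets\<close>

lemma admissible_iff:
  "admissible E es \<longleftrightarrow> es \<noteq> [] \<and> set es \<subseteq> E \<and> successively (\<lambda>e e'. snd e = fst e') es"
  by (simp add: admissible_def successively_conv_nth)

lemma admissible_append:
  assumes "admissible E es" "admissible E es'" "word_term es = word_init es'"
  shows "admissible E (es @ es')" "word_init (es @ es') = word_init es"
    "word_term (es @ es') = word_term es'"
  using assms by (auto simp: admissible_iff successively_append_iff word_init_def word_term_def)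

lemma maps_along_append:
  "maps_along \<tau> es fs \<Longrightarrow> maps_along \<tau> es' fs' \<Longrightarrow> maps_along \<tau> (es @ es') (fs @ fs')"
  unfolding maps_along_def by (rule list_all2_appendI)

section \<open>Supports and weights of edges\<close>

lemma closed_topological_support: "closed (topological_support M)"
proof -
  have "- topological_support M = \<Union>{U. open U \<and> emeasure M U = 0}"
    by (auto simp: topological_support_def zero_less_iff_neq_zero)
  then have "open (- topological_support M)" by auto
  then show ?thesis by (simp add: closed_def)
qed

text \<open>The complement of the support is a union of open null sets, in general too many for
  countable additivity. Finitely many of them cover a given compact subset, and inner regularity
  does the rest.\<close>

lemma emeasure_outside_support:
  assumes reg: "regular_measure M" and sets: "sets M = sets borel"
  shows "emeasure M (- topological_support M) = 0"
proof -
  let ?S = "- topological_support M"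
  have S: "?S \<in> sets M" unfolding sets by (intro borel_open open_Compl closed_topological_support)
  have "emeasure M K = 0" if K: "K \<subseteq> ?S" "compact K" for K
  proof -
    let ?T = "{U. open U \<and> emeasure M U = 0}"
    have "K \<subseteq> \<Union>?T" using K(1) by (auto simp: topological_support_def zero_less_iff_neq_zero subset_iff)
    then obtain D where D: "D \<subseteq> ?T" "finite D" "K \<subseteq> \<Union>D"
      by (rule compactE[OF K(2)]) auto
    have DM: "D \<subseteq> null_sets M" using D(1) sets by (auto simp: null_sets_def intro: borel_open)
    have "\<Union>D \<in> null_sets M" using DM D(2) by (intro null_sets.finite_Union) auto
    then have "emeasure M (\<Union>D) = 0" by auto
    moreover have "emeasure M K \<le> emeasure M (\<Union>D)"
      using D(3) \<open>\<Union>D \<in> null_sets M\<close> by (intro emeasure_mono) auto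
    ultimately show ?thesis by simp
  qed
  then have "(SUP K\<in>{K. K \<subseteq> ?S \<and> compact K}. emeasure M K) = 0"
    by (intro antisym SUP_least) (auto simp: le_zero_eq)
  then show ?thesis using reg S unfolding regular_measure_def by metis
qed

lemma edge_measure_facts:
  assumes "is_MRDS q \<tau>" "e \<in> edges q \<tau>"
  shows "sets (edge_measure \<tau> e) = sets borel" "regular_measure (edge_measure \<tau> e)"
    "emeasure (edge_measure \<tau> e) UNIV > 0" "emeasure (edge_measure \<tau> e) UNIV \<le> 1"
    "edge_support \<tau> e \<noteq> {}" "fst e \<in> verts q" "snd e \<in> verts q"
proof -
  show v: "fst e \<in> verts q" "snd e \<in> verts q" and pos: "emeasure (edge_measure \<tau> e) UNIV > 0"
    using assms(2) by (auto simp: edges_def edge_measure_def)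
  show s: "sets (edge_measure \<tau> e) = sets borel" and r: "regular_measure (edge_measure \<tau> e)"
    using assms(1) v unfolding is_MRDS_def edge_measure_def by blast+
  have "(\<Sum>j\<in>verts q. emeasure (\<tau> (fst e) j) UNIV) = 1"
    using assms(1) v unfolding is_MRDS_def by blast
  moreover have "emeasure (\<tau> (fst e) (snd e)) UNIV \<le> (\<Sum>j\<in>verts q. emeasure (\<tau> (fst e) j) UNIV)"
    using v by (intro member_le_sum) auto
  ultimately show "emeasure (edge_measure \<tau> e) UNIV \<le> 1" by (simp add: edge_measure_def)
  show "edge_support \<tau> e \<noteq> {}"
  proof
    assume "edge_support \<tau> e = {}"
    then have "emeasure (edge_measure \<tau> e) UNIV = 0"
      using emeasure_outside_support[OF r s] by (simp add: edge_support_def)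
    with pos show False by simp
  qed
qed

lemma finite_edges: "finite (edges q \<tau>)"
  by (rule finite_subset[of _ "verts q \<times> verts q"]) (auto simp: edges_def)

text \<open>Reachability of i from i is trivial in the reflexive closure and gives no word. A first
  edge comes from the row sum 1, and irreducibility leads back from its end.\<close>

lemma admissible_loop:
  assumes "is_MRDS q \<tau>" "irreducible_system q \<tau>" "i \<in> verts q"
  obtains es where "admissible (edges q \<tau>) es" "word_init es = i" "word_term es = i"
proof -
  have "(\<Sum>j\<in>verts q. emeasure (\<tau> i j) UNIV) \<noteq> 0"
    using assms(1,3) unfolding is_MRDS_def by (metis zero_neq_one)
  then obtain j where j: "j \<in> verts q" "emeasure (\<tau> i j) UNIV \<noteq> 0"
    by (meson sum.neutral)
  then have e: "(i, j) \<in> edges q \<tau>" using assms(3) by (simp add: edges_def zero_less_iff_neq_zero)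
  have "\<exists>es. admissible (edges q \<tau>) es \<and> word_init es = i \<and> word_term es = k"
    if "(j, k) \<in> (edges q \<tau>)\<^sup>*" for k
    using that
  proof (induction rule: rtrancl_induct)
    case base
    show ?case using e by (intro exI[of _ "[(i, j)]"]) (simp add: admissible_iff word_init_def word_term_def)
  next
    case (step y z)
    then obtain es where es: "admissible (edges q \<tau>) es" "word_init es = i" "word_term es = y" by blast
    have "admissible (edges q \<tau>) [(y, z)]" using step by (simp add: admissible_iff)
    from admissible_append[OF es(1) this] es show ?case
      by (intro exI[of _ "es @ [(y, z)]"]) (simp add: word_init_def word_term_def)
  qed
  moreover have "(j, i) \<in> (edges q \<tau>)\<^sup>*"
    using assms(2,3) j unfolding irreducible_system_def by blast
  ultimately show thesis using that by blast
qed

lemma surj_comp_maps: "surj (comp_maps fs)"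
proof (induction fs)
  case (Cons f fs)
  show ?case unfolding comp_maps_simps by (rule comp_surj[OF surj_app Cons.IH])
qed simp

text \<open>All powers of a composition h along a loop at i belong to the semigroup of i. Were i
  everywhere in its Fatou set, these powers would be equicontinuous on the sphere, so h would be
  injective, and with it the first map of the composition, whose degree is at least 2.\<close>

lemma Fatou_neq_UNIV:
  assumes "is_MRDS q \<tau>" "irreducible_system q \<tau>" "i \<in> verts q"
  shows "Fatou q \<tau> i \<noteq> UNIV"
proof
  assume F: "Fatou q \<tau> i = UNIV"
  obtain es where es: "admissible (edges q \<tau>) es" "word_init es = i" "word_term es = i"
    by (rule admissible_loop[OF assms])
  have "\<forall>e\<in>set es. \<exists>f. f \<in> edge_support \<tau> e"
    using es(1) edge_measure_facts(5)[OF assms(1)] unfolding admissible_iff by blast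
  then obtain \<phi> where \<phi>: "\<And>e. e \<in> set es \<Longrightarrow> \<phi> e \<in> edge_support \<tau> e" by metis
  define fs where "fs = map \<phi> es"
  have along: "maps_along \<tau> es fs"
    unfolding maps_along_def fs_def by (simp add: list_all2_conv_all_nth \<phi>)
  define h where "h = comp_maps fs"
  have iter: "\<exists>fs' es'. h ^^ Suc n = comp_maps fs' \<and> admissible (edges q \<tau>) es' \<and>
      maps_along \<tau> es' fs' \<and> word_init es' = i \<and> word_term es' = i" for n
  proof (induction n)
    case 0
    show ?case using es along by (auto simp: h_def)
  next
    case (Suc n)
    then obtain fs' es' where *: "h ^^ Suc n = comp_maps fs'" "admissible (edges q \<tau>) es'"
      "maps_along \<tau> es' fs'" "word_init es' = i" "word_term es' = i" by blast
    have "h ^^ Suc (Suc n) = h \<circ> (h ^^ Suc n)" by (rule funpow.simps)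
    also have "\<dots> = comp_maps (fs' @ fs)" unfolding * by (simp only: h_def comp_maps_append)
    finally show ?case
      using admissible_append[OF *(2) es(1)] maps_along_append[OF *(3) along] * es by metis
  qed
  have mem: "h ^^ n \<in> (\<Union>j\<in>verts q. semigroup_from_to q \<tau> i j)" if "n \<ge> 1" for n
    using iter[of "n - 1"] that assms(3) unfolding semigroup_from_to_def by force
  have "inj h"
  proof (rule equicontinuous_surj_imp_inj[OF compact_rsphere])
    show "surj h" unfolding h_def by (rule surj_comp_maps)
    fix x and e :: real assume e: "e > 0"
    have "x \<in> Fatou q \<tau> i" using F by simp
    then obtain S where S: "open S" "x \<in> S" "equicontinuous_on S (\<Union>j\<in>verts q. semigroup_from_to q \<tau> i j)"
      unfolding Fatou_def by blast
    obtain \<delta> where \<delta>: "\<delta> > 0" "\<And>g y. g \<in> (\<Union>j\<in>verts q. semigroup_from_to q \<tau> i j) \<Longrightarrow> y \<in> S \<Longrightarrow>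
        dist y x < \<delta> \<Longrightarrow> dist (g y) (g x) < e"
      using S(2,3) e unfolding equicontinuous_on_def by meson
    obtain \<delta>' where \<delta>': "\<delta>' > 0" "ball x \<delta>' \<subseteq> S" using S(1,2) by (meson open_contains_ball)
    show "\<exists>\<delta>>0. \<forall>n\<ge>1. \<forall>y. dist y x < \<delta> \<longrightarrow> dist ((h ^^ n) y) ((h ^^ n) x) < e"
    proof (intro exI[of _ "min \<delta> \<delta>'"] conjI allI impI)
      fix n :: nat and y assume "1 \<le> n" "dist y x < min \<delta> \<delta>'"
      then have "n \<ge> 1" "dist y x < \<delta>" "y \<in> ball x \<delta>'" by (auto simp: dist_commute)
      then show "dist ((h ^^ n) y) ((h ^^ n) x) < e"
        using \<delta>(2)[OF mem] \<delta>'(2) by blast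
    qed (use \<delta> \<delta>' in simp)
  qed
  obtain e es' where "es = e # es'" using es(1) by (cases es) (auto simp: admissible_iff)
  then have "h = comp_maps (map \<phi> es') \<circ> app (\<phi> e)" by (simp add: h_def fs_def)
  with \<open>inj h\<close> have "inj (app (\<phi> e))" by (metis inj_on_imageI2)
  then show False using not_inj_app by blast
qed

section \<open>Orbits that enter the trapping sets\<close>

text \<open>The constant D contributes ln D / n, which tends to 0; a vanishing derivative
  contributes minus infinity.\<close>

lemma limsup_ext_ln_le:
  assumes D: "D > 0" and bd: "\<And>n. n \<ge> m \<Longrightarrow> 0 \<le> s n \<and> s n \<le> D * exp (\<alpha> * real n)"
  shows "limsup (\<lambda>n. ext_ln (s n) / ereal (real n)) \<le> ereal \<alpha>"
proof -
  have "\<forall>\<^sub>F n in sequentially. n \<ge> max m 1" by (rule eventually_ge_at_top)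
  then have ev: "\<forall>\<^sub>F n in sequentially. ext_ln (s n) / ereal (real n) \<le> ereal (ln D * (1 / real n) + \<alpha>)"
  proof eventually_elim
    case (elim n)
    then have n: "real n > 0" "n \<ge> m" by auto
    show ?case
    proof (cases "s n = 0")
      case True
      then show ?thesis using n by (simp add: ext_ln_def)
    next
      case False
      then have s: "0 < s n" "s n \<le> D * exp (\<alpha> * real n)" using bd[OF n(2)] by auto
      then have "ln (s n) \<le> ln (D * exp (\<alpha> * real n))" by simp
      also have "\<dots> = ln D + \<alpha> * real n" using D by (simp add: ln_mult)
      finally have "ln (s n) / real n \<le> (ln D + \<alpha> * real n) / real n"
        using n by (intro divide_right_mono) auto
      also have "\<dots> = ln D * (1 / real n) + \<alpha>" using n by (simp add: add_divide_distrib)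
      finally show ?thesis using False n by (simp add: ext_ln_def)
    qed
  qed
  have "(\<lambda>n. ereal (ln D * (1 / real n) + \<alpha>)) \<longlonglongrightarrow> ereal (ln D * 0 + \<alpha>)"
    by (intro tendsto_intros lim_1_over_n)
  then have "limsup (\<lambda>n. ereal (ln D * (1 / real n) + \<alpha>)) = ereal \<alpha>"
    by (simp add: lim_imp_Limsup)
  then show ?thesis using Limsup_mono[OF ev] by simp
qed

lemma slice_word:
  assumes e: "\<And>n. e n \<in> E" "\<And>n. snd (e n) = fst (e (Suc n))" and ab: "a < b"
  shows "admissible E (map e [a..<b])" "word_init (map e [a..<b]) = fst (e a)"
    "word_term (map e [a..<b]) = snd (e (b - 1))"
  using ab by (auto simp: admissible_def e word_init_def word_term_def hd_map last_map)

lemma slice_maps: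
  assumes "\<And>n. f n \<in> edge_support \<tau> (e n)"
  shows "maps_along \<tau> (map e [a..<b]) (map f [a..<b])"
  by (simp add: maps_along_def list_all2_conv_all_nth assms)

lemma comp_maps_slice:
  "a \<le> b \<Longrightarrow> b \<le> c \<Longrightarrow>
    comp_maps (map f [a..<c]) = comp_maps (map f [b..<c]) \<circ> comp_maps (map f [a..<b])"
  by (metis comp_maps_append map_append upt_add_eq_append le_Suc_ex)

text \<open>Time n is split into the m + 1 letters up to the entry, k blocks of N letters, and fewer
  than N remaining letters. The derivatives are, in this order, a constant of the orbit, at most A
  \<beta>^k, and at most C, since the last part starts in the compact closure of a \<open>W\<close>
  inside the Fatou set.\<close>

theorem trapped_orbit_exponent:
  fixes W U :: "nat \<Rightarrow> rsphere set"
  assumes \<tau>: "is_MRDS q \<tau>" "irreducible_system q \<tau>" and N: "N \<ge> 1"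
    and oW: "\<And>i. i \<in> verts q \<Longrightarrow> open (W i)"
    and UW: "\<And>i. i \<in> verts q \<Longrightarrow> closure (U i) \<subseteq> W i"
    and WF: "\<And>i. i \<in> verts q \<Longrightarrow> closure (W i) \<subseteq> Fatou q \<tau> i"
    and trap: "\<And>es fs. length es = N \<Longrightarrow> admissible (edges q \<tau>) es \<Longrightarrow> maps_along \<tau> es fs \<Longrightarrow>
      closure (comp_maps fs ` W (word_init es)) \<subseteq> U (word_term es)"
  shows "\<exists>\<alpha><0. \<forall>f e m z. (\<forall>n. e n \<in> edges q \<tau>) \<longrightarrow> (\<forall>n. snd (e n) = fst (e (Suc n))) \<longrightarrow>
      (\<forall>n. f n \<in> edge_support \<tau> (e n)) \<longrightarrow>
      comp_maps (map f [0..<Suc m]) z \<in> W (snd (e m)) \<longrightarrow>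
      limsup (\<lambda>n. ext_ln (sph_deriv_norm (comp_maps (map f [0..<n])) z) / ereal (real n)) \<le> ereal \<alpha>"
proof -
  have clW: "closure (W i) \<noteq> UNIV" if "i \<in> verts q" for i
    using WF[OF that] Fatou_neq_UNIV[OF \<tau> that] by auto
  obtain \<beta> where \<beta>: "0 < \<beta>" "\<beta> < 1"
    "\<And>s G x. (\<And>n. s n \<in> verts q) \<Longrightarrow> (\<And>n y. sph_diff (G n) y) \<Longrightarrow>
       (\<And>n. G n ` W (s n) \<subseteq> U (s (Suc n))) \<Longrightarrow> x \<in> W (s 0) \<Longrightarrow>
       \<exists>A. \<forall>n. iter_maps G n x \<in> W (s n) \<and> sph_deriv_norm (iter_maps G n) x \<le> A * \<beta> ^ n"
    by (rule exponential_contraction[OF finite_atLeastAtMost oW clW UW]) blast+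
  \<comment> \<open>Words are non-empty, so \<open>id\<close> is added for the case that no letters
    remain after the last block.\<close>
  define H where "H j = insert id (\<Union>k\<in>verts q. semigroup_from_to q \<tau> j k)" for j
  obtain C where C: "C > 0" "\<And>j. j \<in> verts q \<Longrightarrow> \<forall>h\<in>H j. \<forall>y\<in>closure (W j). sph_deriv_norm h y \<le> C"
  proof (rule uniform_on_finite[OF finite_atLeastAtMost, of 1 q "\<lambda>j r. \<forall>h\<in>H j. \<forall>y\<in>closure (W j). sph_deriv_norm h y \<le> r"])
    fix j assume j: "j \<in> verts q"
    have "compact (closure (W j))" using compact_Int_closed[OF compact_rsphere closed_closure] by simp
    moreover have "\<exists>S. open S \<and> x \<in> S \<and> equicontinuous_on S (\<Union>k\<in>verts q. semigroup_from_to q \<tau> j k)"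
      if "x \<in> closure (W j)" for x
      using WF[OF j] that unfolding Fatou_def by blast
    moreover have "sph_diff h x" if "h \<in> (\<Union>k\<in>verts q. semigroup_from_to q \<tau> j k)" for h x
      using that unfolding semigroup_from_to_def by (auto intro: sph_diff_comp_maps)
    ultimately obtain c where c: "\<And>h y. h \<in> (\<Union>k\<in>verts q. semigroup_from_to q \<tau> j k) \<Longrightarrow>
        y \<in> closure (W j) \<Longrightarrow> sph_deriv_norm h y \<le> c"
      using sph_deriv_norm_bounded_on_compact[of "\<Union>k\<in>verts q. semigroup_from_to q \<tau> j k" "closure (W j)"]
      by metis
    show "\<exists>r. \<forall>h\<in>H j. \<forall>y\<in>closure (W j). sph_deriv_norm h y \<le> r"
    proof (intro exI ballI)
      fix h y assume "h \<in> H j" "y \<in> closure (W j)"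
      then show "sph_deriv_norm h y \<le> max c 1"
        using c[of h y] unfolding H_def
        by (auto simp: sph_deriv_norm_id simp del: UN_iff intro: le_max_iff_disj[THEN iffD2])
    qed
  next
    fix i and r s :: real
    assume "\<forall>h\<in>H i. \<forall>y\<in>closure (W i). sph_deriv_norm h y \<le> r" "r \<le> s"
    then show "\<forall>h\<in>H i. \<forall>y\<in>closure (W i). sph_deriv_norm h y \<le> s" by (meson order_trans)
  qed (use that in blast)
  define \<alpha> where "\<alpha> = ln \<beta> / real N"
  have \<alpha>: "\<alpha> < 0" using \<beta> N by (simp add: \<alpha>_def divide_neg_pos)
  show ?thesis
  proof (intro exI[of _ \<alpha>] conjI \<alpha> allI impI)
    fix f e m z
    assume "\<forall>n. e n \<in> edges q \<tau>" "\<forall>n. snd (e n) = fst (e (Suc n))" "\<forall>n. f n \<in> edge_support \<tau> (e n)"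
    then have e: "\<And>n. e n \<in> edges q \<tau>" "\<And>n. snd (e n) = fst (e (Suc n))"
      and f: "\<And>n. f n \<in> edge_support \<tau> (e n)" by blast+
    assume z: "comp_maps (map f [0..<Suc m]) z \<in> W (snd (e m))"
    define x where "x = comp_maps (map f [0..<Suc m]) z"
    \<comment> \<open>The vertex reached after n blocks: letters are counted from 0, so the entry at
      edge m happens after m + 1 letters, and block n ends with edge m + (n + 1) N.\<close>
    define s where "s n = snd (e (m + n * N))" for n
    define G where "G n = comp_maps (map f [Suc (m + n * N)..<Suc (m + Suc n * N)])" for n
    have sv: "s n \<in> verts q" for n
      using edge_measure_facts(7)[OF \<tau>(1) e(1)] by (simp add: s_def)
    have GU: "G n ` W (s n) \<subseteq> U (s (Suc n))" for n
    proof -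
      let ?a = "Suc (m + n * N)" and ?b = "Suc (m + Suc n * N)"
      have ab: "?a < ?b" using N by simp
      note w = slice_word[where e = e, OF e ab]
      have "closure (comp_maps (map f [?a..<?b]) ` W (word_init (map e [?a..<?b]))) \<subseteq> U (word_term (map e [?a..<?b]))"
        by (rule trap[OF _ w(1) slice_maps[where e = e, OF f]]) simp
      then show ?thesis unfolding w(2,3) using closure_subset by (fastforce simp: G_def s_def e(2))
    qed
    have dG: "sph_diff (G n) y" for n y unfolding G_def by (rule sph_diff_comp_maps)
    have x0: "x \<in> W (s 0)" using z by (simp add: x_def s_def)
    obtain A where A: "\<And>n. iter_maps G n x \<in> W (s n)" "\<And>n. sph_deriv_norm (iter_maps G n) x \<le> A * \<beta> ^ n"
      using \<beta>(3)[of s G x, OF sv dG GU x0] by blast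
    have iterG: "iter_maps G n = comp_maps (map f [Suc m..<Suc (m + n * N)])" for n
    proof (induction n)
      case (Suc n)
      show ?case
        unfolding iter_maps.simps Suc.IH by (subst G_def) (rule comp_maps_slice[symmetric]; simp)
    qed simp
    define B where "B = sph_deriv_norm (comp_maps (map f [0..<Suc m])) z"
    have B: "B \<ge> 0" unfolding B_def by (rule sph_deriv_norm_nonneg)
    \<comment> \<open>The exponential pays for rounding down to whole blocks, k N >= n - (m + 1 +
      N), where \<alpha> < 0. The replacements of A by max A 1 and of B by B + 1 make D
      positive.\<close>
    define D where "D = C * (max A 1 * (B + 1)) * exp (- (\<alpha> * (m + 1 + N)))"
    have D: "D > 0" using C B by (simp add: D_def)
    show "limsup (\<lambda>n. ext_ln (sph_deriv_norm (comp_maps (map f [0..<n])) z) / ereal (real n)) \<le> ereal \<alpha>"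
    proof (rule limsup_ext_ln_le[OF D, of "Suc m"], intro conjI sph_deriv_norm_nonneg)
      fix n assume n: "n \<ge> Suc m"
      define k where "k = (n - Suc m) div N"
      have kN: "k * N \<le> n - Suc m" "n - Suc m < k * N + N"
        using N dividend_less_div_times[of N "n - Suc m"] by (simp_all add: k_def add.commute)
      let ?b = "Suc (m + k * N)"
      have b: "?b \<le> n" using kN(1) n by simp
      define \<psi> where "\<psi> = comp_maps (map f [?b..<n])"
      have \<psi>: "\<psi> \<in> H (s k)"
      proof (cases "?b = n")
        case True
        then show ?thesis by (simp add: \<psi>_def H_def)
      next
        case False
        with b have bn: "?b < n" by simp
        note w = slice_word[where e = e, OF e bn]
        have "snd (e (n - 1)) \<in> verts q" by (rule edge_measure_facts(7)[OF \<tau>(1) e(1)])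
        moreover have "\<psi> \<in> semigroup_from_to q \<tau> (s k) (snd (e (n - 1)))"
          unfolding semigroup_from_to_def \<psi>_def using w slice_maps[where e = e, OF f]
          by (auto simp: s_def e(2))
        ultimately show ?thesis by (auto simp: H_def)
      qed
      have split: "comp_maps (map f [0..<n]) = \<psi> \<circ> (iter_maps G k \<circ> comp_maps (map f [0..<Suc m]))"
        using comp_maps_slice[of 0 ?b n f] comp_maps_slice[of 0 "Suc m" ?b f] b
        by (simp add: \<psi>_def iterG del: upt_Suc)
      have dI: "sph_diff (iter_maps G k) y" and d\<psi>: "sph_diff \<psi> y" for y
        unfolding iterG \<psi>_def by (rule sph_diff_comp_maps)+
      have "sph_deriv_norm (comp_maps (map f [0..<n])) z =
          sph_deriv_norm \<psi> (iter_maps G k x) * (sph_deriv_norm (iter_maps G k) x * B)"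
        unfolding split sph_diff_chain(2)[OF sph_diff_chain(1)[OF sph_diff_comp_maps dI] d\<psi>]
          sph_diff_chain(2)[OF sph_diff_comp_maps dI] B_def x_def o_apply ..
      also have "\<dots> \<le> C * ((max A 1 * \<beta> ^ k) * (B + 1))"
      proof (intro mult_mono)
        show "sph_deriv_norm \<psi> (iter_maps G k x) \<le> C"
          using C(2)[OF sv] \<psi> A(1) closure_subset by blast
        have "A * \<beta> ^ k \<le> max A 1 * \<beta> ^ k" using \<beta>(1) by (intro mult_right_mono) auto
        with A(2) show "sph_deriv_norm (iter_maps G k) x \<le> max A 1 * \<beta> ^ k" by (rule order_trans)
      qed (use C B \<beta> in \<open>auto intro!: mult_nonneg_nonneg sph_deriv_norm_nonneg\<close>)
      also have "\<dots> \<le> C * ((max A 1 * (exp (- (\<alpha> * (m + 1 + N))) * exp (\<alpha> * real n))) * (B + 1))"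
      proof (intro mult_left_mono mult_right_mono)
        have e: "\<alpha> * (real k * real N) = real k * ln \<beta>" using N by (simp add: \<alpha>_def)
        have "\<beta> ^ k = exp (\<alpha> * (real k * real N))"
          unfolding e using \<beta>(1) by (simp add: exp_of_nat_mult)
        also have "\<dots> \<le> exp (\<alpha> * (real n - (m + 1 + N)))"
        proof -
          have "n < k * N + N + Suc m" using kN n by linarith
          then have "real n \<le> real (k * N + N + Suc m)" by (simp only: of_nat_le_iff less_imp_le)
          then have "real n - (m + 1 + N) \<le> real k * real N" by simp
          then show ?thesis using \<alpha> by (simp add: mult_left_mono_neg)
        qed
        also have "\<dots> = exp (- (\<alpha> * (m + 1 + N))) * exp (\<alpha> * real n)"
          unfolding exp_add[symmetric] by (simp add: algebra_simps)
        finally show "\<beta> ^ k \<le> exp (- (\<alpha> * (m + 1 + N))) * exp (\<alpha> * real n)" .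
      qed (use C B in auto)
      also have "\<dots> = D * exp (\<alpha> * real n)" by (simp only: D_def mult_ac)
      finally show "sph_deriv_norm (comp_maps (map f [0..<n])) z \<le> D * exp (\<alpha> * real n)" .
    qed
  qed
qed

section \<open>Measurability on the path space\<close>

lemma dist_app_le: "dist (app f z) (app g z) \<le> dist f g"
  unfolding dist_ratmap_def by (rule cSUP_upper) (auto intro!: bdd_aboveI2 dist_rsphere_le_pi)

lemma continuous_on_app: "continuous_on UNIV (app f)"
  by (rule sph_diff_imp_continuous_on[OF sph_diff_app])

lemma continuous_on_eval: "continuous_on UNIV (\<lambda>f. app f z)"
  unfolding continuous_on_iff by (metis dist_app_le le_less_trans)

text \<open>\<^typ>\<open>ratmap\<close> carries no countability assumption, so joint measurability is obtained by
  rounding the argument to a finite net of the sphere.\<close>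

lemma measurable_app:
  assumes f: "f \<in> borel_measurable M" and X: "X \<in> borel_measurable M"
  shows "(\<lambda>\<omega>. app (f \<omega>) (X \<omega>)) \<in> borel_measurable M"
proof -
  have "\<exists>ys :: rsphere list. \<forall>x. \<exists>m. dist (ys ! m) x < inverse (Suc k)" for k :: nat
  proof -
    have "UNIV \<subseteq> (\<Union>x\<in>UNIV. ball (x :: rsphere) (inverse (Suc k)))" by auto
    then obtain Y where Y: "finite Y" "UNIV \<subseteq> (\<Union>x\<in>Y. ball (x :: rsphere) (inverse (Suc k)))"
      using compactE_image[OF compact_rsphere] by (metis open_ball)
    obtain ys where ys: "set ys = Y" using finite_list[OF Y(1)] by blast
    have "\<exists>m. dist (ys ! m) x < inverse (Suc k)" for x
    proof -
      obtain y where "y \<in> Y" "dist y x < inverse (Suc k)"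
        using subsetD[OF Y(2) UNIV_I, of x] unfolding UN_iff mem_ball by blast
      then show ?thesis using ys by (metis in_set_conv_nth)
    qed
    then show ?thesis by blast
  qed
  then obtain ys :: "nat \<Rightarrow> rsphere list" where ys: "\<And>k x. \<exists>m. dist (ys k ! m) x < inverse (Suc k)" by metis
  \<comment> \<open>The least index of a net point close to the argument is a natural number, so
    evaluation at the rounded argument selects among countably many functions, each with a fixed
    argument.\<close>
  define idx where "idx k x = (LEAST m. dist (ys k ! m) x < inverse (Suc k))" for k x
  have idx: "dist (ys k ! idx k x) x < inverse (Suc k)" for k x
    unfolding idx_def using ys by (rule LeastI_ex)
  have ball: "(\<lambda>\<omega>. dist y (X \<omega>) < r) \<in> measurable M (count_space UNIV)" for y r
  proof -
    have "X -` ball y r \<inter> space M \<in> sets M" by (rule measurable_sets[OF X]) simp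
    moreover have "X -` ball y r \<inter> space M = {\<omega> \<in> space M. dist y (X \<omega>) < r}" by auto
    ultimately show ?thesis by (simp add: pred_def)
  qed
  have idx_meas: "(\<lambda>\<omega>. idx k (X \<omega>)) \<in> measurable M (count_space UNIV)" for k
    unfolding idx_def by (rule measurable_Least) (rule ball)
  have "(\<lambda>\<omega>. app (f \<omega>) (ys k ! idx k (X \<omega>))) \<in> borel_measurable M" for k
  proof (rule measurable_compose_countable[OF _ idx_meas, of "\<lambda>m \<omega>. app (f \<omega>) (ys k ! m)"])
    show "(\<lambda>\<omega>. app (f \<omega>) (ys k ! m)) \<in> borel_measurable M" for m
      by (rule measurable_compose[OF f borel_measurable_continuous_onI[OF continuous_on_eval]])
  qed
  then show ?thesis
  proof (rule borel_measurable_LIMSEQ_metric)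
    fix \<omega>
    have "(\<lambda>k. ys k ! idx k (X \<omega>)) \<longlonglongrightarrow> X \<omega>"
    proof (rule metric_tendsto_imp_tendsto[OF LIMSEQ_inverse_real_of_nat])
      show "\<forall>\<^sub>F k in sequentially. dist (ys k ! idx k (X \<omega>)) (X \<omega>) \<le> dist (inverse (real (Suc k))) 0"
        using idx[of _ "X \<omega>"] by (auto intro!: always_eventually less_imp_le)
    qed
    then show "(\<lambda>k. app (f \<omega>) (ys k ! idx k (X \<omega>))) \<longlonglongrightarrow> app (f \<omega>) (X \<omega>)"
      using continuous_on_app by (metis UNIV_I continuous_on_eq_continuous_at isCont_tendsto_compose open_UNIV)
  qed
qed

lemma measurable_path_map: "(\<lambda>\<omega>. fst (\<omega> n)) \<in> borel_measurable (path_borel E)"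
proof (rule borel_measurableI)
  fix S :: "ratmap set" assume "open S"
  have "continuous_map (path_topology E) euclidean (\<lambda>\<omega>. fst (\<omega> n))"
    unfolding path_topology_def by (intro continuous_map_product_projection[THEN continuous_map_compose, unfolded o_def] continuous_map_fst) simp
  then have "openin (path_topology E) {\<omega> \<in> topspace (path_topology E). fst (\<omega> n) \<in> S}"
    by (rule openin_continuous_map_preimage) (use \<open>open S\<close> in simp)
  moreover have "space (path_borel E) = topspace (path_topology E)"
    by (simp add: space_path_borel path_topology_def)
  ultimately show "(\<lambda>\<omega>. fst (\<omega> n)) -` S \<inter> space (path_borel E) \<in> sets (path_borel E)"
    unfolding sets_path_borel by (intro sigma_sets.Basic) (simp add: vimage_def Int_def conj_commute)
qed

lemma path_edge_set: "{\<omega> \<in> space (path_borel E). snd (\<omega> n) \<in> T} \<in> sets (path_borel E)"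
proof -
  have "continuous_map (path_topology E) (discrete_topology E) (\<lambda>\<omega>. snd (\<omega> n))"
    unfolding path_topology_def by (intro continuous_map_product_projection[THEN continuous_map_compose, unfolded o_def] continuous_map_snd) simp
  then have "openin (path_topology E) {\<omega> \<in> topspace (path_topology E). snd (\<omega> n) \<in> T \<inter> E}"
    by (rule openin_continuous_map_preimage) simp
  moreover have sp: "space (path_borel E) = topspace (path_topology E)"
    by (simp add: space_path_borel path_topology_def)
  moreover have "{\<omega> \<in> topspace (path_topology E). snd (\<omega> n) \<in> T \<inter> E} = {\<omega> \<in> space (path_borel E). snd (\<omega> n) \<in> T}"
    unfolding sp[symmetric] space_path_borel by (auto simp: PiE_iff mem_Times_iff)
  ultimately show ?thesis
    unfolding sets_path_borel by (auto intro: sigma_sets.Basic)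
qed

lemma path_edge_in: "\<omega> \<in> space (path_borel E) \<Longrightarrow> snd (\<omega> n) \<in> E"
  by (auto simp: space_path_borel PiE_iff mem_Times_iff)

section \<open>Events determined by finitely many letters\<close>

definition rectangles :: "edge set \<Rightarrow> nat \<Rightarrow> (nat \<Rightarrow> ratmap \<times> edge) set set" where
  "rectangles E n = {cylinder E n A e | A e. \<forall>k<n. A k \<in> sets borel \<and> e k \<in> E}"

lemma rectanglesI:
  "(\<And>k. k < n \<Longrightarrow> A k \<in> sets borel \<and> e k \<in> E) \<Longrightarrow> cylinder E n A e \<in> rectangles E n"
  unfolding rectangles_def by blast

text \<open>The filtration of the path process. It is generated by rectangles rather than by open
  sets because these are the sets whose measure is prescribed.\<close>

definition history :: "edge set \<Rightarrow> nat \<Rightarrow> (nat \<Rightarrow> ratmap \<times> edge) measure" where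
  "history E n = sigma (space (path_borel E)) (rectangles E n)"

lemma rectangles_Pow: "rectangles E n \<subseteq> Pow (space (path_borel E))"
  by (auto simp: rectangles_def cylinder_def)

lemma space_history: "space (history E n) = space (path_borel E)"
  and sets_history: "sets (history E n) = sigma_sets (space (path_borel E)) (rectangles E n)"
  unfolding history_def using rectangles_Pow by (auto simp: space_measure_of sets_measure_of)

lemma cylinder_alt:
  "cylinder E n A e = {\<omega> \<in> space (path_borel E). \<forall>k<n. fst (\<omega> k) \<in> A k \<and> snd (\<omega> k) = e k}"
  by (auto simp: cylinder_def mem_Times_iff)

lemma cylinder_sets:
  assumes "\<And>k. k < n \<Longrightarrow> A k \<in> sets borel"
  shows "cylinder E n A e \<in> sets (path_borel E)"
proof -
  have "cylinder E n A e = space (path_borel E) \<inter> (\<Inter>k\<in>{..<n}.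
      ((\<lambda>\<omega>. fst (\<omega> k)) -` A k \<inter> space (path_borel E)) \<inter> {\<omega> \<in> space (path_borel E). snd (\<omega> k) \<in> {e k}}) "
    by (auto simp: cylinder_alt)
  also have "\<dots> \<in> sets (path_borel E)"
  proof (cases "n = 0")
    case False
    then show ?thesis
      by (intro sets.Int sets.top sets.finite_INT path_edge_set measurable_sets[OF measurable_path_map] assms) auto
  qed simp
  finally show ?thesis .
qed

lemma history_subset: "sets (history E n) \<subseteq> sets (path_borel E)"
  unfolding sets_history
  by (rule sets.sigma_sets_subset) (auto simp: rectangles_def intro: cylinder_sets)

text \<open>Rectangles over different edge words are disjoint, and the empty set is itself a
  rectangle, with empty factors.\<close>

lemma Int_stable_rectangles:
  assumes "n \<ge> 1" shows "Int_stable (rectangles E n)"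
proof (rule Int_stableI)
  fix a b assume "a \<in> rectangles E n" "b \<in> rectangles E n"
  then obtain A e A' e' where *: "a = cylinder E n A e" "\<And>k. k < n \<Longrightarrow> A k \<in> sets borel \<and> e k \<in> E"
     "b = cylinder E n A' e'" "\<And>k. k < n \<Longrightarrow> A' k \<in> sets borel \<and> e' k \<in> E"
    unfolding rectangles_def by blast
  show "a \<inter> b \<in> rectangles E n"
  proof (cases "\<forall>k<n. e k = e' k")
    case True
    then have "a \<inter> b = cylinder E n (\<lambda>k. A k \<inter> A' k) e"
      unfolding *(1,3) cylinder_alt by auto
    moreover have "\<forall>k<n. A k \<inter> A' k \<in> sets borel \<and> e k \<in> E" using * by auto
    ultimately show ?thesis unfolding rectangles_def by blast
  next
    case False
    then have "a \<inter> b = cylinder E n (\<lambda>_. {}) e"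
      unfolding *(1,3) cylinder_alt using assms by auto
    moreover have "\<forall>k<n. {} \<in> sets (borel :: ratmap measure) \<and> e k \<in> E" using * by auto
    ultimately show ?thesis unfolding rectangles_def by blast
  qed
qed

text \<open>A rectangle prescribes all n edges, so a condition on one letter is a union over all
  edge words of length n, which are finitely many.\<close>

lemma history_coord:
  assumes "finite E" "k < n" "S \<in> sets borel"
  shows "{\<omega> \<in> space (path_borel E). fst (\<omega> k) \<in> S \<and> snd (\<omega> k) \<in> T} \<in> sets (history E n)"
proof -
  let ?I = "{e \<in> {..<n} \<rightarrow>\<^sub>E E. e k \<in> T}"
  let ?A = "\<lambda>j. if j = k then S else UNIV"
  have "{\<omega> \<in> space (path_borel E). fst (\<omega> k) \<in> S \<and> snd (\<omega> k) \<in> T} = (\<Union>e\<in>?I. cylinder E n ?A e)"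
  proof (intro set_eqI iffI)
    fix \<omega> assume \<omega>: "\<omega> \<in> {\<omega> \<in> space (path_borel E). fst (\<omega> k) \<in> S \<and> snd (\<omega> k) \<in> T}"
    define e where "e = restrict (\<lambda>j. snd (\<omega> j)) {..<n}"
    have "e \<in> ?I" using \<omega> assms(2) by (auto simp: e_def path_edge_in)
    moreover have "\<omega> \<in> cylinder E n ?A e" using \<omega> by (auto simp: cylinder_alt e_def)
    ultimately show "\<omega> \<in> (\<Union>e\<in>?I. cylinder E n ?A e)" by blast
  qed (use assms(2) in \<open>auto simp: cylinder_alt\<close>)
  moreover have "finite ?I"
    by (rule finite_subset[of _ "{..<n} \<rightarrow>\<^sub>E E"]) (auto intro!: finite_PiE assms(1))
  moreover have "cylinder E n ?A e \<in> sets (history E n)" if "e \<in> ?I" for e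
    unfolding sets_history
    by (intro sigma_sets.Basic rectanglesI) (use that assms(3) in \<open>auto simp: PiE_iff\<close>)
  ultimately show ?thesis by (auto intro!: sets.finite_UN)
qed

section \<open>Random orbits and their measurability\<close>

definition orbit :: "rsphere \<Rightarrow> nat \<Rightarrow> (nat \<Rightarrow> ratmap \<times> edge) \<Rightarrow> rsphere" where
  "orbit z n \<omega> = comp_maps (map (\<lambda>k. fst (\<omega> k)) [0..<n]) z"

lemma orbit_Suc: "orbit z (Suc n) \<omega> = app (fst (\<omega> n)) (orbit z n \<omega>)"
  by (simp add: orbit_def comp_maps_append)

lemma orbit_add: "orbit z (n + m) \<omega> = comp_maps (map (\<lambda>k. fst (\<omega> (n + k))) [0..<m]) (orbit z n \<omega>)"
  by (induction m) (simp_all add: orbit_Suc comp_maps_append)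

lemma measurable_orbit:
  assumes "finite E" "m \<le> n"
  shows "orbit z m \<in> borel_measurable (history E n)"
  using assms(2)
proof (induction m)
  case 0
  then show ?case by (simp add: orbit_def)
next
  case (Suc m)
  have "(\<lambda>\<omega>. fst (\<omega> m)) \<in> borel_measurable (history E n)"
  proof (rule borel_measurableI)
    fix S :: "ratmap set" assume "open S"
    then have "{\<omega> \<in> space (path_borel E). fst (\<omega> m) \<in> S \<and> snd (\<omega> m) \<in> UNIV} \<in> sets (history E n)"
      using Suc.prems by (intro history_coord assms) auto
    moreover have "(\<lambda>\<omega>. fst (\<omega> m)) -` S \<inter> space (history E n) =
        {\<omega> \<in> space (path_borel E). fst (\<omega> m) \<in> S \<and> snd (\<omega> m) \<in> UNIV}"
      by (auto simp: space_history)
    ultimately show "(\<lambda>\<omega>. fst (\<omega> m)) -` S \<inter> space (history E n) \<in> sets (history E n)" by simp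
  qed
  then have "(\<lambda>\<omega>. app (fst (\<omega> m)) (orbit z m \<omega>)) \<in> borel_measurable (history E n)"
    using Suc by (intro measurable_app) auto
  then show ?case by (simp add: orbit_Suc[abs_def])
qed

lemma orbit_event:
  assumes "finite E" "m \<le> n" "k < n" "open S"
  shows "{\<omega> \<in> space (path_borel E). orbit z m \<omega> \<in> S \<and> snd (\<omega> k) \<in> T} \<in> sets (history E n)"
proof -
  have "orbit z m -` S \<inter> space (history E n) \<in> sets (history E n)"
    by (rule measurable_sets[OF measurable_orbit[OF assms(1,2)]]) (use assms(4) in simp)
  moreover have "{\<omega> \<in> space (path_borel E). fst (\<omega> k) \<in> UNIV \<and> snd (\<omega> k) \<in> T} \<in> sets (history E n)"
    by (intro history_coord assms) simp
  ultimately have "orbit z m -` S \<inter> space (history E n) \<inter> {\<omega> \<in> space (path_borel E). fst (\<omega> k) \<in> UNIV \<and> snd (\<omega> k) \<in> T} \<in> sets (history E n)"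
    by (rule sets.Int)
  moreover have "orbit z m -` S \<inter> space (history E n) \<inter> {\<omega> \<in> space (path_borel E). fst (\<omega> k) \<in> UNIV \<and> snd (\<omega> k) \<in> T} =
      {\<omega> \<in> space (path_borel E). orbit z m \<omega> \<in> S \<and> snd (\<omega> k) \<in> T}"
    by (auto simp: space_history)
  ultimately show ?thesis by simp
qed

section \<open>The Markov property\<close>

lemma prod_lessThan_add:
  "(\<Prod>k<n + m. g k) = (\<Prod>k<n. g k) * (\<Prod>k<m. g (n + k :: nat) :: 'a :: comm_monoid_mult)"
  by (induction m) (simp_all add: mult_ac)

locale path_measure =
  fixes q :: nat and \<tau> :: system and i :: nat and M :: "(nat \<Rightarrow> ratmap \<times> edge) measure"
  assumes mrds: "is_MRDS q \<tau>" and pm: "is_path_measure q \<tau> i M"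
begin

abbreviation "E \<equiv> edges q \<tau>"
abbreviation "\<Omega> \<equiv> space (path_borel (edges q \<tau>))"
abbreviation "wt e A \<equiv> measure (edge_measure \<tau> e) A"

lemma sets_M: "sets M = sets (path_borel E)"
  using pm by (simp add: is_path_measure_def)

lemma space_M: "space M = \<Omega>"
  using sets_M by (rule sets_eq_imp_space_eq)

sublocale finite_measure M
  by (rule finite_measureI) (use pm in \<open>simp add: is_path_measure_def\<close>)

lemma history_M: "B \<in> sets (history E n) \<Longrightarrow> B \<in> sets M"
  using history_subset sets_M by blast

lemma measure_cylinder:
  assumes "n \<ge> 1" "\<And>k. k < n \<Longrightarrow> A k \<in> sets borel \<and> e k \<in> E"
  shows "measure M (cylinder E n A e) =
    (if admissible E (map e [0..<n]) \<and> fst (e 0) = i then \<Prod>k<n. wt (e k) (A k) else 0)"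
proof -
  have "emeasure (edge_measure \<tau> (e k)) (A k) = ennreal (wt (e k) (A k))" if "k < n" for k
  proof -
    note facts = edge_measure_facts[OF mrds, of "e k"]
    have "emeasure (edge_measure \<tau> (e k)) (A k) \<le> emeasure (edge_measure \<tau> (e k)) UNIV"
      using facts assms(2)[OF that] by (intro emeasure_mono) auto
    also have "\<dots> \<le> 1" using facts assms(2)[OF that] by simp
    finally have "emeasure (edge_measure \<tau> (e k)) (A k) \<noteq> \<infinity>"
      by (metis ennreal_one_less_top infinity_ennreal_def leD)
    then show ?thesis by (simp add: emeasure_eq_ennreal_measure)
  qed
  then have "(\<Prod>k<n. emeasure (edge_measure \<tau> (e k)) (A k)) = (\<Prod>k<n. ennreal (wt (e k) (A k)))"
    by (intro prod.cong) auto
  also have "\<dots> = ennreal (\<Prod>k<n. wt (e k) (A k))"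
    by (rule prod_ennreal) simp
  finally have *: "(\<Prod>k<n. emeasure (edge_measure \<tau> (e k)) (A k)) = ennreal (\<Prod>k<n. wt (e k) (A k))" .
  have "emeasure M (cylinder E n A e) =
      (if admissible E (map e [0..<n]) \<and> fst (e 0) = i then ennreal (\<Prod>k<n. wt (e k) (A k)) else 0)"
    using pm assms unfolding is_path_measure_def *[symmetric] by blast
  then show ?thesis
    by (simp add: measure_def prod_nonneg)
qed

lemma cylinder_cover:
  "\<Omega> = (\<Union>e\<in>{..<n} \<rightarrow>\<^sub>E E. cylinder E n (\<lambda>_. UNIV) e)"
proof (intro set_eqI iffI)
  fix \<omega> assume \<omega>: "\<omega> \<in> \<Omega>"
  define e where "e = restrict (\<lambda>j. snd (\<omega> j)) {..<n}"
  have "e \<in> {..<n} \<rightarrow>\<^sub>E E" using \<omega> by (auto simp: e_def path_edge_in)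
  moreover have "\<omega> \<in> cylinder E n (\<lambda>_. UNIV) e" using \<omega> by (auto simp: cylinder_alt e_def)
  ultimately show "\<omega> \<in> (\<Union>e\<in>{..<n} \<rightarrow>\<^sub>E E. cylinder E n (\<lambda>_. UNIV) e)" by blast
qed (auto simp: cylinder_alt)

text \<open>Cylinder weights multiply under concatenation of words. \<open>J\<close> fixes the
  vertex reached after n letters, so that appending \<open>es\<close> to an edge word of the past is
  admissible exactly when that word is. This settles rectangles, and Dynkin's argument extends the
  identity to every event of the past.\<close>

lemma markov:
  fixes es :: "nat \<Rightarrow> edge" and A :: "nat \<Rightarrow> ratmap set"
  assumes n: "n \<ge> 1" and m: "m \<ge> 1" and B: "B \<in> sets (history E n)"
    and A: "\<And>k. k < m \<Longrightarrow> A k \<in> sets borel" and adm: "admissible E (map es [0..<m])"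
  defines "J \<equiv> {\<omega> \<in> \<Omega>. snd (\<omega> (n - 1)) \<in> {e. snd e = fst (es 0)}}"
    and "S \<equiv> {\<omega> \<in> \<Omega>. \<forall>k<m. fst (\<omega> (n + k)) \<in> A k \<and> snd (\<omega> (n + k)) = es k}"
  shows "measure M (B \<inter> J \<inter> S) = (\<Prod>k<m. wt (es k) (A k)) * measure M (B \<inter> J)"
proof -
  define c where "c = (\<Prod>k<m. wt (es k) (A k))"
  have esE: "es k \<in> E" if "k < m" for k using adm that by (auto simp: admissible_iff)
  have J: "J \<in> sets M" unfolding J_def sets_M by (rule path_edge_set)
  have "S = \<Omega> \<inter> (\<Inter>k\<in>{..<m}. ((\<lambda>\<omega>. fst (\<omega> (n + k))) -` A k \<inter> \<Omega>) \<inter> {\<omega> \<in> \<Omega>. snd (\<omega> (n + k)) \<in> {es k}})"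
    by (auto simp: S_def)
  also have "\<dots> \<in> sets M"
  proof -
    have "(\<lambda>\<omega>. fst (\<omega> (n + k))) -` A k \<inter> \<Omega> \<in> sets (path_borel E)" if "k < m" for k
      by (rule measurable_sets[OF measurable_path_map A[OF that]])
    moreover have "{..<m} \<noteq> {}" using m by (simp add: lessThan_empty_iff)
    ultimately show ?thesis
      unfolding sets_M by (intro sets.Int[OF sets.top] sets.finite_INT sets.Int[OF _ path_edge_set]) auto
  qed
  finally have S: "S \<in> sets M" .
  have cyl: "measure M (C \<inter> J \<inter> S) = c * measure M (C \<inter> J)" if C: "C \<in> rectangles E n" for C
  proof -
    obtain A' e' where C': "C = cylinder E n A' e'" "\<And>k. k < n \<Longrightarrow> A' k \<in> sets borel \<and> e' k \<in> E"
      using C unfolding rectangles_def by blast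
    show ?thesis
    proof (cases "snd (e' (n - 1)) = fst (es 0)")
      case False
      then have "C \<inter> J = {}" using n by (auto simp: C' cylinder_alt J_def)
      then show ?thesis by simp
    next
      case True
      have CJ: "C \<inter> J = C" using True n by (auto simp: C' cylinder_alt J_def)
      define A2 where "A2 k = (if k < n then A' k else A (k - n))" for k
      define e2 where "e2 k = (if k < n then e' k else es (k - n))" for k
      have A2: "A2 (n + k) = A k" and e2: "e2 (n + k) = es k" for k by (simp_all add: A2_def e2_def)
      have low: "k < n \<Longrightarrow> A2 k = A' k" "k < n \<Longrightarrow> e2 k = e' k" for k by (simp_all add: A2_def e2_def)
      have "C \<inter> J \<inter> S = cylinder E (n + m) A2 e2"
      proof (intro set_eqI iffI)
        fix \<omega> assume "\<omega> \<in> C \<inter> J \<inter> S"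
        then have \<omega>: "\<omega> \<in> \<Omega>" "\<And>k. k < n \<Longrightarrow> fst (\<omega> k) \<in> A' k \<and> snd (\<omega> k) = e' k"
          "\<And>k. k < m \<Longrightarrow> fst (\<omega> (n + k)) \<in> A k \<and> snd (\<omega> (n + k)) = es k"
          by (auto simp: C' cylinder_alt S_def)
        have "fst (\<omega> k) \<in> A2 k \<and> snd (\<omega> k) = e2 k" if "k < n + m" for k
          using \<omega>(2)[of k] \<omega>(3)[of "k - n"] that by (auto simp: A2_def e2_def)
        with \<omega>(1) show "\<omega> \<in> cylinder E (n + m) A2 e2" by (simp add: cylinder_alt)
      next
        fix \<omega> assume *: "\<omega> \<in> cylinder E (n + m) A2 e2"
        then have "\<omega> \<in> \<Omega>" and all: "\<And>k. k < n + m \<Longrightarrow> fst (\<omega> k) \<in> A2 k \<and> snd (\<omega> k) = e2 k"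
          by (auto simp: cylinder_alt)
        have "fst (\<omega> k) \<in> A' k \<and> snd (\<omega> k) = e' k" if "k < n" for k
          using all[of k] that low[of k] by simp
        moreover have "fst (\<omega> (n + k)) \<in> A k \<and> snd (\<omega> (n + k)) = es k" if "k < m" for k
          using all[of "n + k"] that by (simp add: A2 e2)
        ultimately have "\<omega> \<in> C \<inter> S" using \<open>\<omega> \<in> \<Omega>\<close> by (simp add: C' cylinder_alt S_def)
        then show "\<omega> \<in> C \<inter> J \<inter> S" using CJ by blast
      qed
      then have "measure M (C \<inter> J \<inter> S) =
          (if admissible E (map e2 [0..<n + m]) \<and> fst (e2 0) = i then \<Prod>k<n + m. wt (e2 k) (A2 k) else 0)"
      proof (simp only:, intro measure_cylinder)
        show "A2 k \<in> sets borel \<and> e2 k \<in> E" if "k < n + m" for k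
          using C'(2)[of k] A[of "k - n"] esE[of "k - n"] that by (auto simp: A2_def e2_def)
      qed (use n in simp)
      also have "map e2 [0..<n + m] = map e' [0..<n] @ map es [0..<m]"
        by (rule nth_equalityI) (auto simp: nth_append e2_def)
      also have "admissible E (map e' [0..<n] @ map es [0..<m]) \<longleftrightarrow> admissible E (map e' [0..<n])"
        using adm n m True
        by (auto simp: admissible_iff successively_append_iff last_map hd_map)
      also have "fst (e2 0) = fst (e' 0)" using n by (simp add: e2_def)
      also have "(\<Prod>k<n + m. wt (e2 k) (A2 k)) = (\<Prod>k<n. wt (e' k) (A' k)) * c"
        unfolding prod_lessThan_add c_def A2 e2 using low by (intro arg_cong2[where f = "(*)"] prod.cong) auto
      finally have "measure M (C \<inter> J \<inter> S) =
          (if admissible E (map e' [0..<n]) \<and> fst (e' 0) = i then (\<Prod>k<n. wt (e' k) (A' k)) * c else 0)" .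
      moreover have "measure M (C \<inter> J) =
          (if admissible E (map e' [0..<n]) \<and> fst (e' 0) = i then \<Prod>k<n. wt (e' k) (A' k) else 0)"
        unfolding CJ unfolding C' by (rule measure_cylinder[OF n C'(2)])
      ultimately show ?thesis by simp
    qed
  qed
  \<comment> \<open>Complements in Dynkin's argument require the identity for the whole space, which
    is the disjoint union of the rectangles over all edge words of length n.\<close>
  have full: "measure M (\<Omega> \<inter> J \<inter> S) = c * measure M (\<Omega> \<inter> J)"
  proof -
    let ?I = "{..<n} \<rightarrow>\<^sub>E E"
    let ?C = "\<lambda>e. cylinder E n (\<lambda>_. UNIV) e"
    have I: "finite ?I" by (intro finite_PiE finite_edges) auto
    have C: "?C e \<in> rectangles E n" if "e \<in> ?I" for e
      by (rule rectanglesI) (use that in \<open>auto simp: PiE_iff\<close>)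
    have CM: "?C e \<in> sets M" for e unfolding sets_M by (rule cylinder_sets) simp
    have disj: "disjoint_family_on (\<lambda>e. ?C e \<inter> T) ?I" for T
      unfolding disjoint_family_on_def
    proof (intro ballI impI)
      fix e e' assume e: "e \<in> ?I" "e' \<in> ?I" "e \<noteq> e'"
      then obtain k where "k < n" "e k \<noteq> e' k" by (metis PiE_ext lessThan_iff)
      then show "?C e \<inter> T \<inter> (?C e' \<inter> T) = {}" by (auto simp: cylinder_alt)
    qed
    have "measure M (\<Omega> \<inter> T) = (\<Sum>e\<in>?I. measure M (?C e \<inter> T))" if "T \<in> sets M" for T
    proof -
      have "measure M (\<Union>e\<in>?I. ?C e \<inter> T) = (\<Sum>e\<in>?I. measure M (?C e \<inter> T))"
        by (rule finite_measure_finite_Union) (use I CM that disj in auto)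
      moreover have "\<Omega> \<inter> T = (\<Union>e\<in>?I. ?C e \<inter> T)" using cylinder_cover[of n] by blast
      ultimately show ?thesis by simp
    qed
    from this[OF J] this[OF sets.Int[OF J S]] cyl[OF C] show ?thesis
      by (simp add: sum_distrib_left Int_assoc)
  qed
  have "B \<in> sigma_sets \<Omega> (rectangles E n)" using B by (simp add: sets_history)
  from Int_stable_rectangles[OF n] rectangles_Pow this
  have "measure M (B \<inter> J \<inter> S) = c * measure M (B \<inter> J)"
  proof (induction rule: sigma_sets_induct_disjoint)
    case (basic C)
    then show ?case by (rule cyl)
  next
    case empty
    show ?case by simp
  next
    case (compl C)
    have C: "C \<in> sets M" using compl(1) history_M[of C n] by (simp add: sets_history)
    have "measure M ((\<Omega> - C) \<inter> T) = measure M (\<Omega> \<inter> T) - measure M (C \<inter> T)" if "T \<in> sets M" for T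
    proof -
      have "(\<Omega> - C) \<inter> T = (\<Omega> \<inter> T) - (C \<inter> T)" by blast
      moreover have "C \<subseteq> \<Omega>" using C sets.sets_into_space space_M by blast
      then have "C \<inter> T \<subseteq> \<Omega> \<inter> T" by blast
      moreover have "\<Omega> \<inter> T \<in> sets M" using that by (metis sets.Int sets.top space_M)
      ultimately show ?thesis using C that by (metis finite_measure_Diff sets.Int)
    qed
    from this[OF J] this[OF sets.Int[OF J S]] full compl(2) show ?case
      by (simp add: Int_assoc right_diff_distrib)
  next
    case (union C)
    have C: "C k \<in> sets M" for k using union(2) history_M[of "C k" n] by (auto simp: sets_history)
    have sums: "(\<lambda>k. measure M (C k \<inter> T)) sums measure M ((\<Union>k. C k) \<inter> T)" if "T \<in> sets M" for T
    proof -
      have "(\<Union>k. C k) \<inter> T = (\<Union>k. C k \<inter> T)" by blast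
      moreover have "disjoint_family (\<lambda>k. C k \<inter> T)" using union(1) by (auto simp: disjoint_family_on_def)
      ultimately show ?thesis using C that by (simp only:) (rule finite_measure_UNION; auto)
    qed
    have "(\<lambda>k. c * measure M (C k \<inter> J)) sums (c * measure M ((\<Union>k. C k) \<inter> J))"
      by (intro sums_mult sums J)
    moreover have "(\<lambda>k. c * measure M (C k \<inter> J)) sums measure M ((\<Union>k. C k) \<inter> J \<inter> S)"
      using sums[OF sets.Int[OF J S]] union(3) by (simp add: Int_assoc)
    ultimately show ?case by (metis sums_unique2)
  qed
  then show ?thesis by (simp add: c_def)
qed

section \<open>Almost every orbit enters the trapping sets\<close>

text \<open>Finitely many cylinders cover N, one for each edge word, and each is null for one of two
  reasons: the word is inadmissible, or some letter is confined to a set of weight 0.\<close>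

lemma null_cylinder_cover:
  assumes "n \<ge> 1" "N \<in> sets M"
    and A: "\<And>e k. e \<in> {..<n} \<rightarrow>\<^sub>E E \<Longrightarrow> k < n \<Longrightarrow> A e k \<in> sets borel"
    and sub: "\<And>\<omega> e. e \<in> {..<n} \<rightarrow>\<^sub>E E \<Longrightarrow> \<omega> \<in> N \<Longrightarrow> (\<And>k. k < n \<Longrightarrow> snd (\<omega> k) = e k) \<Longrightarrow>
      (\<forall>k<n. fst (\<omega> k) \<in> A e k) \<and> (\<not> admissible E (map e [0..<n]) \<or> (\<exists>k<n. wt (e k) (A e k) = 0))"
  shows "N \<in> null_sets M"
proof -
  let ?J = "{e \<in> {..<n} \<rightarrow>\<^sub>E E. \<not> admissible E (map e [0..<n]) \<or> (\<exists>k<n. wt (e k) (A e k) = 0)}"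
  have I: "finite ?J" by (rule finite_subset[of _ "{..<n} \<rightarrow>\<^sub>E E"]) (auto intro!: finite_PiE finite_edges)
  have "cylinder E n (A e) e \<in> null_sets M" if e: "e \<in> ?J" for e
  proof (rule null_setsI)
    have "measure M (cylinder E n (A e) e) = 0"
      using e A assms(1) by (subst measure_cylinder) (auto simp: PiE_iff prod_zero_iff intro!: prod_zero)
    then show "emeasure M (cylinder E n (A e) e) = 0" by (simp add: emeasure_eq_measure)
    show "cylinder E n (A e) e \<in> sets M" unfolding sets_M using e A by (intro cylinder_sets) auto
  qed
  then have "(\<Union>e\<in>?J. cylinder E n (A e) e) \<in> null_sets M"
    using I by (intro null_sets.finite_UN) auto
  moreover have "N \<subseteq> (\<Union>e\<in>?J. cylinder E n (A e) e)"
  proof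
    fix \<omega> assume \<omega>: "\<omega> \<in> N"
    then have \<Omega>: "\<omega> \<in> \<Omega>" using assms(2) sets.sets_into_space space_M by blast
    define e where "e = restrict (\<lambda>j. snd (\<omega> j)) {..<n}"
    have e: "e \<in> {..<n} \<rightarrow>\<^sub>E E" using \<Omega> by (auto simp: e_def path_edge_in)
    have s: "snd (\<omega> k) = e k" if "k < n" for k using that by (simp add: e_def)
    from sub[OF e \<omega> s] have "e \<in> ?J" "\<omega> \<in> cylinder E n (A e) e" using e \<Omega> s by (auto simp: cylinder_alt)
    then show "\<omega> \<in> (\<Union>e\<in>?J. cylinder E n (A e) e)" by blast
  qed
  ultimately show ?thesis using assms(2) null_sets_subset by blast
qed

text \<open>A break between two consecutive edges makes the edge word of length n + 2
  inadmissible.\<close>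

lemma chain_null: "{\<omega> \<in> \<Omega>. snd (snd (\<omega> n)) \<noteq> fst (snd (\<omega> (Suc n)))} \<in> null_sets M"
proof (rule null_cylinder_cover[of "n + 2" _ "\<lambda>_ _. UNIV"])
  have "{\<omega> \<in> \<Omega>. snd (snd (\<omega> n)) \<noteq> fst (snd (\<omega> (Suc n)))} =
      (\<Union>(a, b)\<in>{(a, b) \<in> E \<times> E. snd a \<noteq> fst b}. {\<omega> \<in> \<Omega>. snd (\<omega> n) \<in> {a}} \<inter> {\<omega> \<in> \<Omega>. snd (\<omega> (Suc n)) \<in> {b}})"
  proof (intro set_eqI iffI)
    fix \<omega> assume "\<omega> \<in> {\<omega> \<in> \<Omega>. snd (snd (\<omega> n)) \<noteq> fst (snd (\<omega> (Suc n)))}"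
    then show "\<omega> \<in> (\<Union>(a, b)\<in>{(a, b) \<in> E \<times> E. snd a \<noteq> fst b}. {\<omega> \<in> \<Omega>. snd (\<omega> n) \<in> {a}} \<inter> {\<omega> \<in> \<Omega>. snd (\<omega> (Suc n)) \<in> {b}})"
      by (intro UN_I[of "(snd (\<omega> n), snd (\<omega> (Suc n)))"]) (simp_all add: path_edge_in)
  qed auto
  also have "\<dots> \<in> sets M"
  proof -
    have "finite {(a, b) \<in> E \<times> E. snd a \<noteq> fst b}"
      by (rule finite_subset[of _ "E \<times> E"]) (auto intro: finite_edges)
    moreover have "{\<omega> \<in> \<Omega>. snd (\<omega> n) \<in> {a}} \<inter> {\<omega> \<in> \<Omega>. snd (\<omega> (Suc n)) \<in> {b}} \<in> sets M" for a b
      unfolding sets_M by (intro sets.Int path_edge_set)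
    ultimately show ?thesis by (auto intro!: sets.finite_UN)
  qed
  finally show "{\<omega> \<in> \<Omega>. snd (snd (\<omega> n)) \<noteq> fst (snd (\<omega> (Suc n)))} \<in> sets M" .
next
  fix \<omega> e assume "\<omega> \<in> {\<omega> \<in> \<Omega>. snd (snd (\<omega> n)) \<noteq> fst (snd (\<omega> (Suc n)))}"
    and "\<And>k. k < n + 2 \<Longrightarrow> snd (\<omega> k) = e k"
  then have ne: "snd (e n) \<noteq> fst (e (Suc n))" by auto
  have "\<not> admissible E (map e [0..<n + 2])"
  proof
    assume "admissible E (map e [0..<n + 2])"
    then have "Suc n < length (map e [0..<n + 2]) \<longrightarrow> snd (map e [0..<n + 2] ! n) = fst (map e [0..<n + 2] ! Suc n)"
      unfolding admissible_def by blast
    with ne show False by (simp del: upt_Suc)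
  qed
  then show "(\<forall>k<n + 2. fst (\<omega> k) \<in> UNIV) \<and> (\<not> admissible E (map e [0..<n + 2]) \<or> (\<exists>k<n + 2. wt (e k) UNIV = 0))"
    by simp
qed auto

text \<open>Only the last letter is constrained, to the complement of the support of its edge, which
  has weight 0.\<close>

lemma support_null: "{\<omega> \<in> \<Omega>. fst (\<omega> n) \<notin> edge_support \<tau> (snd (\<omega> n))} \<in> null_sets M"
proof (rule null_cylinder_cover[of "Suc n" _ "\<lambda>e k. if k = n then - edge_support \<tau> (e n) else UNIV"])
  have cl: "- edge_support \<tau> e \<in> sets borel" for e
    unfolding edge_support_def by (intro borel_open open_Compl closed_topological_support)
  have "{\<omega> \<in> \<Omega>. fst (\<omega> n) \<notin> edge_support \<tau> (snd (\<omega> n))} =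
      (\<Union>a\<in>E. ((\<lambda>\<omega>. fst (\<omega> n)) -` (- edge_support \<tau> a) \<inter> \<Omega>) \<inter> {\<omega> \<in> \<Omega>. snd (\<omega> n) \<in> {a}})"
  proof (intro set_eqI iffI)
    fix \<omega> assume "\<omega> \<in> {\<omega> \<in> \<Omega>. fst (\<omega> n) \<notin> edge_support \<tau> (snd (\<omega> n))}"
    then show "\<omega> \<in> (\<Union>a\<in>E. ((\<lambda>\<omega>. fst (\<omega> n)) -` (- edge_support \<tau> a) \<inter> \<Omega>) \<inter> {\<omega> \<in> \<Omega>. snd (\<omega> n) \<in> {a}})"
      by (intro UN_I[of "snd (\<omega> n)"]) (simp_all add: path_edge_in)
  qed auto
  also have "\<dots> \<in> sets M"
    unfolding sets_M
    by (intro sets.finite_UN finite_edges sets.Int[OF measurable_sets[OF measurable_path_map cl] path_edge_set])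
  finally show "{\<omega> \<in> \<Omega>. fst (\<omega> n) \<notin> edge_support \<tau> (snd (\<omega> n))} \<in> sets M" .
  show "(if k = n then - edge_support \<tau> (e n) else UNIV) \<in> sets borel" for e k using cl by simp
next
  fix \<omega> e assume e: "e \<in> {..<Suc n} \<rightarrow>\<^sub>E E"
    and \<omega>: "\<omega> \<in> {\<omega> \<in> \<Omega>. fst (\<omega> n) \<notin> edge_support \<tau> (snd (\<omega> n))}"
    and s: "\<And>k. k < Suc n \<Longrightarrow> snd (\<omega> k) = e k"
  have "e n \<in> E" using e by auto
  then have "emeasure (edge_measure \<tau> (e n)) (- edge_support \<tau> (e n)) = 0"
    unfolding edge_support_def using edge_measure_facts(1,2)[OF mrds] by (intro emeasure_outside_support) auto
  then have "wt (e n) (- edge_support \<tau> (e n)) = 0" by (simp add: measure_def)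
  then show "(\<forall>k<Suc n. fst (\<omega> k) \<in> (if k = n then - edge_support \<tau> (e n) else UNIV)) \<and>
      (\<not> admissible E (map e [0..<Suc n]) \<or>
       (\<exists>k<Suc n. wt (e k) (if k = n then - edge_support \<tau> (e n) else UNIV) = 0))"
    using \<omega> s[of n] by auto
qed simp

end

text \<open>Evaluation is jointly continuous: replacing f by g moves a value by at most dist f g,
  and replacing x by y is controlled by continuity of f. Each accounts for r / 2; the rest is
  induction on the word.\<close>

lemma comp_maps_neighbourhood:
  assumes "open S" "comp_maps fs x \<in> S"
  shows "\<exists>Y As. open Y \<and> x \<in> Y \<and> list_all2 (\<lambda>f A. open A \<and> f \<in> A) fs As \<and>
    (\<forall>y\<in>Y. \<forall>gs. list_all2 (\<lambda>g A. g \<in> A) gs As \<longrightarrow> comp_maps gs y \<in> S)"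
  using assms(2)
proof (induction fs arbitrary: x)
  case Nil
  then show ?case using assms(1) by (intro exI[of _ S] exI[of _ "[]"]) auto
next
  case (Cons f fs)
  have "comp_maps fs (app f x) \<in> S" using Cons.prems by simp
  from Cons.IH[OF this] obtain Y As where Y: "open Y" "app f x \<in> Y"
    and As: "list_all2 (\<lambda>f A. open A \<and> f \<in> A) fs As"
    and imp: "\<And>y gs. y \<in> Y \<Longrightarrow> list_all2 (\<lambda>g A. g \<in> A) gs As \<Longrightarrow> comp_maps gs y \<in> S" by blast
  obtain r where r: "r > 0" "ball (app f x) r \<subseteq> Y" using Y by (meson open_contains_ball)
  define Y' where "Y' = app f -` ball (app f x) (r / 2)"
  define A where "A = ball f (r / 2)"
  have "open Y'" unfolding Y'_def by (rule open_vimage[OF open_ball continuous_on_app])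
  moreover have "x \<in> Y'" using r(1) by (simp add: Y'_def)
  moreover have "list_all2 (\<lambda>f A. open A \<and> f \<in> A) (f # fs) (A # As)" using As r(1) by (simp add: A_def)
  moreover have "comp_maps gs y \<in> S" if y: "y \<in> Y'" and gs: "list_all2 (\<lambda>g A. g \<in> A) gs (A # As)" for y gs
  proof -
    obtain g gs' where g: "gs = g # gs'" "g \<in> A" "list_all2 (\<lambda>g A. g \<in> A) gs' As"
      using gs by (auto simp: list_all2_Cons2)
    have "dist (app f x) (app g y) \<le> dist (app f x) (app f y) + dist (app f y) (app g y)"
      by (rule dist_triangle)
    also have "\<dots> < r / 2 + r / 2"
      using y g(2) dist_app_le[of f y g] by (intro add_strict_mono) (auto simp: Y'_def A_def)
    finally have "app g y \<in> Y" using r(2) by auto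
    then show ?thesis using imp g by simp
  qed
  ultimately show ?case by blast
qed

lemma tendsto_diff_shift_zero:
  fixes a :: "nat \<Rightarrow> real"
  assumes "decseq a" "\<And>n. 0 \<le> a n"
  shows "(\<lambda>n. a n - a (n + m)) \<longlonglongrightarrow> 0"
proof -
  obtain L where L: "a \<longlonglongrightarrow> L" using decseq_convergent[OF assms(1), of 0] assms(2) by blast
  have "(\<lambda>n. a n - a (n + m)) \<longlonglongrightarrow> L - L"
    by (intro tendsto_diff L LIMSEQ_ignore_initial_segment)
  then show ?thesis by simp
qed

context path_measure
begin

text \<open>The maps behind a semigroup element lie in supports, so all their open neighbourhoods
  have positive weight. A single path from x into \<open>W\<close> thus becomes an event of positive
  weight that serves every starting point in Y.\<close>

lemma stopping_word:
  assumes W: "\<And>j. j \<in> verts q \<Longrightarrow> open (W j)" and j: "j \<in> verts q"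
    and reach: "\<exists>k\<in>verts q. \<exists>h\<in>semigroup_from_to q \<tau> j k. h x \<in> W k"
  shows "\<exists>Y m es A. open Y \<and> x \<in> Y \<and> m \<ge> 1 \<and> admissible E (map es [0..<m]) \<and> fst (es 0) = j \<and>
    (\<forall>k<m. open (A k) \<and> wt (es k) (A k) > 0) \<and>
    (\<forall>y\<in>Y. \<forall>g. (\<forall>k<m. g k \<in> A k) \<longrightarrow> comp_maps (map g [0..<m]) y \<in> W (snd (es (m - 1))))"
proof -
  obtain fs ws k where *: "admissible E ws" "maps_along \<tau> ws fs" "word_init ws = j" "word_term ws = k"
     "comp_maps fs x \<in> W k" "k \<in> verts q"
    using reach unfolding semigroup_from_to_def by blast
  obtain Y As where Y: "open Y" "x \<in> Y" and As: "list_all2 (\<lambda>f A. open A \<and> f \<in> A) fs As"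
    and imp: "\<And>y gs. y \<in> Y \<Longrightarrow> list_all2 (\<lambda>g A. g \<in> A) gs As \<Longrightarrow> comp_maps gs y \<in> W k"
    using comp_maps_neighbourhood[OF W[OF *(6)] *(5)] by blast
  define m where "m = length ws"
  have len: "length fs = m" "length As = m"
    using list_all2_lengthD[OF As] list_all2_lengthD[OF *(2)[unfolded maps_along_def]]
    by (simp_all add: m_def)
  have ne: "ws \<noteq> []" using *(1) by (simp add: admissible_iff)
  then have m: "m \<ge> 1" by (simp add: m_def Suc_le_eq)
  have ws: "map ((!) ws) [0..<m] = ws" by (simp add: m_def map_nth)
  show ?thesis
  proof (intro exI[of _ Y] exI[of _ m] exI[of _ "(!) ws"] exI[of _ "(!) As"] conjI Y m allI impI ballI)
    show "admissible E (map ((!) ws) [0..<m])" using *(1) ws by simp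
    show "fst (ws ! 0) = j" using *(3) ne by (simp add: word_init_def hd_conv_nth)
    fix l assume l: "l < m"
    have f: "fs ! l \<in> edge_support \<tau> (ws ! l)" using *(2) l len by (simp add: maps_along_def list_all2_conv_all_nth)
    have A: "open (As ! l)" "fs ! l \<in> As ! l" using As l len by (simp_all add: list_all2_conv_all_nth)
    show "open (As ! l)" by (rule A(1))
    have e: "ws ! l \<in> E" using *(1) l by (auto simp: admissible_iff m_def)
    have pos: "emeasure (edge_measure \<tau> (ws ! l)) (As ! l) > 0"
      using f A unfolding edge_support_def topological_support_def by blast
    have "emeasure (edge_measure \<tau> (ws ! l)) (As ! l) \<le> emeasure (edge_measure \<tau> (ws ! l)) UNIV"
      using edge_measure_facts(1)[OF mrds e] by (intro emeasure_mono) auto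
    also have "\<dots> \<le> 1" using edge_measure_facts(4)[OF mrds e] .
    finally have "emeasure (edge_measure \<tau> (ws ! l)) (As ! l) < \<infinity>"
      using ennreal_one_less_top by (simp add: le_less_trans)
    with pos show "wt (ws ! l) (As ! l) > 0"
      unfolding measure_def enn2real_positive_iff by simp
  next
    fix y g assume y: "y \<in> Y" and g: "\<forall>k<m. g k \<in> As ! k"
    have "snd (ws ! (m - 1)) = k" using *(4) ne by (simp add: word_term_def last_conv_nth m_def)
    moreover have "comp_maps (map g [0..<m]) y \<in> W k"
      by (rule imp[OF y]) (use g len in \<open>simp add: list_all2_conv_all_nth\<close>)
    ultimately show "comp_maps (map g [0..<m]) y \<in> W (snd (ws ! (m - 1)))" by simp
  qed
qed

text \<open>Let \<open>a n\<close> be the probability of avoiding the sets \<open>W\<close> up to time \<open>n\<close>. By compactness finitely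
  many stopping words suffice for all positions, and following one of them costs
  \<open>a n - a (n + m)\<close>, which tends to zero.\<close>

lemma avoiding_null:
  assumes W: "\<And>j. j \<in> verts q \<Longrightarrow> open (W j)"
    and reach: "\<And>x j. j \<in> verts q \<Longrightarrow> \<exists>k\<in>verts q. \<exists>h\<in>semigroup_from_to q \<tau> j k. h x \<in> W k"
  shows "{\<omega> \<in> \<Omega>. \<forall>k. orbit z (Suc k) \<omega> \<notin> W (snd (snd (\<omega> k)))} \<in> null_sets M"
proof -
  have vert: "snd (snd (\<omega> k)) \<in> verts q" if "\<omega> \<in> \<Omega>" for \<omega> k
    using path_edge_in[OF that, of k] edge_measure_facts(7)[OF mrds] by blast
  \<comment> \<open>Positions after 1, ..., n letters are tested, each against the end of the edge
    just used, so the event belongs to the history of n letters.\<close>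
  define D where "D n = {\<omega> \<in> \<Omega>. \<forall>k<n. orbit z (Suc k) \<omega> \<notin> W (snd (snd (\<omega> k)))}" for n
  have D_hist: "D n \<in> sets (history E n)" for n
  proof -
    have "D n = \<Omega> - (\<Union>k\<in>{..<n}. \<Union>j\<in>verts q. {\<omega> \<in> \<Omega>. orbit z (Suc k) \<omega> \<in> W j \<and> snd (\<omega> k) \<in> {e. snd e = j}})"
      using vert by (fastforce simp: D_def)
    also have "\<dots> \<in> sets (history E n)"
    proof -
      have "{\<omega> \<in> \<Omega>. orbit z (Suc k) \<omega> \<in> W j \<and> snd (\<omega> k) \<in> {e. snd e = j}} \<in> sets (history E n)"
        if "k < n" "j \<in> verts q" for k j
        using that by (intro orbit_event finite_edges W) auto
      then have "(\<Union>k\<in>{..<n}. \<Union>j\<in>verts q. {\<omega> \<in> \<Omega>. orbit z (Suc k) \<omega> \<in> W j \<and> snd (\<omega> k) \<in> {e. snd e = j}})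
          \<in> sets (history E n)"
        by (intro sets.finite_UN) auto
      from sets.compl_sets[OF this] show ?thesis by (simp only: space_history)
    qed
    finally show ?thesis .
  qed
  have D_M: "D n \<in> sets M" for n by (rule history_M[OF D_hist])
  define a where "a n = measure M (D n)" for n
  have "decseq a"
    unfolding a_def by (intro decseq_SucI finite_measure_mono D_M) (auto simp: D_def)
  note shift = tendsto_diff_shift_zero[OF this, unfolded a_def, OF measure_nonneg, folded a_def]
  have "\<forall>x. \<forall>j\<in>verts q. \<exists>Y m es A. open Y \<and> x \<in> Y \<and> m \<ge> 1 \<and> admissible E (map es [0..<m]) \<and> fst (es 0) = j \<and>
    (\<forall>k<m. open (A k) \<and> wt (es k) (A k) > 0) \<and>
    (\<forall>y\<in>Y. \<forall>g. (\<forall>k<m. g k \<in> A k) \<longrightarrow> comp_maps (map g [0..<m]) y \<in> W (snd (es (m - 1))))"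
    using stopping_word[OF W _ reach] by blast
  then obtain Y m es A where st: "\<And>x j. j \<in> verts q \<Longrightarrow> open (Y x j) \<and> x \<in> Y x j \<and> m x j \<ge> 1 \<and>
      admissible E (map (es x j) [0..<m x j]) \<and> fst (es x j 0) = j \<and>
      (\<forall>k<m x j. open (A x j k) \<and> wt (es x j k) (A x j k) > 0) \<and>
      (\<forall>y\<in>Y x j. \<forall>g. (\<forall>k<m x j. g k \<in> A x j k) \<longrightarrow> comp_maps (map g [0..<m x j]) y \<in> W (snd (es x j (m x j - 1))))"
    by metis
  have "\<exists>X. finite X \<and> UNIV \<subseteq> (\<Union>x\<in>X. Y x j)" if j: "j \<in> verts q" for j
  proof -
    have "UNIV \<subseteq> (\<Union>x\<in>UNIV. Y x j)" using st[OF j] by blast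
    then obtain X where "finite X" "UNIV \<subseteq> (\<Union>x\<in>X. Y x j)"
      using compactE_image[OF compact_rsphere, of UNIV "\<lambda>x. Y x j"] st[OF j] by metis
    then show ?thesis by blast
  qed
  then obtain X where X: "\<And>j. j \<in> verts q \<Longrightarrow> finite (X j)" "\<And>j. j \<in> verts q \<Longrightarrow> UNIV \<subseteq> (\<Union>x\<in>X j. Y x j)"
    by metis
  define c where "c x j = (\<Prod>k<m x j. wt (es x j k) (A x j k))" for x j
  have c: "c x j > 0" if "j \<in> verts q" for x j
    unfolding c_def using st[OF that] by (intro prod_pos) auto
  \<comment> \<open>After n letters the orbit is at the vertex where edge n - 1 ends, which is why n
    >= 1 below. On this event the stopping word of (x, j) may be appended.\<close>
  define Q where "Q n x j = {\<omega> \<in> \<Omega>. orbit z n \<omega> \<in> Y x j \<and> snd (\<omega> (n - 1)) \<in> {e. snd e = j}}" for n x j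
  have Q_hist: "Q n x j \<in> sets (history E n)" if "n \<ge> 1" "j \<in> verts q" for n x j
    unfolding Q_def using that st[OF that(2), of x] by (intro orbit_event finite_edges) auto
  have cost: "c x j * measure M (D n \<inter> Q n x j) \<le> a n - a (n + m x j)" if n: "n \<ge> 1" and j: "j \<in> verts q" for n x j
  proof -
    note stj = st[OF j, of x]
    let ?J = "{\<omega> \<in> \<Omega>. snd (\<omega> (n - 1)) \<in> {e. snd e = fst (es x j 0)}}"
    let ?S = "{\<omega> \<in> \<Omega>. \<forall>k<m x j. fst (\<omega> (n + k)) \<in> A x j k \<and> snd (\<omega> (n + k)) = es x j k}"
    have B: "D n \<inter> Q n x j \<in> sets (history E n)" by (intro sets.Int D_hist Q_hist n j)
    have "measure M (D n \<inter> Q n x j \<inter> ?J \<inter> ?S) = c x j * measure M (D n \<inter> Q n x j \<inter> ?J)"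
      unfolding c_def using stj by (intro markov n B) auto
    moreover have "D n \<inter> Q n x j \<inter> ?J = D n \<inter> Q n x j" using stj by (auto simp: Q_def)
    \<comment> \<open>Following the stopping word puts the orbit into \<open>W\<close> after n + m x
      j letters, which is the last position tested by D (n + m x j).\<close>
    moreover have "D n \<inter> Q n x j \<inter> ?S \<subseteq> D n - D (n + m x j)"
    proof
      fix \<omega> assume \<omega>: "\<omega> \<in> D n \<inter> Q n x j \<inter> ?S"
      have "comp_maps (map (\<lambda>k. fst (\<omega> (n + k))) [0..<m x j]) (orbit z n \<omega>) \<in> W (snd (es x j (m x j - 1)))"
        using stj \<omega> by (auto simp: Q_def)
      moreover have "m x j - 1 < m x j" using stj by simp
      then have "snd (\<omega> (n + (m x j - 1))) = es x j (m x j - 1)" using \<omega> by blast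
      ultimately have "orbit z (n + m x j) \<omega> \<in> W (snd (snd (\<omega> (n + (m x j - 1)))))"
        by (simp only: orbit_add)
      moreover have "n + m x j = Suc (n + (m x j - 1))" using stj by simp
      ultimately have "\<omega> \<notin> D (n + m x j)"
        unfolding D_def by (metis (no_types, lifting) lessI mem_Collect_eq)
      then show "\<omega> \<in> D n - D (n + m x j)" using \<omega> by blast
    qed
    then have "measure M (D n \<inter> Q n x j \<inter> ?S) \<le> measure M (D n - D (n + m x j))"
      by (intro finite_measure_mono sets.Diff D_M)
    moreover have "measure M (D n - D (n + m x j)) = a n - a (n + m x j)"
      unfolding a_def by (intro finite_measure_Diff D_M) (auto simp: D_def)
    ultimately show ?thesis by simp
  qed
  define T where "T = (SIGMA j:verts q. X j)"
  have T: "finite T" unfolding T_def using X(1) by (intro finite_SigmaI) auto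
  \<comment> \<open>At time n every path of D n is in one of finitely many events Q n x j. Each of
    them costs a difference of values of the decreasing sequence a; the lengths m x j differ, but
    each difference tends to 0 for its own fixed length.\<close>
  have "a n \<le> (\<Sum>(j, x)\<in>T. (a n - a (n + m x j)) / c x j)" if n: "n \<ge> 1" for n
  proof -
    have "D n \<subseteq> (\<Union>t\<in>T. D n \<inter> Q n (snd t) (fst t))"
    proof
      fix \<omega> assume \<omega>: "\<omega> \<in> D n"
      then have \<Omega>: "\<omega> \<in> \<Omega>" by (simp add: D_def)
      define j where "j = snd (snd (\<omega> (n - 1)))"
      have j: "j \<in> verts q" unfolding j_def by (rule vert[OF \<Omega>])
      obtain x where "x \<in> X j" "orbit z n \<omega> \<in> Y x j" using subsetD[OF X(2)[OF j] UNIV_I] by blast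
      then have "(j, x) \<in> T" "\<omega> \<in> Q n x j" using j \<Omega> by (auto simp: T_def Q_def j_def)
      with \<omega> show "\<omega> \<in> (\<Union>t\<in>T. D n \<inter> Q n (snd t) (fst t))" by force
    qed
    moreover have QM: "D n \<inter> Q n (snd t) (fst t) \<in> sets M" if "t \<in> T" for t
      using that n by (intro history_M[OF sets.Int[OF D_hist Q_hist]]) (auto simp: T_def)
    ultimately have "a n \<le> measure M (\<Union>t\<in>T. D n \<inter> Q n (snd t) (fst t))"
      unfolding a_def using T by (intro finite_measure_mono sets.finite_UN) auto
    also have "\<dots> \<le> (\<Sum>t\<in>T. measure M (D n \<inter> Q n (snd t) (fst t)))"
      using T QM by (intro finite_measure_subadditive_finite) auto
    also have "\<dots> \<le> (\<Sum>(j, x)\<in>T. (a n - a (n + m x j)) / c x j)"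
    proof (rule sum_mono, clarify)
      fix j x assume "(j, x) \<in> T"
      then have j: "j \<in> verts q" by (simp add: T_def)
      show "measure M (D n \<inter> Q n (snd (j, x)) (fst (j, x))) \<le> (a n - a (n + m x j)) / c x j"
        using cost[OF n j, of x] c[OF j, of x] by (simp add: pos_le_divide_eq mult.commute)
    qed
    finally show ?thesis .
  qed
  moreover have "(\<lambda>n. \<Sum>(j, x)\<in>T. (a n - a (n + m x j)) / c x j) \<longlonglongrightarrow> (\<Sum>(j, x)\<in>T. 0 / c x j)"
    unfolding case_prod_unfold using c by (intro tendsto_sum tendsto_divide shift tendsto_const) (auto simp: T_def less_imp_neq[symmetric])
  then have lim: "(\<lambda>n. \<Sum>(j, x)\<in>T. (a n - a (n + m x j)) / c x j) \<longlonglongrightarrow> 0" by simp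
  define Z where "Z = {\<omega> \<in> \<Omega>. \<forall>k. orbit z (Suc k) \<omega> \<notin> W (snd (snd (\<omega> k)))}"
  have Z: "Z = (\<Inter>n. D n)" by (auto simp: Z_def D_def)
  have ZM: "Z \<in> sets M" unfolding Z using D_M by blast
  have "measure M Z \<le> (\<Sum>(j, x)\<in>T. (a n - a (n + m x j)) / c x j)" if "n \<ge> 1" for n
  proof -
    have "measure M Z \<le> a n" unfolding a_def by (intro finite_measure_mono D_M) (auto simp: Z)
    then show ?thesis using calculation[OF that] by linarith
  qed
  then have "measure M Z \<le> 0" by (intro LIMSEQ_le_const[OF lim]) blast
  then have "measure M Z = 0" using measure_nonneg[of M Z] by linarith
  then show ?thesis
    using ZM unfolding Z_def by (intro null_setsI) (simp_all add: emeasure_eq_measure)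
qed

end

section \<open>The almost sure bound for the exponent\<close>

theorem mainTheorem2:
  fixes q :: nat
    and \<tau> :: system
    and p :: "nat \<Rightarrow> real"
    and \<mu> :: "nat \<Rightarrow> (nat \<Rightarrow> ratmap \<times> edge) measure"
  assumes "\<tau> \<in> MRDS q UNIV"
    and "mean_stable q \<tau>"
    and "stationary_vector q \<tau> p"
    and "\<And>i. i \<in> verts q \<Longrightarrow> is_path_measure q \<tau> i (\<mu> i)"
  shows "\<exists>\<alpha>::real. \<alpha> < 0 \<and>
    (\<forall>z. \<exists>F \<in> sets (path_borel (edges q \<tau>)).
       emeasure (mixture q \<tau> p \<mu>) F = 1 \<and>
       (\<forall>\<omega>\<in>F. limsup (\<lambda>n.
            ext_ln (sph_deriv_norm (comp_maps (map (\<lambda>k. fst (\<omega> k)) [0..<n])) z) / ereal (real n))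
          \<le> ereal \<alpha>))"
proof -
  let ?E = "edges q \<tau>"
  let ?\<Omega> = "space (path_borel ?E)"
  have mrds: "is_MRDS q \<tau>" and irr: "irreducible_system q \<tau>"
    using assms(1) by (auto simp: MRDS_def)
  from assms(2)[unfolded mean_stable_def] obtain N U W where N: "N \<ge> 1"
    and oUW: "\<forall>i\<in>verts q. open (U i) \<and> U i \<noteq> {} \<and> open (W i) \<and> W i \<noteq> {}"
    and nest: "\<forall>i\<in>verts q. U i \<subseteq> closure (U i) \<and> closure (U i) \<subseteq> W i \<and>
        W i \<subseteq> closure (W i) \<and> closure (W i) \<subseteq> Fatou q \<tau> i"
    and trp: "\<forall>es fs. length es = N \<and> admissible ?E es \<and> maps_along \<tau> es fs \<longrightarrow>
        closure (comp_maps fs ` W (word_init es)) \<subseteq> U (word_term es)"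
    and rch: "\<forall>z. \<forall>i\<in>verts q. \<exists>j\<in>verts q. \<exists>h\<in>semigroup_from_to q \<tau> i j. h z \<in> W j"
    by (elim exE conjE) (rule that; assumption)
  have oW: "\<And>i. i \<in> verts q \<Longrightarrow> open (W i)" using oUW by blast
  have UW: "\<And>i. i \<in> verts q \<Longrightarrow> closure (U i) \<subseteq> W i" using nest by blast
  have WF: "\<And>i. i \<in> verts q \<Longrightarrow> closure (W i) \<subseteq> Fatou q \<tau> i" using nest by blast
  have trap: "closure (comp_maps fs ` W (word_init es)) \<subseteq> U (word_term es)"
    if "length es = N" "admissible ?E es" "maps_along \<tau> es fs" for es fs
    using trp that by blast
  have reach: "\<exists>j\<in>verts q. \<exists>h\<in>semigroup_from_to q \<tau> i j. h z \<in> W j" if "i \<in> verts q" for z i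
    using rch that by blast
  have "\<exists>\<alpha><0. \<forall>f e m z. (\<forall>n. e n \<in> ?E) \<longrightarrow> (\<forall>n. snd (e n) = fst (e (Suc n))) \<longrightarrow>
      (\<forall>n. f n \<in> edge_support \<tau> (e n)) \<longrightarrow>
      comp_maps (map f [0..<Suc m]) z \<in> W (snd (e m)) \<longrightarrow>
      limsup (\<lambda>n. ext_ln (sph_deriv_norm (comp_maps (map f [0..<n])) z) / ereal (real n)) \<le> ereal \<alpha>"
    by (rule trapped_orbit_exponent[OF mrds irr N oW UW WF trap])
  then obtain \<alpha> :: real where \<alpha>: "\<alpha> < 0"
    "\<forall>f e m z. (\<forall>n. e n \<in> ?E) \<longrightarrow> (\<forall>n. snd (e n) = fst (e (Suc n))) \<longrightarrow>
      (\<forall>n. f n \<in> edge_support \<tau> (e n)) \<longrightarrow>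
      comp_maps (map f [0..<Suc m]) z \<in> W (snd (e m)) \<longrightarrow>
      limsup (\<lambda>n. ext_ln (sph_deriv_norm (comp_maps (map f [0..<n])) z) / ereal (real n)) \<le> ereal \<alpha>"
    by (elim exE conjE) (rule that; assumption)
  show ?thesis
  proof (intro exI[of _ \<alpha>] conjI allI \<alpha>(1))
    fix z
    \<comment> \<open>The set depends on z but not on the initial vertex, and it is null for every
      \<mu> i; its complement therefore has full measure for the mixture. Outside \<open>Z\<close>
      the path is a chain, uses maps from the supports, and enters \<open>W\<close> at some time,
      which is all that the choice of \<alpha> asks for.\<close>
    define Z where "Z = (\<Union>n. {\<omega> \<in> ?\<Omega>. snd (snd (\<omega> n)) \<noteq> fst (snd (\<omega> (Suc n)))}) \<union>
      (\<Union>n. {\<omega> \<in> ?\<Omega>. fst (\<omega> n) \<notin> edge_support \<tau> (snd (\<omega> n))}) \<union>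
      {\<omega> \<in> ?\<Omega>. \<forall>k. orbit z (Suc k) \<omega> \<notin> W (snd (snd (\<omega> k)))}"
    have Z: "Z \<in> null_sets (\<mu> i)" "sets (\<mu> i) = sets (path_borel ?E)" "emeasure (\<mu> i) ?\<Omega> = 1"
      if i: "i \<in> verts q" for i
    proof -
      interpret path_measure q \<tau> i "\<mu> i"
        by unfold_locales (use mrds assms(4)[OF i] in auto)
      show "Z \<in> null_sets (\<mu> i)"
        unfolding Z_def using oW reach
        by (intro null_sets.Un null_sets_UN chain_null support_null avoiding_null) auto
      show "sets (\<mu> i) = sets (path_borel ?E)" by (rule sets_M)
      show "emeasure (\<mu> i) ?\<Omega> = 1"
        using assms(4)[OF i] unfolding is_path_measure_def space_M by blast
    qed
    have q: "1 \<in> verts q" using mrds by (simp add: is_MRDS_def)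
    define F where "F = ?\<Omega> - Z"
    have F: "F \<in> sets (path_borel ?E)"
      unfolding F_def using Z(1)[OF q] Z(2)[OF q] by auto
    have "emeasure (\<mu> i) F = 1" if "i \<in> verts q" for i
      unfolding F_def using Z[OF that] by (subst emeasure_Diff_null_set) auto
    then have "emeasure (mixture q \<tau> p \<mu>) F = (\<Sum>i\<in>verts q. ennreal (p i))"
      by (subst emeasure_mixture[OF Z(2) F]) simp_all
    also have "\<dots> = ennreal (\<Sum>i\<in>verts q. p i)"
      using assms(3) by (intro sum_ennreal) (auto simp: stationary_vector_def less_imp_le)
    also have "\<dots> = 1" using assms(3) by (simp add: stationary_vector_def)
    finally have "emeasure (mixture q \<tau> p \<mu>) F = 1" .
    moreover have "limsup (\<lambda>n. ext_ln (sph_deriv_norm (comp_maps (map (\<lambda>k. fst (\<omega> k)) [0..<n])) z) / ereal (real n)) \<le> ereal \<alpha>"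
      if \<omega>: "\<omega> \<in> F" for \<omega>
    proof -
      have \<Omega>: "\<omega> \<in> ?\<Omega>" using \<omega> by (simp add: F_def)
      then obtain k where "orbit z (Suc k) \<omega> \<in> W (snd (snd (\<omega> k)))" using \<omega> unfolding F_def Z_def by blast
      then have "comp_maps (map (\<lambda>k. fst (\<omega> k)) [0..<Suc k]) z \<in> W (snd (snd (\<omega> k)))"
        by (simp only: orbit_def)
      moreover have "snd (snd (\<omega> n)) = fst (snd (\<omega> (Suc n)))" "fst (\<omega> n) \<in> edge_support \<tau> (snd (\<omega> n))" for n
        using \<omega> \<Omega> unfolding F_def Z_def by blast+
      ultimately show ?thesis
        using \<alpha>(2)[rule_format, of "\<lambda>n. snd (\<omega> n)" "\<lambda>n. fst (\<omega> n)" k z] path_edge_in[OF \<Omega>] by blast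
    qed
    ultimately show "\<exists>F \<in> sets (path_borel ?E). emeasure (mixture q \<tau> p \<mu>) F = 1 \<and>
       (\<forall>\<omega>\<in>F. limsup (\<lambda>n. ext_ln (sph_deriv_norm (comp_maps (map (\<lambda>k. fst (\<omega> k)) [0..<n])) z) / ereal (real n))
          \<le> ereal \<alpha>)"
      using F by blast
  qed
qed

end
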